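(* Let $n\ge2$, $\lambda,x\in\mathbb{R}^n$, $d=n(n-1)$, and let $\Psi_\lambda(x)$ be the $SO(n,n)$ Whittaker wave function defined in the context. Write $\mathrm{i}=\sqrt{-1}$. Then $$\Psi_\lambda(x)=\frac{e^{-\mathrm{i}\sum_k\lambda_kx_k}}{(2\pi\mathrm{i})^d}\int_C e^{H(x,\gamma)}\prod_{k=1}^{n-2}\frac{\Gamma(\gamma_{k,k+1}+\delta_{k,k+1}+2\mathrm{i}\lambda_k)}{\Gamma(\gamma_{k,n}+\delta_{k,n}-\gamma_{k+1,n}-\delta_{k+1,n}+2\mathrm{i}\lambda_k)}$$ $$\times\prod_{1\le k<l\le n}\Gamma(\xi_{k,l}+\mathrm{i}(\lambda_k-\lambda_l))\,\Gamma(\eta_{k,l}+\mathrm{i}(\lambda_k+\lambda_l))\,\Gamma(\gamma_{k,l}-\gamma_{k+1,l})\,\Gamma(\delta_{k,l}-\delta_{k+1,l})\,d\gamma_{k,l}\,d\delta_{k,l}.$$ Here $\gamma_{k,l}=\delta_{k,l}=0$ by convention unless $1\le k<l\le n$, $$H(x,\gamma)=\sum_{2\le j<n}(\gamma_{1,j}+\delta_{1,j})(x_j-x_{j-1})+\gamma_{1,n}(x_n-x_{n-1})-\delta_{1,n}(x_{n-1}+x_n),$$ $$\xi_{k,l}=-\gamma_{k+1,l+1}-\delta_{k+1,l+1}+\gamma_{k+1,l}+\delta_{k,l},\qquad \eta_{k,l}=\gamma_{k,l+1}+\delta_{k,l+1}-\gamma_{k+1,l}-\delta_{k,l}\qquad(1\le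 k<l<n),$$ $$\xi_{k,n}=\gamma_{k,n}-\delta_{k+1,n},\qquad \eta_{k,n}=\delta_{k,n}-\gamma_{k+1,n}\qquad(1\le k<n).$$ The integration cycle $C$ is a deformation of the imaginary plane $\operatorname{Re}\gamma_{k,l}=\operatorname{Re}\delta_{k,l}=0$ (each variable running from $-\mathrm{i}\infty$ to $+\mathrm{i}\infty$) into the nonempty domain $D\subset\mathbb{C}^d$ of analyticity of the integrand, which is described by the relations $\operatorname{Re}\gamma_{k,l}>0$, $\operatorname{Re}\delta_{k,l}>0$, $\operatorname{Re}\xi_{k,l}>0$, $\operatorname{Re}\eta_{k,l}>0$ for all $1\le k<l\le n$.
   Context: Let $e_{a,b}$ be the $2n\times2n$ matrix units, $\hat k=2n+1-k$ and $\epsilon(k)=(-1)^k$. $SO(n,n)\subset SL(2n,\mathbb{R})$ is the group preserving $\sum_{i=1}^{2n}x_iy_{\hat i}$. Chevalley generators: $e_i=e_{i,i+1}-e_{2n-i,2n+1-i}$, $f_i=e_{i+1,i}-e_{2n+1-i,2n-i}$ for $1\le i\le n-2$; $e^+_{n-1}=e_{n-1,n}-e_{n+1,n+2}$, $f^+_{n-1}=e_{n,n-1}-e_{n+2,n+1}$; $e^-_{n-1}=e_{n-1,n+1}-e_{n,n+2}$, $f^-_{n-1}=e_{n+1,n-1}-e_{n+2,n}$ ($e^{\pm1}_{n-1}$ means $e^\pm_{n-1}$). For variables $t_{i,j},s_{i,j}$ ($1\le i<j\le n$), abbreviated $(t,s)$, put $X(t,s)=R_{n-1}R_{n-2}\cdots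 R_1$ with $$R_i=\exp(s_{i,i+1}e_i)\exp(s_{i,i+2}e_{i+1})\cdots\exp(s_{i,n-1}e_{n-2})\exp(s_{i,n}e_{n-1}^{\epsilon(n-i)})\exp(t_{i,n}e_{n-1}^{\epsilon(n-i+1)})\exp(t_{i,n-1}e_{n-2})\cdots\exp(t_{i,i+1}e_i)$$ (for $j<n$ both $s_{i,j}$ and $t_{i,j}$ multiply $e_{j-1}$). Let $\bar w_0$ be the matrix obtained from this product by replacing each factor $\exp(c\,e)$, $e$ a Chevalley generator with partner $f$, by $\exp(e)\exp(-f)\exp(e)$ (a lift of the longest Weyl group element). For $T=\sum_{k=1}^n(T_ke_{k,k}+T_k^{-1}e_{\hat k,\hat k})$ with $T_k>0$ and $\nu\in\mathbb{C}^n$ put $\chi_\nu(T)=\prod_kT_k^{\nu_k}$. Let $\rho_k=n-k$, $(\rho,x)=\sum_k\rho_kx_k$. Here "unipotent lower/upper triangular" refers to such matrices in $SO(n,n)$. Right Whittaker vector: for $Y$ lower triangular unipotent, $T=\sum_{k=1}^n(T_ke_{k,k}+T_k^{-1}e_{\hat k,\hat k})$ with all $T_k>0$, and all $t_{i,j},s_{i,j}>0$, $v^R_\mu(Y\,T\,X(t,s))=\chi_\mu(T)\exp(-\sum_{i<j}(t_{i,j}+s_{i,j}))$. Left Whittaker vector: for all $t_{i,j},s_{i,j}>0$ there is a unique factorization $X(-t,-s)\bar w_0=Y\,T\,X(p,q)$ with $Y$ lower triangular unipotent, $T=\sum_{k=1}^n(T_ke_{k,k}+T_k^{-1}e_{\hat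 k,\hat k})$ with all $T_k>0$, and all $p_{i,j},q_{i,j}>0$ (with $p$ in place of $t$, $q$ in place of $s$); put $v^L_\nu(X(t,s))=\chi_\nu(T)\exp(-\sum_{i<j}(p_{i,j}+q_{i,j}))$. With $\mu=\mathrm{i}\lambda-\rho$ and $h(x)=\sum_{k=1}^nx_k(e_{k,k}-e_{\hat k,\hat k})$, $$\Psi_\lambda(x)=e^{-(\rho,x)}\int_{t_{i,j},s_{i,j}>0}\overline{v^L_\mu(X(t,s))}\;v^R_\mu\big(X(t,s)e^{-h(x)}\big)\prod_{i<j}t_{i,j}^{\,j-i}s_{i,j}^{\,2n-i-j}\frac{dt_{i,j}}{t_{i,j}}\frac{ds_{i,j}}{s_{i,j}}.$$
   Formalization: For n≥3 the printed relations allow poles (e.g. γ_{1,3}=γ_{2,3}), so D also requires Re(γ_{k,l}−γ_{k+1,l})>0 and Re(δ_{k,l}−δ_{k+1,l})>0; C is any translate of the imaginary plane inside D; analyticity is stated in each variable separately. *)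

theory Defs
  imports
    "HOL-Analysis.Analysis"
    "Jordan_Normal_Form.Matrix"
    "Jordan_Normal_Form.Determinant"
begin

(* Conventions.  Indices are 1-based as usual in Lie theory, whereas the entries A $$ (i,j) of a
   matrix are 0-based; the functions mat_unit, torus_mat, cartan_mat below do the translation.
   A point of R^n or C^n is a function on nat of which only the values at 1..n are used; a
   triangular array (t_{i,j})_{1<=i<j<=n} is a function on nat * nat of which only the values on
   idx n are used. *)

definition idx :: "nat \<Rightarrow> (nat \<times> nat) set" where
  "idx n = {(i, j). 1 \<le> i \<and> i < j \<and> j \<le> n}"


section \<open>Matrices, Chevalley generators, the group\<close>

definition mat_unit :: "nat \<Rightarrow> nat \<Rightarrow> nat \<Rightarrow> real mat" where
  "mat_unit n a b = mat (2*n) (2*n) (\<lambda>(i, j). if Suc i = a \<and> Suc j = b then 1 else 0)"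

definition mat_exp :: "real mat \<Rightarrow> real mat" where
  "mat_exp A = mat (dim_row A) (dim_row A) (\<lambda>(i, j). \<Sum>k. (A ^\<^sub>m k) $$ (i, j) / fact k)"

(* sum of x_i y_{2n+1-i} over i = 1..2n *)
definition split_form :: "nat \<Rightarrow> real Matrix.vec \<Rightarrow> real Matrix.vec \<Rightarrow> real" where
  "split_form n x y = (\<Sum>i<2*n. vec_index x i * vec_index y (2*n - 1 - i))"

definition SO_split :: "nat \<Rightarrow> real mat set" where
  "SO_split n = {g \<in> carrier_mat (2*n) (2*n). Determinant.det g = 1 \<and>
     (\<forall>x \<in> carrier_vec (2*n). \<forall>y \<in> carrier_vec (2*n).
        split_form n (g *\<^sub>v x) (g *\<^sub>v y) = split_form n x y)}"

definition lower_unipotent :: "nat \<Rightarrow> real mat set" where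
  "lower_unipotent n = {Y \<in> SO_split n.
     (\<forall>i<2*n. Y $$ (i, i) = 1) \<and> (\<forall>j<2*n. \<forall>i<j. Y $$ (i, j) = 0)}"

definition torus_mat :: "nat \<Rightarrow> (nat \<Rightarrow> real) \<Rightarrow> real mat" where
  "torus_mat n T = mat (2*n) (2*n)
     (\<lambda>(i, j). if i \<noteq> j then 0 else if i < n then T (Suc i) else inverse (T (2*n - i)))"

definition cartan_mat :: "nat \<Rightarrow> (nat \<Rightarrow> real) \<Rightarrow> real mat" where
  "cartan_mat n x = mat (2*n) (2*n)
     (\<lambda>(i, j). if i \<noteq> j then 0 else if i < n then x (Suc i) else - x (2*n - i))"

definition sgn_pow :: "nat \<Rightarrow> int" where
  "sgn_pow k = (-1) ^ k"

(* Lin i labels e_i, f_i for 1 <= i <= n-2;  Spin 1 and Spin (-1) label e^+_{n-1}, f^+_{n-1} and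
   e^-_{n-1}, f^-_{n-1}. *)
datatype node = Lin nat | Spin int

fun chev_e :: "nat \<Rightarrow> node \<Rightarrow> real mat" where
  "chev_e n (Lin i) = mat_unit n i (i+1) - mat_unit n (2*n-i) (2*n+1-i)"
| "chev_e n (Spin s) =
     (if s = 1 then mat_unit n (n-1) n - mat_unit n (n+1) (n+2)
      else mat_unit n (n-1) (n+1) - mat_unit n n (n+2))"

fun chev_f :: "nat \<Rightarrow> node \<Rightarrow> real mat" where
  "chev_f n (Lin i) = mat_unit n (i+1) i - mat_unit n (2*n+1-i) (2*n-i)"
| "chev_f n (Spin s) =
     (if s = 1 then mat_unit n n (n-1) - mat_unit n (n+2) (n+1)
      else mat_unit n (n+1) (n-1) - mat_unit n (n+2) n)"

(* A pair (c, a) stands for the factor exp(c e_a).  Keeping the word itself, and not only the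
   product, gives X and the lift of the longest Weyl group element from the same factorization. *)
definition row_word ::
  "nat \<Rightarrow> (nat \<times> nat \<Rightarrow> real) \<Rightarrow> (nat \<times> nat \<Rightarrow> real) \<Rightarrow> nat \<Rightarrow> (real \<times> node) list" where
  "row_word n t s i =
     map (\<lambda>j. (s (i, j), Lin (j-1))) [i+1..<n]
     @ [(s (i, n), Spin (sgn_pow (n-i))), (t (i, n), Spin (sgn_pow (n-i+1)))]
     @ map (\<lambda>j. (t (i, j), Lin (j-1))) (rev [i+1..<n])"

definition full_word ::
  "nat \<Rightarrow> (nat \<times> nat \<Rightarrow> real) \<Rightarrow> (nat \<times> nat \<Rightarrow> real) \<Rightarrow> (real \<times> node) list" where
  "full_word n t s = concat (map (row_word n t s) (rev [1..<n]))"

definition mat_prod_list :: "nat \<Rightarrow> real mat list \<Rightarrow> real mat" where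
  "mat_prod_list n As = foldr (*) As (1\<^sub>m (2*n))"

definition X_mat :: "nat \<Rightarrow> (nat \<times> nat \<Rightarrow> real) \<Rightarrow> (nat \<times> nat \<Rightarrow> real) \<Rightarrow> real mat" where
  "X_mat n t s = mat_prod_list n (map (\<lambda>(c, a). mat_exp (c \<cdot>\<^sub>m chev_e n a)) (full_word n t s))"

(* The coefficients of the word are irrelevant here. *)
definition w0_lift :: "nat \<Rightarrow> real mat" where
  "w0_lift n = mat_prod_list n
     (map (\<lambda>(c, a). mat_exp (chev_e n a) * mat_exp (- chev_f n a) * mat_exp (chev_e n a))
       (full_word n (\<lambda>_. 1) (\<lambda>_. 1)))"


section \<open>Whittaker vectors and the wave function\<close>

definition positive_array :: "nat \<Rightarrow> (nat \<times> nat \<Rightarrow> real) \<Rightarrow> bool" where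
  "positive_array n t \<longleftrightarrow> (\<forall>p \<in> idx n. t p > 0)"

definition positive_torus :: "nat \<Rightarrow> (nat \<Rightarrow> real) \<Rightarrow> bool" where
  "positive_torus n T \<longleftrightarrow> (\<forall>k \<in> {1..n}. T k > 0)"

definition torus_char :: "nat \<Rightarrow> (nat \<Rightarrow> complex) \<Rightarrow> (nat \<Rightarrow> real) \<Rightarrow> complex" where
  "torus_char n nu T = (\<Prod>k=1..n. complex_of_real (T k) powr nu k)"

definition exp_char :: "nat \<Rightarrow> (nat \<times> nat \<Rightarrow> real) \<Rightarrow> (nat \<times> nat \<Rightarrow> real) \<Rightarrow> complex" where
  "exp_char n t s = complex_of_real (exp (- (\<Sum>p\<in>idx n. t p + s p)))"

(* The Whittaker vectors are functions on subsets of the group given by a formula in coordinates;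
   the description operator picks the value determined by the (unique) coordinates of g. *)
definition right_whittaker :: "nat \<Rightarrow> (nat \<Rightarrow> complex) \<Rightarrow> real mat \<Rightarrow> complex" where
  "right_whittaker n mu g = (THE z. \<exists>Y T t s.
     Y \<in> lower_unipotent n \<and> positive_torus n T \<and> positive_array n t \<and> positive_array n s \<and>
     g = Y * torus_mat n T * X_mat n t s \<and>
     z = torus_char n mu T * exp_char n t s)"

definition left_whittaker :: "nat \<Rightarrow> (nat \<Rightarrow> complex) \<Rightarrow> real mat \<Rightarrow> complex" where
  "left_whittaker n nu g = (THE z. \<exists>t s Y T p q.
     positive_array n t \<and> positive_array n s \<and> g = X_mat n t s \<and>
     Y \<in> lower_unipotent n \<and> positive_torus n T \<and> positive_array n p \<and> positive_array n q \<and>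
     X_mat n (\<lambda>r. - t r) (\<lambda>r. - s r) * w0_lift n = Y * torus_mat n T * X_mat n p q \<and>
     z = torus_char n nu T * exp_char n p q)"

(* Lebesgue measure on R^d, d = n(n-1), as pairs of triangular arrays *)
definition array_measure ::
  "nat \<Rightarrow> ((nat \<times> nat \<Rightarrow> real) \<times> (nat \<times> nat \<Rightarrow> real)) measure" where
  "array_measure n = (\<Pi>\<^sub>M p\<in>idx n. lborel) \<Otimes>\<^sub>M (\<Pi>\<^sub>M p\<in>idx n. lborel)"

definition positive_region :: "nat \<Rightarrow> ((nat \<times> nat \<Rightarrow> real) \<times> (nat \<times> nat \<Rightarrow> real)) set" where
  "positive_region n =
     {(t, s) \<in> space (array_measure n). positive_array n t \<and> positive_array n s}"

definition rho :: "nat \<Rightarrow> nat \<Rightarrow> real" where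
  "rho n k = real n - real k"

definition whittaker_param :: "nat \<Rightarrow> (nat \<Rightarrow> real) \<Rightarrow> nat \<Rightarrow> complex" where
  "whittaker_param n lam k = \<i> * complex_of_real (lam k) - complex_of_real (rho n k)"

definition wave_integrand ::
  "nat \<Rightarrow> (nat \<Rightarrow> real) \<Rightarrow> (nat \<Rightarrow> real) \<Rightarrow> (nat \<times> nat \<Rightarrow> real) \<times> (nat \<times> nat \<Rightarrow> real) \<Rightarrow> complex"
where
  "wave_integrand n lam x = (\<lambda>(t, s).
     cnj (left_whittaker n (whittaker_param n lam) (X_mat n t s))
     * right_whittaker n (whittaker_param n lam) (X_mat n t s * mat_exp (- cartan_mat n x))
     * complex_of_real (\<Prod>(i, j)\<in>idx n.
         t (i, j) ^ (j - i) * s (i, j) ^ (2*n - i - j) * (1 / t (i, j)) * (1 / s (i, j))))"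

definition whittaker_wave :: "nat \<Rightarrow> (nat \<Rightarrow> real) \<Rightarrow> (nat \<Rightarrow> real) \<Rightarrow> complex" where
  "whittaker_wave n lam x =
     complex_of_real (exp (- (\<Sum>k=1..n. rho n k * x k)))
     * (LINT ts:positive_region n|array_measure n. wave_integrand n lam x ts)"


section \<open>The Mellin-Barnes integrand\<close>

type_synonym carray = "nat \<times> nat \<Rightarrow> complex"

definition entry :: "nat \<Rightarrow> carray \<Rightarrow> nat \<Rightarrow> nat \<Rightarrow> complex" where
  "entry n g k l = (if 1 \<le> k \<and> k < l \<and> l \<le> n then g (k, l) else 0)"

definition xi :: "nat \<Rightarrow> carray \<Rightarrow> carray \<Rightarrow> nat \<Rightarrow> nat \<Rightarrow> complex" where
  "xi n g d k l =
     (if l < n then - entry n g (k+1) (l+1) - entry n d (k+1) (l+1) + entry n g (k+1) l + entry n d k l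
      else entry n g k n - entry n d (k+1) n)"

definition eta :: "nat \<Rightarrow> carray \<Rightarrow> carray \<Rightarrow> nat \<Rightarrow> nat \<Rightarrow> complex" where
  "eta n g d k l =
     (if l < n then entry n g k (l+1) + entry n d k (l+1) - entry n g (k+1) l - entry n d k l
      else entry n d k n - entry n g (k+1) n)"

definition H_fun :: "nat \<Rightarrow> (nat \<Rightarrow> real) \<Rightarrow> carray \<Rightarrow> carray \<Rightarrow> complex" where
  "H_fun n x g d =
     (\<Sum>j=2..<n. (entry n g 1 j + entry n d 1 j) * complex_of_real (x j - x (j-1)))
     + entry n g 1 n * complex_of_real (x n - x (n-1))
     - entry n d 1 n * complex_of_real (x (n-1) + x n)"

(* At a pole of a Gamma function in a denominator, Gamma is 0 and a / 0 = 0, which is the value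
   required by the entire function 1/Gamma. *)
definition mb_integrand ::
  "nat \<Rightarrow> (nat \<Rightarrow> real) \<Rightarrow> (nat \<Rightarrow> real) \<Rightarrow> carray \<Rightarrow> carray \<Rightarrow> complex" where
  "mb_integrand n lam x g d =
     exp (H_fun n x g d)
     * (\<Prod>k=1..n-2.
          Gamma (entry n g k (k+1) + entry n d k (k+1) + 2 * \<i> * complex_of_real (lam k))
          / Gamma (entry n g k n + entry n d k n - entry n g (k+1) n - entry n d (k+1) n
                   + 2 * \<i> * complex_of_real (lam k)))
     * (\<Prod>(k, l)\<in>idx n.
          Gamma (xi n g d k l + \<i> * complex_of_real (lam k - lam l))
          * Gamma (eta n g d k l + \<i> * complex_of_real (lam k + lam l))
          * Gamma (entry n g k l - entry n g (k+1) l)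
          * Gamma (entry n d k l - entry n d (k+1) l))"

(* The last two inequalities keep the factors Gamma(gamma_{k,l} - gamma_{k+1,l}) and
   Gamma(delta_{k,l} - delta_{k+1,l}) away from their poles.  For n >= 3 they do not follow from
   the first four: e.g. for n = 3 the region given by the first four alone meets the polar
   hyperplane gamma_{1,3} = gamma_{2,3}, and integrals over planes on its two sides differ. *)
definition analyticity_domain :: "nat \<Rightarrow> (carray \<times> carray) set" where
  "analyticity_domain n =
     {(g, d) \<in> (idx n \<rightarrow>\<^sub>E UNIV) \<times> (idx n \<rightarrow>\<^sub>E UNIV). \<forall>(k, l)\<in>idx n.
        Re (entry n g k l) > 0 \<and> Re (entry n d k l) > 0 \<and>
        Re (xi n g d k l) > 0 \<and> Re (eta n g d k l) > 0 \<and>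
        Re (entry n g k l - entry n g (k+1) l) > 0 \<and>
        Re (entry n d k l - entry n d (k+1) l) > 0}"

(* The translate Re gamma = a, Re delta = b of the imaginary plane, and its parametrization by the
   imaginary parts *)
definition vertical_plane ::
  "nat \<Rightarrow> (nat \<times> nat \<Rightarrow> real) \<Rightarrow> (nat \<times> nat \<Rightarrow> real) \<Rightarrow> (carray \<times> carray) set" where
  "vertical_plane n a b =
     {(g, d) \<in> (idx n \<rightarrow>\<^sub>E UNIV) \<times> (idx n \<rightarrow>\<^sub>E UNIV).
        \<forall>p\<in>idx n. Re (g p) = a p \<and> Re (d p) = b p}"

definition plane_point :: "nat \<Rightarrow> (nat \<times> nat \<Rightarrow> real) \<Rightarrow> (nat \<times> nat \<Rightarrow> real) \<Rightarrow> carray" where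
  "plane_point n a y = (\<lambda>p\<in>idx n. Complex (a p) (y p))"

definition plane_integrable ::
  "nat \<Rightarrow> (nat \<times> nat \<Rightarrow> real) \<Rightarrow> (nat \<times> nat \<Rightarrow> real) \<Rightarrow> (carray \<Rightarrow> carray \<Rightarrow> complex) \<Rightarrow> bool" where
  "plane_integrable n a b F \<longleftrightarrow>
     integrable (array_measure n) (\<lambda>(y, z). F (plane_point n a y) (plane_point n b z))"

(* Each of the d = n(n-1) variables runs upwards, which contributes a factor i to the differential. *)
definition plane_integral ::
  "nat \<Rightarrow> (nat \<times> nat \<Rightarrow> real) \<Rightarrow> (nat \<times> nat \<Rightarrow> real) \<Rightarrow> (carray \<Rightarrow> carray \<Rightarrow> complex) \<Rightarrow> complex" where
  "plane_integral n a b F =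
     \<i> ^ (n * (n - 1)) *
     (LINT (y, z)|array_measure n. F (plane_point n a y) (plane_point n b z))"

end

theory Submission
  imports Defs "HOL-Probability.Probability"
begin

text \<open>A row of \<open>X(-t,-s)\<close> times its part of the lift of the longest element is lower unipotent times a
  torus element times a row with positive parameters, all explicit and subtraction free. Moving the
  torus elements across the later rows gives the factorization which defines the left Whittaker
  vector. On unipotent upper triangular matrices the sum of the coefficients of the simple root vectors is a
  homomorphism, so the exponents of both Whittaker vectors are determined without uniqueness of the
  parameters.

  In logarithmic coordinates the wave integrand is the exponential of a linear form, times the factors
  \<open>exp (- exp (- (y k + shift k)))\<close> of the right Whittaker vector and \<open>exp (- p)\<close> of the left one. The
  former are written as inverse Mellin transforms of \<open>Gamma\<close>. After an interchange of the integrations,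
  triangular translations decouple the integral over \<open>y\<close> into Gamma integrals and, in the last
  column, Beta integrals; these are the remaining factors of the formula.\<close>

section \<open>Changes of variables in product measures\<close>

text \<open>The lower unipotent factor in the left Whittaker vector is never computed. It is enough
  to follow one vector through the rows and to know coordinate \<open>k\<close> of the result when
  the coordinates before \<open>k\<close> vanish (\<open>tri_rel\<close>); orthogonality supplies
  the other half. A row therefore has to be compared with its transform only on the hyperplane
  \<open>pc z i = 0\<close>, where all coordinates but one are merely rescaled.

  The shape of \<open>xi\<close> and \<open>eta\<close> comes from a mismatch of coordinates. The
  torus character, the measure and the Mellin transforms give a linear form in \<open>y\<close>,
  whereas the integral decouples for a linear form in the coordinates \<open>lg\<close>,
  \<open>ld\<close> obtained after the torus has been moved across the rows. The weights
  \<open>w_g\<close>, \<open>w_d\<close> make the two forms equal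
  (\<open>exponent_identity\<close>), column by column, through summation by parts.

  Both Whittaker vectors are definite descriptions, so even the measurability of the wave integrand
  is obtained from its explicit form. The parity of n - i enters through the last coordinate, which
  the longest element negates or spares; it is confined to the last column and disappears from all
  sums.\<close>

abbreviation PiR :: "'i set \<Rightarrow> ('i \<Rightarrow> real) measure" where
  "PiR K \<equiv> \<Pi>\<^sub>M k\<in>K. lborel"

interpretation PiR: product_sigma_finite "\<lambda>_::'i. lborel :: real measure"
  by standard

text \<open>An index \<open>a\<close> of maximal rank influences no shift, so for fixed other
  coordinates the innermost integral is over a translate of the real line. The shear on the
  remaining coordinates is the induction hypothesis.\<close>

lemma distr_PiR_triangular:
  fixes K :: "'i set" and r :: "'i \<Rightarrow> nat" and h :: "'i \<Rightarrow> ('i \<Rightarrow> real) \<Rightarrow> real"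
  assumes "finite K"
    and "\<And>k. k \<in> K \<Longrightarrow> h k \<in> borel_measurable (PiR K)"
    and "\<And>k x y. k \<in> K \<Longrightarrow> (\<forall>j\<in>K. r j < r k \<longrightarrow> x j = y j) \<Longrightarrow> h k x = h k y"
  shows "distr (PiR K) (PiR K) (\<lambda>x. \<lambda>k\<in>K. x k + h k x) = PiR K"
  using assms
proof (induction K rule: finite_ranking_induct[where f = r])
  case empty
  have "distr (PiR {}) (PiR {}) (\<lambda>x. \<lambda>k\<in>{}. x k + h k x) = distr (PiR {}) (PiR {}) (\<lambda>x. x)"
    by (intro distr_cong) (auto simp: space_PiM)
  also have "\<dots> = PiR {}" by (rule distr_id2) simp
  finally show ?case .
next
  case (insert a S)
  show ?case
  proof (cases "a \<in> S")
    case True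
    with insert show ?thesis by (simp add: insert_absorb)
  next
    case False
    note hm = insert.prems(1) and dep = insert.prems(2)
    have upd: "(\<lambda>x. x(a := c)) \<in> measurable (PiR S) (PiR (insert a S))" for c :: real
      by (rule measurable_fun_upd[where J = S]) auto
    have dep': "h k x = h k y" if "k \<in> insert a S" "\<And>j. j \<in> S \<Longrightarrow> x j = y j" for k x y
      using insert.hyps(2) that by (intro dep) fastforce+
    \<comment> \<open>Measurability is given on the larger product. Fixing coordinate
      \<open>a\<close> at 0 brings it down to \<open>S\<close> and, by the rank condition, changes
      no value.\<close>
    have hS: "h k \<in> borel_measurable (PiR S)" if "k \<in> insert a S" for k
    proof -
      have "(\<lambda>x. h k (x(a := 0))) \<in> borel_measurable (PiR S)"
        using measurable_comp[OF upd hm[OF that]] by (simp add: comp_def)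
      moreover have "h k (x(a := 0)) = h k x" for x
        using False by (intro dep' that) auto
      ultimately show ?thesis by (simp cong: measurable_cong)
    qed
    have IH: "distr (PiR S) (PiR S) (\<lambda>x. \<lambda>k\<in>S. x k + h k x) = PiR S"
    proof (rule insert.IH)
      show "h k \<in> borel_measurable (PiR S)" if "k \<in> S" for k
        using hS that by simp
      show "h k x = h k y" if "k \<in> S" "\<forall>j\<in>S. r j < r k \<longrightarrow> x j = y j" for k x y
        using insert.hyps(2)[of k] that by (intro dep) auto
    qed
    let ?K = "insert a S"
    let ?F = "\<lambda>x. \<lambda>k\<in>?K. x k + h k x" and ?G = "\<lambda>x. \<lambda>k\<in>S. x k + h k x"
    have [measurable]: "?F \<in> measurable (PiR ?K) (PiR ?K)"
      using hm by (intro measurable_restrict) auto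
    have [measurable]: "?G \<in> measurable (PiR S) (PiR S)"
      using hS by (intro measurable_restrict) auto
    show ?thesis
    proof (rule measure_eqI)
      show "sets (distr (PiR ?K) (PiR ?K) ?F) = sets (PiR ?K)" by simp
    next
      fix A assume "A \<in> sets (distr (PiR ?K) (PiR ?K) ?F)"
      then have A[measurable]: "A \<in> sets (PiR ?K)" by simp
      define f where "f = (indicator A :: _ \<Rightarrow> ennreal)"
      have f[measurable]: "f \<in> borel_measurable (PiR ?K)" by (simp add: f_def)
      have upd2[measurable]: "(\<lambda>(x, y). x(a := y)) \<in> measurable (PiR S \<Otimes>\<^sub>M lborel) (PiR ?K)"
        using measurable_add_dim[where I = S and M = "\<lambda>_. lborel" and i = a] by simp
      have f2[measurable]: "(\<lambda>(x, y). f (x(a := y))) \<in> borel_measurable (PiR S \<Otimes>\<^sub>M lborel)"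
        using measurable_comp[OF upd2 f] by (simp add: comp_def case_prod_unfold)
      have F_upd: "?F (x(a := y)) = (?G x)(a := y + h a x)" for x and y :: real
      proof
        fix k
        have "h k (x(a := y)) = h k x" if "k \<in> ?K"
          using False by (intro dep' that) auto
        then show "?F (x(a := y)) k = ((?G x)(a := y + h a x)) k"
          using False by auto
      qed
      have fx: "(\<lambda>y. f (x(a := y))) \<in> borel_measurable borel" if "x \<in> space (PiR S)" for x
        using measurable_Pair2[OF f2 that] by simp
      have "emeasure (distr (PiR ?K) (PiR ?K) ?F) A = (\<integral>\<^sup>+x. f x \<partial>distr (PiR ?K) (PiR ?K) ?F)"
        by (simp add: f_def)
      also have "\<dots> = (\<integral>\<^sup>+x. f (?F x) \<partial>PiR ?K)"
        by (rule nn_integral_distr) measurable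
      also have "\<dots> = (\<integral>\<^sup>+x. (\<integral>\<^sup>+y. f (?F (x(a := y))) \<partial>lborel) \<partial>PiR S)"
        using False insert.hyps(1) by (intro PiR.product_nn_integral_insert) measurable
      also have "\<dots> = (\<integral>\<^sup>+x. (\<integral>\<^sup>+y. f ((?G x)(a := y)) \<partial>lborel) \<partial>PiR S)"
      proof (rule nn_integral_cong)
        fix x :: "'i \<Rightarrow> real" assume x: "x \<in> space (PiR S)"
        then have "?G x \<in> space (PiR S)" by (auto simp: space_PiM)
        then have "(\<lambda>y. f ((?G x)(a := y))) \<in> borel_measurable borel" by (rule fx)
        from nn_integral_real_affine[OF this, of 1 "h a x"]
        show "(\<integral>\<^sup>+y. f (?F (x(a := y))) \<partial>lborel) = (\<integral>\<^sup>+y. f ((?G x)(a := y)) \<partial>lborel)"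
          unfolding F_upd by (simp add: add.commute)
      qed
      also have "\<dots> = (\<integral>\<^sup>+x. (\<integral>\<^sup>+y. f (x(a := y)) \<partial>lborel) \<partial>distr (PiR S) (PiR S) ?G)"
        by (rule nn_integral_distr[symmetric]) measurable
      also have "\<dots> = (\<integral>\<^sup>+x. f x \<partial>PiR ?K)"
        unfolding IH using False insert.hyps(1) by (intro PiR.product_nn_integral_insert[symmetric]) measurable
      also have "\<dots> = emeasure (PiR ?K) A"
        by (simp add: f_def)
      finally show "emeasure (distr (PiR ?K) (PiR ?K) ?F) A = emeasure (PiR ?K) A" .
    qed
  qed
qed

lemma distr_PiR_reindex:
  assumes "finite I" "bij_betw f I J"
  shows "distr (PiR J) (PiR I) (\<lambda>u. \<lambda>p\<in>I. u (f p)) = PiR I"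
proof (rule PiR.PiM_eqI)
  show "finite I" by fact
  have J: "finite J" "J = f ` I" and inj: "inj_on f I" using assms by (auto simp: bij_betw_def)
  have m: "(\<lambda>u. \<lambda>p\<in>I. u (f p)) \<in> measurable (PiR J) (PiR I)"
    using J by (intro measurable_restrict) auto
  fix A :: "'a \<Rightarrow> real set" assume A: "\<And>i. i \<in> I \<Longrightarrow> A i \<in> sets lborel"
  define B where "B j = A (inv_into I f j)" for j
  have B: "B (f i) = A i" if "i \<in> I" for i using that inj by (simp add: B_def)
  have sB: "B j \<in> sets lborel" if "j \<in> J" for j using that A J B by auto
  have "(\<lambda>u. \<lambda>p\<in>I. u (f p)) -` (Pi\<^sub>E I A) \<inter> space (PiR J) = Pi\<^sub>E J B"
    using J B by (auto simp: space_PiM PiE_iff)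
  then have "emeasure (distr (PiR J) (PiR I) (\<lambda>u. \<lambda>p\<in>I. u (f p))) (Pi\<^sub>E I A) = emeasure (PiR J) (Pi\<^sub>E J B)"
    using m A assms(1) by (subst emeasure_distr) (auto intro!: sets_PiM_I_finite)
  also have "\<dots> = (\<Prod>j\<in>J. emeasure lborel (B j))"
    using J sB by (intro PiR.emeasure_PiM) auto
  also have "\<dots> = (\<Prod>i\<in>I. emeasure lborel (A i))"
    using J inj B by (simp add: prod.reindex)
  finally show "emeasure (distr (PiR J) (PiR I) (\<lambda>u. \<lambda>p\<in>I. u (f p))) (Pi\<^sub>E I A) = (\<Prod>i\<in>I. emeasure lborel (A i))" .
qed simp

text \<open>Two arrays may exchange roles index by index, as \<open>t\<close> and \<open>s\<close>
  do in the last column according to parity. The graph of \<open>w\<close> and its complement are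
  two disjoint copies of \<open>I\<close>.\<close>

lemma distr_PiR_bool:
  fixes I :: "'i set" and w :: "'i \<Rightarrow> bool"
  assumes "finite I"
  shows "distr (PiR (I \<times> (UNIV :: bool set))) (PiR I \<Otimes>\<^sub>M PiR I)
           (\<lambda>x. (\<lambda>p\<in>I. x (p, w p), \<lambda>p\<in>I. x (p, \<not> w p))) = PiR I \<Otimes>\<^sub>M PiR I"
proof -
  define J1 J2 where "J1 = (\<lambda>p. (p, w p)) ` I" and "J2 = (\<lambda>p. (p, \<not> w p)) ` I"
  have J: "J1 \<inter> J2 = {}" "I \<times> (UNIV :: bool set) = J1 \<union> J2" "finite J1" "finite J2"
    using assms by (auto simp: J1_def J2_def image_iff)
  let ?f = "\<lambda>u. \<lambda>p\<in>I. u (p, w p)" and ?g = "\<lambda>u. \<lambda>p\<in>I. u (p, \<not> w p)"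
  have d1: "distr (PiR J1) (PiR I) ?f = PiR I"
    using assms by (intro distr_PiR_reindex) (auto simp: bij_betw_def J1_def inj_on_def)
  have d2: "distr (PiR J2) (PiR I) ?g = PiR I"
    using assms by (intro distr_PiR_reindex) (auto simp: bij_betw_def J2_def inj_on_def)
  have mf[measurable]: "?f \<in> measurable (PiR J1) (PiR I)"
    by (intro measurable_restrict) (auto simp: J1_def)
  have mg[measurable]: "?g \<in> measurable (PiR J2) (PiR I)"
    by (intro measurable_restrict) (auto simp: J2_def)
  have mm: "(\<lambda>x. (?f x, ?g x)) \<in> measurable (PiR (J1 \<union> J2)) (PiR I \<Otimes>\<^sub>M PiR I)"
    by (intro measurable_Pair measurable_restrict) (auto simp: J1_def J2_def)
  have "sigma_finite_measure (PiR I)"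
    using assms by (rule PiR.sigma_finite)
  then have sf: "sigma_finite_measure (distr (PiR J2) (PiR I) ?g)" by (simp only: d2)
  have "PiR I \<Otimes>\<^sub>M PiR I = distr (PiR J1) (PiR I) ?f \<Otimes>\<^sub>M distr (PiR J2) (PiR I) ?g"
    by (simp only: d1 d2)
  also have "\<dots> = distr (PiR J1 \<Otimes>\<^sub>M PiR J2) (PiR I \<Otimes>\<^sub>M PiR I) (\<lambda>(x, y). (?f x, ?g y))"
    by (rule pair_measure_distr[OF mf mg sf])
  also have "\<dots> = distr (PiR J1 \<Otimes>\<^sub>M PiR J2) (PiR I \<Otimes>\<^sub>M PiR I) ((\<lambda>x. (?f x, ?g x)) \<circ> merge J1 J2)"
  proof (rule distr_cong; clarsimp simp: space_pair_measure)
    fix x y :: "'i \<times> bool \<Rightarrow> real"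
    have "merge J1 J2 (x, y) (p, w p) = x (p, w p)" "merge J1 J2 (x, y) (p, \<not> w p) = y (p, \<not> w p)" if "p \<in> I" for p
      using that J(1) by (auto simp: J1_def J2_def merge_def image_iff)
    then show "?f x = ?f (merge J1 J2 (x, y)) \<and> ?g y = ?g (merge J1 J2 (x, y))"
      by (auto simp: fun_eq_iff)
  qed
  also have "\<dots> = distr (distr (PiR J1 \<Otimes>\<^sub>M PiR J2) (PiR (J1 \<union> J2)) (merge J1 J2)) (PiR I \<Otimes>\<^sub>M PiR I) (\<lambda>x. (?f x, ?g x))"
    by (rule distr_distr[symmetric, OF mm measurable_merge])
  also have "distr (PiR J1 \<Otimes>\<^sub>M PiR J2) (PiR (J1 \<union> J2)) (merge J1 J2) = PiR (J1 \<union> J2)"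
    using J by (intro PiR.distr_merge) auto
  finally show ?thesis unfolding J(2) ..
qed

section \<open>Lebesgue measure on the positive orthant in logarithmic coordinates\<close>

lemma SUP_mult_indicator:
  fixes c :: ennreal
  shows "(SUP k. c * indicator (R k) t) = c * indicator (\<Union>k. R k) t"
proof (cases "t \<in> (\<Union>k. R k)")
  case True
  then obtain k where "t \<in> R k" by auto
  then have "(SUP k. c * indicator (R k) t) = c"
    by (intro antisym SUP_least SUP_upper2[of k]) (auto simp: indicator_def)
  with True show ?thesis by simp
next
  case False
  then have "indicator (R k) t = (0 :: ennreal)" for k by (auto simp: indicator_def)
  with False show ?thesis by simp
qed

lemma incseq_mult_indicator:
  fixes f :: "'a \<Rightarrow> ennreal"
  assumes "incseq R"
  shows "incseq (\<lambda>k t. f t * indicator (R k) t)"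
proof (intro incseq_SucI le_funI)
  fix k t
  show "f t * indicator (R k) t \<le> f t * indicator (R (Suc k)) t"
    using incseq_SucD[OF assms, of k] by (cases "t \<in> R k") (auto simp: subsetD)
qed

text \<open>The image is dt/t on the half line. Substitution is applied on compact intervals, so
  both sides are exhausted monotonically, by \<open>R k\<close> and by [-k, k]; a reflection then
  gives the minus sign.\<close>

lemma distr_exp_minus:
  "distr lborel lborel (\<lambda>x::real. exp (- x)) = density lborel (\<lambda>t. indicator {0<..} t / ennreal t)"
proof (rule measure_eqI)
  fix A :: "real set" assume "A \<in> sets (distr lborel lborel (\<lambda>x::real. exp (- x)))"
  then have A[measurable]: "A \<in> sets borel" by simp
  define f :: "real \<Rightarrow> real" where "f t = indicator A t / t" for t
  have [measurable]: "f \<in> borel_measurable borel" by (simp add: f_def[abs_def])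
  define R where "R k = {exp (- real k)..exp (real k)}" for k
  have sub: "(\<integral>\<^sup>+t. ennreal (f t) * indicator (R k) t \<partial>lborel)
      = (\<integral>\<^sup>+x. indicator A (exp x) * indicator {- real k..real k} x \<partial>lborel)" for k
  proof -
    have "(\<integral>\<^sup>+t. ennreal (f t) * indicator (R k) t \<partial>lborel) = (\<integral>\<^sup>+t. ennreal (f t * indicator (R k) t) \<partial>lborel)"
      by (intro nn_integral_cong) (auto simp: indicator_def)
    also have "\<dots> = (\<integral>\<^sup>+x. ennreal (f (exp x) * exp x * indicator {- real k..real k} x) \<partial>lborel)"
      unfolding R_def
      by (rule nn_integral_substitution[where g = exp and g' = exp])
         (auto intro!: derivative_eq_intros continuous_intros simp: set_borel_measurable_def)
    also have "\<dots> = (\<integral>\<^sup>+x. indicator A (exp x) * indicator {- real k..real k} x \<partial>lborel)"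
      by (intro nn_integral_cong) (auto simp: f_def indicator_def)
    finally show ?thesis .
  qed
  have R1: "(\<Union>k. R k) = {0<..}"
  proof (rule equalityI; rule subsetI)
    fix t :: real assume "t \<in> {0<..}"
    then have t: "t > 0" by simp
    obtain k :: nat where k: "\<bar>ln t\<bar> \<le> real k" using real_arch_simple by blast
    then have "exp (- real k) \<le> exp (ln t)" "exp (ln t) \<le> exp (real k)" by auto
    then show "t \<in> (\<Union>k. R k)" using t by (auto simp: R_def)
  qed (auto simp: R_def intro: less_le_trans[OF exp_gt_zero])
  have incR: "incseq R" by (auto simp: incseq_def R_def intro: order_trans[rotated] order_trans)
  have incI: "incseq (\<lambda>k. {- real k..real k})" by (auto simp: incseq_def)
  have I1: "(\<Union>k. {- real k..real k}) = UNIV"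
  proof (rule equalityI; rule subsetI)
    fix x :: real
    obtain k :: nat where "\<bar>x\<bar> \<le> real k" using real_arch_simple by blast
    then show "x \<in> (\<Union>k. {- real k..real k})" by (auto simp: abs_le_iff intro!: exI[of _ k])
  qed simp
  have "emeasure (density lborel (\<lambda>t. indicator {0<..} t / ennreal t)) A
      = (\<integral>\<^sup>+t. indicator {0<..} t / ennreal t * indicator A t \<partial>lborel)"
    by (rule emeasure_density) auto
  also have "\<dots> = (\<integral>\<^sup>+t. ennreal (f t) * indicator {0<..} t \<partial>lborel)"
    by (rule nn_integral_cong)
       (use divide_ennreal[of 1] in \<open>auto simp: f_def indicator_def\<close>)
  also have "\<dots> = (\<integral>\<^sup>+t. ennreal (f t) * indicator (\<Union>k. R k) t \<partial>lborel)" by (simp add: R1)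
  also have "\<dots> = (\<integral>\<^sup>+t. (SUP k. ennreal (f t) * indicator (R k) t) \<partial>lborel)"
    by (simp only: SUP_mult_indicator)
  also have "\<dots> = (SUP k. (\<integral>\<^sup>+t. ennreal (f t) * indicator (R k) t \<partial>lborel))"
    by (rule nn_integral_monotone_convergence_SUP[OF incseq_mult_indicator[OF incR]])
       (simp add: R_def)
  also have "\<dots> = (SUP k. (\<integral>\<^sup>+x. indicator A (exp x) * indicator {- real k..real k} x \<partial>lborel))"
    by (simp only: sub)
  also have "\<dots> = (\<integral>\<^sup>+x. (SUP k. indicator A (exp x) * indicator {- real k..real k} x) \<partial>lborel)"
    by (rule nn_integral_monotone_convergence_SUP[OF incseq_mult_indicator[OF incI], symmetric])
       simp
  also have "\<dots> = (\<integral>\<^sup>+x. indicator A (exp x) \<partial>lborel)"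
    by (simp only: SUP_mult_indicator I1 indicator_UNIV mult_1_right)
  also have "\<dots> = (\<integral>\<^sup>+x. indicator A (exp (- x)) \<partial>lborel)"
    using nn_integral_real_affine[of "\<lambda>x. indicator A (exp x)" "-1" 0] by simp
  also have "\<dots> = emeasure (distr lborel lborel (\<lambda>x::real. exp (- x))) A"
    by (subst nn_integral_distr[of "\<lambda>x. exp (- x)" lborel lborel "indicator A", symmetric]) auto
  finally show "emeasure (distr lborel lborel (\<lambda>x::real. exp (- x))) A
      = emeasure (density lborel (\<lambda>t. indicator {0<..} t / ennreal t)) A" ..
qed simp

text \<open>Both sides are the product of copies of \<open>N\<close>, once as an image and once as a
  density; it suffices to compare them on rectangles.\<close>

lemma distr_PiR_exp_minus:
  assumes K: "finite K"
  shows "distr (PiR K) (PiR K) (\<lambda>x. \<lambda>k\<in>K. exp (- x k))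
    = density (PiR K) (\<lambda>x. \<Prod>k\<in>K. indicator {0<..} (x k) / ennreal (x k))"
proof -
  define w :: "real \<Rightarrow> ennreal" where "w t = indicator {0<..} t / ennreal t" for t
  have [measurable]: "w \<in> borel_measurable borel" by (simp add: w_def[abs_def])
  define N where "N = distr lborel lborel (\<lambda>x::real. exp (- x))"
  have N2: "N = density lborel w" unfolding N_def w_def[abs_def] by (rule distr_exp_minus)
  have sN: "sets N = sets lborel" by (simp add: N_def)
  have Nsf: "sigma_finite_measure N"
  proof -
    have "AE x in lborel. w x \<noteq> \<infinity>"
      by (rule AE_I2) (auto simp: w_def indicator_def ennreal_divide_eq_top_iff)
    then show ?thesis
      unfolding N2 by (subst sigma_finite_measure.sigma_finite_iff_density_finite[OF sigma_finite_lborel]) auto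
  qed
  interpret N: product_sigma_finite "\<lambda>_. N" by (simp add: product_sigma_finite_def Nsf)
  have m[measurable]: "(\<lambda>x. \<lambda>k\<in>K. exp (- x k)) \<in> measurable (PiR K) (PiR K)"
    by (intro measurable_restrict) auto
  have sP: "sets (\<Pi>\<^sub>M k\<in>K. N) = sets (PiR K)" by (intro sets_PiM_cong) (auto simp: sN)
  have "distr (PiR K) (PiR K) (\<lambda>x. \<lambda>k\<in>K. exp (- x k)) = (\<Pi>\<^sub>M k\<in>K. N)"
  proof (rule N.PiM_eqI)
    fix A assume A: "\<And>k. k \<in> K \<Longrightarrow> A k \<in> sets N"
    have "(\<lambda>x. \<lambda>k\<in>K. exp (- x k)) -` Pi\<^sub>E K A \<inter> space (PiR K) = (\<Pi>\<^sub>E k\<in>K. (\<lambda>x. exp (- x)) -` A k)"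
      by (auto simp: space_PiM PiE_iff)
    moreover have "(\<lambda>x. exp (- x)) -` A k \<in> sets lborel" if "k \<in> K" for k
    proof -
      have "A k \<in> sets borel" using A[OF that] sN by simp
      moreover have "(\<lambda>x::real. exp (- x)) \<in> borel_measurable borel" by measurable
      ultimately show ?thesis using measurable_sets_borel[of "\<lambda>x::real. exp (- x)" borel "A k"] by simp
    qed
    moreover have "emeasure N (A k) = emeasure lborel ((\<lambda>x. exp (- x)) -` A k)" if "k \<in> K" for k
      using A[OF that] sN unfolding N_def by (subst emeasure_distr) auto
    moreover have "Pi\<^sub>E K A \<in> sets (PiR K)"
      using A sN K by (intro sets_PiM_I_finite) auto
    ultimately show "emeasure (distr (PiR K) (PiR K) (\<lambda>x. \<lambda>k\<in>K. exp (- x k))) (Pi\<^sub>E K A) = (\<Prod>k\<in>K. emeasure N (A k))"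
      using K by (subst emeasure_distr[OF m]) (simp_all add: PiR.emeasure_PiM)
  qed (use K sP in auto)
  moreover have "density (PiR K) (\<lambda>x. \<Prod>k\<in>K. w (x k)) = (\<Pi>\<^sub>M k\<in>K. N)"
  proof (rule N.PiM_eqI)
    fix A assume A: "\<And>k. k \<in> K \<Longrightarrow> A k \<in> sets N"
    then have A'[measurable]: "A k \<in> sets borel" if "k \<in> K" for k using that sN by auto
    have PA: "Pi\<^sub>E K A \<in> sets (PiR K)"
      using A sN K by (intro sets_PiM_I_finite) auto
    have "emeasure (density (PiR K) (\<lambda>x. \<Prod>k\<in>K. w (x k))) (Pi\<^sub>E K A)
        = (\<integral>\<^sup>+x. (\<Prod>k\<in>K. w (x k)) * indicator (Pi\<^sub>E K A) x \<partial>PiR K)"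
      using PA by (intro emeasure_density) auto
    also have "\<dots> = (\<integral>\<^sup>+x. (\<Prod>k\<in>K. w (x k) * indicator (A k) (x k)) \<partial>PiR K)"
    proof (rule nn_integral_cong)
      fix x :: "'a \<Rightarrow> real" assume x: "x \<in> space (PiR K)"
      show "(\<Prod>k\<in>K. w (x k)) * indicator (Pi\<^sub>E K A) x = (\<Prod>k\<in>K. w (x k) * indicator (A k) (x k))"
      proof (cases "x \<in> Pi\<^sub>E K A")
        case True then show ?thesis by (auto simp: indicator_def PiE_iff intro!: prod.cong)
      next
        case False
        then obtain k where "k \<in> K" "x k \<notin> A k" using x by (auto simp: space_PiM PiE_iff)
        then have "(\<Prod>k\<in>K. w (x k) * indicator (A k) (x k)) = 0" using K by (intro prod_zero bexI[of _ k]) auto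
        with False show ?thesis by simp
      qed
    qed
    also have "\<dots> = (\<Prod>k\<in>K. \<integral>\<^sup>+t. w t * indicator (A k) t \<partial>lborel)"
      using K by (intro PiR.product_nn_integral_prod) auto
    also have "\<dots> = (\<Prod>k\<in>K. emeasure N (A k))"
      unfolding N2 using A' by (intro prod.cong refl emeasure_density[symmetric]) auto
    finally show "emeasure (density (PiR K) (\<lambda>x. \<Prod>k\<in>K. w (x k))) (Pi\<^sub>E K A) = (\<Prod>k\<in>K. emeasure N (A k))" .
  qed (use K sP in auto)
  ultimately show ?thesis by (simp add: w_def)
qed

lemma integral_PiR_exp_minus:
  fixes f :: "('i \<Rightarrow> real) \<Rightarrow> complex"
  assumes K: "finite K" and f[measurable]: "f \<in> borel_measurable (PiR K)"
  shows "integrable (PiR K) (\<lambda>x. indicat_real {x. \<forall>k\<in>K. x k > 0} x *\<^sub>R f x)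
      \<longleftrightarrow> integrable (PiR K) (\<lambda>y. (\<Prod>k\<in>K. exp (- y k)) *\<^sub>R f (\<lambda>k\<in>K. exp (- y k)))" (is ?A)
    and "(LINT x|PiR K. indicat_real {x. \<forall>k\<in>K. x k > 0} x *\<^sub>R f x)
      = (LINT y|PiR K. (\<Prod>k\<in>K. exp (- y k)) *\<^sub>R f (\<lambda>k\<in>K. exp (- y k)))" (is ?B)
proof -
  define w :: "real \<Rightarrow> real" where "w t = indicator {0<..} t / t" for t
  have [measurable]: "w \<in> borel_measurable borel" by (simp add: w_def[abs_def])
  have w0: "0 \<le> w t" for t by (auto simp: w_def indicator_def)
  define W where "W x = (\<Prod>k\<in>K. w (x k))" for x :: "'i \<Rightarrow> real"
  have [measurable]: "W \<in> borel_measurable (PiR K)" by (simp add: W_def[abs_def])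
  have W0: "0 \<le> W x" for x using w0 by (auto simp: W_def intro: prod_nonneg)
  have "(\<Prod>k\<in>K. indicator {0<..} (x k) / ennreal (x k)) = ennreal (W x)" for x :: "'i \<Rightarrow> real"
  proof -
    have "indicator {0<..} t / ennreal t = ennreal (w t)" for t :: real
      using divide_ennreal[of 1 t] by (auto simp: w_def indicator_def)
    then show ?thesis by (simp add: W_def prod_ennreal w0)
  qed
  then have D: "distr (PiR K) (PiR K) (\<lambda>x. \<lambda>k\<in>K. exp (- x k)) = density (PiR K) (\<lambda>x. ennreal (W x))"
    using distr_PiR_exp_minus[OF K] by simp
  have m[measurable]: "(\<lambda>x. \<lambda>k\<in>K. exp (- x k)) \<in> measurable (PiR K) (PiR K)"
    by (intro measurable_restrict) auto
  \<comment> \<open>The product of the coordinates compensates the density of the image measure, so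
    \<open>W\<close> times \<open>F\<close> is \<open>f\<close> cut off to the positive
    orthant.\<close>
  define F where "F x = (\<Prod>k\<in>K. x k) *\<^sub>R f x" for x
  have F[measurable]: "F \<in> borel_measurable (PiR K)" by (simp add: F_def[abs_def])
  have WF: "W x *\<^sub>R F x = indicat_real {x. \<forall>k\<in>K. x k > 0} x *\<^sub>R f x" for x
  proof (cases "\<forall>k\<in>K. x k > 0")
    case True
    then have "W x * (\<Prod>k\<in>K. x k) = 1"
      unfolding W_def prod.distrib[symmetric] by (intro prod.neutral) (auto simp: w_def)
    then show ?thesis using True by (simp add: F_def)
  next
    case False
    then obtain k where "k \<in> K" "\<not> x k > 0" by auto
    then have "W x = 0" using K by (auto simp: W_def w_def intro!: prod_zero bexI[of _ k])
    then show ?thesis using False by simp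
  qed
  have FE: "F (\<lambda>k\<in>K. exp (- y k)) = (\<Prod>k\<in>K. exp (- y k)) *\<^sub>R f (\<lambda>k\<in>K. exp (- y k))" for y
    by (simp add: F_def)
  show ?A
    using integrable_distr_eq[OF m F] integrable_density[OF F, of W] W0
    by (simp add: D WF FE)
  show ?B
    using integral_distr[OF m F] integral_density[OF F, of W] W0
    by (simp add: D WF FE)
qed

section \<open>Gamma integrals in logarithmic coordinates\<close>

lemma integrable_pair_mult:
  fixes f :: "'a \<Rightarrow> complex" and g :: "'b \<Rightarrow> complex"
  assumes "sigma_finite_measure M" "sigma_finite_measure N" and f: "integrable M f" and g: "integrable N g"
  shows "integrable (M \<Otimes>\<^sub>M N) (\<lambda>(x, y). f x * g y)"
proof -
  interpret M: sigma_finite_measure M by fact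
  interpret N: sigma_finite_measure N by fact
  interpret MN: pair_sigma_finite M N ..
  have [measurable]: "f \<in> borel_measurable M" "g \<in> borel_measurable N" using f g by auto
  show ?thesis
  proof (rule MN.Fubini_integrable)
    show "AE x in M. integrable N (\<lambda>y. case (x, y) of (x, y) \<Rightarrow> f x * g y)" using g by simp
    show "integrable M (\<lambda>x. \<integral>y. norm (case (x, y) of (x, y) \<Rightarrow> f x * g y) \<partial>N)" using f by (simp add: norm_mult)
  qed measurable
qed

text \<open>Euler's integral with t = exp a. It is available over the completed measure and as a
  gauge integral, so integrability and value are first transferred to \<open>lborel\<close>.\<close>

lemma Gamma_log_integral:
  fixes w :: complex
  assumes w: "Re w > 0"
  shows "integrable lborel (\<lambda>a::real. exp (w * of_real a - of_real (exp a)))"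
    and "(LINT a|lborel. exp (w * of_real a - of_real (exp a))) = Gamma w"
proof -
  define g :: "real \<Rightarrow> complex" where "g t = exp ((w - 1) * of_real (ln t)) / of_real (exp t)" for t
  define F :: "real \<Rightarrow> complex" where "F t = of_real t * g t" for t
  define W :: "real \<Rightarrow> real" where "W t = indicator {0<..} t / t" for t
  have [measurable]: "g \<in> borel_measurable borel" "F \<in> borel_measurable borel" "W \<in> borel_measurable borel"
    unfolding F_def[abs_def] g_def[abs_def] W_def[abs_def] by measurable
  have g_powr: "of_real t powr (w - 1) / of_real (exp t) = g t" if "t \<in> {0<..}" for t
    using that by (simp add: g_def powr_def Ln_of_real)
  have ai: "set_integrable lebesgue {0<..} g"
    using absolutely_integrable_Gamma_integral'[OF w] g_powr
    unfolding set_integrable_def by (auto simp: indicator_def cong: if_cong elim!: Bochner_Integration.integrable_cong[THEN iffD1, rotated -1])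
  have WF: "W t *\<^sub>R F t = indicator {0<..} t *\<^sub>R g t" for t
    by (auto simp: W_def F_def indicator_def scaleR_conv_of_real)
  have int: "integrable lborel (\<lambda>t. W t *\<^sub>R F t)"
    using ai unfolding WF set_integrable_def by (subst (asm) integrable_completion) auto
  have lint: "(LINT t|lborel. W t *\<^sub>R F t) = Gamma w"
  proof -
    have "(LINT t|lborel. W t *\<^sub>R F t) = (LINT t:{0<..}|lebesgue. g t)"
      unfolding WF set_lebesgue_integral_def by (subst integral_completion) auto
    also have "\<dots> = integral {0<..} g" by (rule set_lebesgue_integral_eq_integral(2)[OF ai])
    also have "\<dots> = Gamma w"
      using Gamma_integral_complex'[OF w] g_powr
      by (intro integral_unique) (rule has_integral_eq)
    finally show ?thesis .
  qed
  have D: "distr lborel lborel (\<lambda>x::real. exp (- x)) = density lborel (\<lambda>t. ennreal (W t))"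
  proof -
    have "indicator {0<..} t / ennreal t = ennreal (W t)" for t :: real
      using divide_ennreal[of 1 t] by (auto simp: W_def indicator_def)
    then show ?thesis unfolding distr_exp_minus by simp
  qed
  have W0: "0 \<le> W t" for t by (auto simp: W_def indicator_def)
  have m: "(\<lambda>x::real. exp (- x)) \<in> measurable lborel lborel" by measurable
  have F: "F \<in> borel_measurable lborel" by simp
  define G :: "real \<Rightarrow> complex" where "G a = exp (w * of_real a - of_real (exp a))" for a
  have FG: "F (exp (- x)) = G (0 + (-1) * x)" for x
  proof -
    have "F (exp (- x)) = exp (of_real (- x)) * exp ((w - 1) * of_real (- x)) / exp (of_real (exp (- x)))"
      by (simp add: F_def g_def flip: exp_of_real)
    also have "\<dots> = G (0 + (-1) * x)"
      unfolding G_def exp_add[symmetric] exp_diff[symmetric] by (simp add: algebra_simps)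
    finally show ?thesis .
  qed
  have "integrable lborel (\<lambda>x. G (0 + (-1) * x))"
    using integrable_distr_eq[OF m F] integrable_density[OF F, of W] W0 int unfolding D FG[symmetric] by simp
  then have "integrable lborel G" by (subst (asm) lborel_integrable_real_affine_iff) auto
  then show "integrable lborel (\<lambda>a::real. exp (w * of_real a - of_real (exp a)))"
    by (simp add: G_def[abs_def])
  have "(LINT x|lborel. G x) = (LINT x|lborel. G (0 + (-1) * x))"
    using lborel_integral_real_affine[of "-1" G 0] by simp
  also have "\<dots> = Gamma w"
    using integral_distr[OF m F] integral_density[OF F, of W] W0 lint unfolding D FG[symmetric] by simp
  finally show "(LINT a|lborel. exp (w * of_real a - of_real (exp a))) = Gamma w"
    by (simp add: G_def[abs_def])
qed

lemma integrable_inverse_square_plus: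
  fixes a :: real
  assumes "a > 0"
  shows "integrable lborel (\<lambda>v. 1 / (a + v\<^sup>2))"
proof (rule Bochner_Integration.integrable_bound)
  have "integrable lborel (\<lambda>v::real. inverse (1 + v\<^sup>2))"
    using integrable_inverse_1_plus_square by (simp add: set_integrable_def einterval_def)
  then show "integrable lborel (\<lambda>v::real. (1 + 1 / a) * inverse (1 + v\<^sup>2))" by simp
  show "AE v in lborel. norm (1 / (a + v\<^sup>2)) \<le> norm ((1 + 1 / a) * inverse (1 + v\<^sup>2))"
  proof (rule AE_I2)
    fix v :: real
    have p: "a + v\<^sup>2 > 0" "1 + v\<^sup>2 > 0" using assms by (auto intro: add_pos_nonneg)
    have "1 / (a + v\<^sup>2) \<le> (1 + 1 / a) / (1 + v\<^sup>2)"
      using p assms by (simp add: divide_simps) (auto simp: algebra_simps intro!: add_nonneg_nonneg)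
    then show "norm (1 / (a + v\<^sup>2)) \<le> norm ((1 + 1 / a) * inverse (1 + v\<^sup>2))"
      using p assms by (simp add: divide_inverse)
  qed
qed measurable

lemma not_nonpos_Ints_if_Re_pos: "Re z > 0 \<Longrightarrow> z \<notin> \<int>\<^sub>\<le>\<^sub>0"
  by (auto elim!: nonpos_Ints_cases)

text \<open>Two steps of the functional equation produce the quadratic denominator z (z + 1), while
  \<open>Gamma (z + 2)\<close> is bounded on the line by the integral of the modulus. A single step
  would only give decay like 1/|v|.\<close>

lemma integrable_Gamma_vertical:
  assumes a: "a > 0"
  shows "integrable lborel (\<lambda>v. Gamma (Complex a v))"
proof -
  define C where "C = (LINT u|lborel. norm (exp (of_real (a + 2) * of_real u - of_real (exp u) :: complex)))"
  have bound: "norm (Gamma (Complex a v)) \<le> C / (a\<^sup>2 + v\<^sup>2)" for v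
  proof -
    define z where "z = Complex a v"
    have z: "Re z = a" "Im z = v" by (simp_all add: z_def)
    have nz: "z \<noteq> 0" "z + 1 \<noteq> 0" using z a by (auto simp: complex_eq_iff)
    have "Gamma (z + 2) = (z * (z + 1)) * Gamma z"
      using Gamma_plus1[of "z + 1"] Gamma_plus1[of z] z a
      by (simp add: not_nonpos_Ints_if_Re_pos add.assoc ac_simps)
    then have G: "Gamma z = Gamma (z + 2) / (z * (z + 1))"
      using nz by simp
    have "norm (Gamma (z + 2)) \<le> C"
    proof -
      have R: "Re (z + 2) > 0" using z a by simp
      have "norm (Gamma (z + 2)) \<le> (LINT u|lborel. norm (exp ((z + 2) * of_real u - of_real (exp u))))"
        unfolding Gamma_log_integral(2)[OF R, symmetric] by (rule integral_norm_bound)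
      also have "\<dots> = C" by (simp add: C_def z)
      finally show ?thesis .
    qed
    moreover have "a\<^sup>2 + v\<^sup>2 \<le> norm (z * (z + 1))"
    proof -
      have "norm z \<le> norm (z + 1)"
        using a by (auto simp: cmod_def z power2_eq_square algebra_simps)
      then have "norm z * norm z \<le> norm z * norm (z + 1)" by (intro mult_left_mono) auto
      moreover have "norm z * norm z = a\<^sup>2 + v\<^sup>2"
        by (simp add: cmod_def z flip: power2_eq_square)
      ultimately show ?thesis by (simp add: norm_mult)
    qed
    moreover have "a\<^sup>2 + v\<^sup>2 > 0" using a by (auto intro: add_pos_nonneg)
    ultimately have "norm (Gamma z) \<le> C / (a\<^sup>2 + v\<^sup>2)"
      unfolding G norm_divide by (intro frac_le) (auto intro: order_trans[OF norm_ge_zero])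
    then show ?thesis by (simp add: z_def)
  qed
  have "continuous_on UNIV (\<lambda>v. Gamma (Complex a v))"
    by (rule continuous_on_compose2[OF continuous_on_Gamma, of "{z. Re z > 0}"])
       (auto simp: Complex_eq a not_nonpos_Ints_if_Re_pos intro!: continuous_intros)
  then have m: "(\<lambda>v. Gamma (Complex a v)) \<in> borel_measurable lborel"
    using borel_measurable_continuous_onI by simp
  have "a\<^sup>2 > 0" using a by simp
  from integrable_mult_right[OF integrable_inverse_square_plus[OF this], of C]
  have "integrable lborel (\<lambda>v. C * (1 / (a\<^sup>2 + v\<^sup>2)))" by simp
  then show ?thesis
    by (rule Bochner_Integration.integrable_bound[OF _ m])
       (auto intro!: AE_I2 order_trans[OF bound] divide_right_mono)
qed

text \<open>Fourier inversion, by Gaussian regularization of the inner integral.\<close>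

lemma fourier_inversion:
  fixes f :: "real \<Rightarrow> complex" and F :: "real \<Rightarrow> complex"
  assumes f: "integrable lborel f" and cont: "\<And>u. isCont f u" and bdd: "\<And>u. norm (f u) \<le> B"
    and F: "\<And>v. F v = (LINT u|lborel. f u * iexp (v * u))" and intF: "integrable lborel F"
  shows "(LINT v|lborel. F v * iexp (v * y)) = 2 * pi * f (- y)"
proof -
  define g where "g = std_normal_density"
  define e :: "nat \<Rightarrow> real" where "e k = inverse (real (Suc k))" for k
  have e: "e k > 0" for k by (simp add: e_def)
  have elim: "e \<longlonglongrightarrow> 0" unfolding e_def by (rule LIMSEQ_inverse_real_of_nat)
  have [measurable]: "g \<in> borel_measurable borel" by (simp add: g_def)
  have [measurable]: "f \<in> borel_measurable borel" "F \<in> borel_measurable borel"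
    using f intF by (auto dest: borel_measurable_integrable)
  have gcont: "isCont g u" for u unfolding g_def std_normal_density_def by (intro continuous_intros) auto
  have gint: "integrable lborel g" using integrable_std_normal_moment[of 0] by (simp add: g_def)
  have g0: "g u \<ge> 0" for u by (simp add: g_def)
  have gle: "g u \<le> 1 / sqrt (2 * pi)" for u
    by (auto simp: g_def std_normal_density_def divide_simps mult_left_le)
  have gchar: "(LINT v|lborel. of_real (g v) * iexp (t * v)) = complex_of_real (exp (- (t\<^sup>2) / 2))" for t
    using fun_cong[OF char_std_normal_distribution, of t]
    by (simp add: char_def integral_density g_def scaleR_conv_of_real)
  \<comment> \<open>The outer integral is damped by a Gaussian of width 1 / \<open>e k\<close>. The
    limit is found twice: directly, and after Fubini through the Fourier transform of the Gaussian,
    which averages \<open>f\<close> around - y at scale \<open>e k\<close>.\<close>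
  define I where "I k = (LINT v|lborel. F v * iexp (v * y) * of_real (g (e k * v)))" for k
  have norm_iexp: "norm (iexp s) = 1" for s by simp
  have lim1: "I \<longlonglongrightarrow> (LINT v|lborel. F v * iexp (v * y) * of_real (g 0))"
    unfolding I_def
  proof (rule integral_dominated_convergence[where w = "\<lambda>v. norm (F v) * (1 / sqrt (2 * pi))"])
    show "AE v in lborel. (\<lambda>k. F v * iexp (v * y) * of_real (g (e k * v))) \<longlonglongrightarrow> F v * iexp (v * y) * of_real (g 0)"
    proof (rule AE_I2)
      fix v
      have "(\<lambda>k. e k * v) \<longlonglongrightarrow> 0 * v" by (intro tendsto_intros elim)
      then have "(\<lambda>k. g (e k * v)) \<longlonglongrightarrow> g 0" using isCont_tendsto_compose[OF gcont, of "\<lambda>k. e k * v"] by simp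
      then show "(\<lambda>k. F v * iexp (v * y) * of_real (g (e k * v))) \<longlonglongrightarrow> F v * iexp (v * y) * of_real (g 0)"
        by (intro tendsto_intros)
    qed
    show "AE v in lborel. norm (F v * iexp (v * y) * of_real (g (e k * v))) \<le> norm (F v) * (1 / sqrt (2 * pi))" for k
      using mult_left_mono[OF gle norm_ge_zero] g0 by (intro AE_I2) (simp add: norm_mult)
  qed (use intF in auto)
  have I2: "I k = (LINT w|lborel. f (- y + e k * w) * of_real (exp (- (w\<^sup>2) / 2)))" for k
  proof -
    have gi: "integrable lborel (\<lambda>v. g (e k * v))"
      using lborel_integrable_real_affine[OF gint, of "e k" 0] e[of k] by simp
    define K where "K = (\<lambda>(v, u). iexp (v * (u + y)) * (of_real (g (e k * v)) * f u))"
    have [measurable]: "K \<in> borel_measurable (lborel \<Otimes>\<^sub>M lborel)"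
      unfolding K_def by measurable
    have "integrable (lborel \<Otimes>\<^sub>M lborel) (\<lambda>(v, u). complex_of_real (g (e k * v)) * f u)"
      using gi f by (intro integrable_pair_mult sigma_finite_lborel) auto
    then have Kint: "integrable (lborel \<Otimes>\<^sub>M lborel) K"
      by (rule Bochner_Integration.integrable_bound) (auto simp: K_def norm_mult)
    have "I k = (LINT v|lborel. LINT u|lborel. K (v, u))"
      unfolding I_def
    proof (rule Bochner_Integration.integral_cong[OF refl])
      fix v
      have "(LINT u|lborel. K (v, u)) = (LINT u|lborel. (iexp (v * y) * of_real (g (e k * v))) * (f u * iexp (v * u)))"
        by (rule Bochner_Integration.integral_cong[OF refl])
           (simp add: K_def algebra_simps exp_add)
      also have "\<dots> = (iexp (v * y) * of_real (g (e k * v))) * F v"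
        unfolding F by (rule integral_mult_right_zero)
      finally show "F v * iexp (v * y) * of_real (g (e k * v)) = (LINT u|lborel. K (v, u))" by simp
    qed
    also have "\<dots> = (LINT u|lborel. LINT v|lborel. K (v, u))"
      using lborel_pair.Fubini_integral[of "\<lambda>u v. K (u, v)"] Kint by simp
    also have "\<dots> = (LINT u|lborel. f u * of_real (exp (- ((u + y) / e k)\<^sup>2 / 2) / e k))"
    proof (rule Bochner_Integration.integral_cong[OF refl])
      fix u
      define h where "h v = of_real (g v) * iexp (((u + y) / e k) * v)" for v
      have "(LINT v|lborel. K (v, u)) = (LINT v|lborel. f u * h (0 + e k * v))"
        using e[of k] by (intro Bochner_Integration.integral_cong[OF refl]) (simp add: K_def h_def mult.commute)
      also have "\<dots> = f u * (LINT v|lborel. h (0 + e k * v))" by (rule integral_mult_right_zero)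
      also have "(LINT v|lborel. h (0 + e k * v)) = (LINT v|lborel. h v) / e k"
        using lborel_integral_real_affine[of "e k" h 0] e[of k] by (simp add: scaleR_conv_of_real)
      also have "(LINT v|lborel. h v) = of_real (exp (- ((u + y) / e k)\<^sup>2 / 2))"
        unfolding h_def by (rule gchar)
      finally show "(LINT v|lborel. K (v, u)) = f u * of_real (exp (- ((u + y) / e k)\<^sup>2 / 2) / e k)" by simp
    qed
    also have "\<dots> = e k *\<^sub>R (LINT w|lborel. f (- y + e k * w) * of_real (exp (- ((- y + e k * w + y) / e k)\<^sup>2 / 2) / e k))"
      using e[of k] by (subst lborel_integral_real_affine[of "e k" _ "- y"]) auto
    also have "\<dots> = (LINT w|lborel. f (- y + e k * w) * of_real (exp (- (w\<^sup>2) / 2)))"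
      using e[of k] unfolding integral_scaleR_right[symmetric]
      by (intro Bochner_Integration.integral_cong[OF refl]) (simp add: scaleR_conv_of_real)
    finally show ?thesis .
  qed
  have gauss: "integrable lborel (\<lambda>w::real. exp (- (w\<^sup>2) / 2))"
    "(LINT w|lborel. exp (- (w\<^sup>2) / 2)) = sqrt (2 * pi)"
  proof -
    have eq: "exp (- (w\<^sup>2) / 2) = sqrt (2 * pi) * g w" for w :: real
      by (simp add: g_def std_normal_density_def)
    show "integrable lborel (\<lambda>w::real. exp (- (w\<^sup>2) / 2))" unfolding eq using gint by simp
    have "(LINT w|lborel. g w) = 1" using integral_std_normal_moment_even[of 0] by (simp add: g_def)
    then show "(LINT w|lborel. exp (- (w\<^sup>2) / 2)) = sqrt (2 * pi)" unfolding eq by simp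
  qed
  have lim2: "I \<longlonglongrightarrow> (LINT w|lborel. f (- y) * of_real (exp (- (w\<^sup>2) / 2)))"
    unfolding I2
  proof (rule integral_dominated_convergence[where w = "\<lambda>w. B * exp (- (w\<^sup>2) / 2)"])
    show "AE w in lborel. (\<lambda>k. f (- y + e k * w) * of_real (exp (- (w\<^sup>2) / 2))) \<longlonglongrightarrow> f (- y) * of_real (exp (- (w\<^sup>2) / 2))"
    proof (rule AE_I2)
      fix w
      have "(\<lambda>k. - y + e k * w) \<longlonglongrightarrow> - y + 0 * w" by (intro tendsto_intros elim)
      then have "(\<lambda>k. f (- y + e k * w)) \<longlonglongrightarrow> f (- y)"
        using isCont_tendsto_compose[OF cont, of "\<lambda>k. - y + e k * w"] by simp
      then show "(\<lambda>k. f (- y + e k * w) * of_real (exp (- (w\<^sup>2) / 2))) \<longlonglongrightarrow> f (- y) * of_real (exp (- (w\<^sup>2) / 2))"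
        by (intro tendsto_intros)
    qed
    show "AE w in lborel. norm (f (- y + e k * w) * of_real (exp (- (w\<^sup>2) / 2))) \<le> B * exp (- (w\<^sup>2) / 2)" for k
      using bdd by (auto simp: norm_mult simp flip: of_real_exp intro!: mult_right_mono)
  qed (use gauss in auto)
  have "(LINT v|lborel. F v * iexp (v * y) * of_real (g 0)) = (LINT w|lborel. f (- y) * of_real (exp (- (w\<^sup>2) / 2)))"
    using lim1 lim2 by (rule LIMSEQ_unique)
  also have "(LINT v|lborel. F v * iexp (v * y) * of_real (g 0)) = (LINT v|lborel. F v * iexp (v * y)) * of_real (g 0)"
    by (rule integral_mult_left_zero)
  also have "(LINT w|lborel. f (- y) * of_real (exp (- (w\<^sup>2) / 2))) = f (- y) * (LINT w|lborel. of_real (exp (- (w\<^sup>2) / 2)))"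
    by (rule integral_mult_right_zero)
  also have "(LINT w|lborel. complex_of_real (exp (- (w\<^sup>2) / 2))) = of_real (sqrt (2 * pi))"
    unfolding gauss(2)[symmetric] by (rule integral_complex_of_real)
  finally have *: "(LINT v|lborel. F v * iexp (v * y)) * of_real (g 0) = f (- y) * of_real (sqrt (2 * pi))" .
  have "(LINT v|lborel. F v * iexp (v * y)) = (LINT v|lborel. F v * iexp (v * y)) * of_real (g 0) * of_real (sqrt (2 * pi))"
    by (simp add: g_def std_normal_density_def)
  also have "\<dots> = f (- y) * of_real (sqrt (2 * pi) * sqrt (2 * pi))"
    unfolding * by (simp only: of_real_mult mult.assoc)
  finally show ?thesis by simp
qed

text \<open>By \<open>Gamma_log_integral\<close>, Gamma on the line Re z = a is the Fourier
  transform of exp (a u - exp u). Inversion at - y returns exp (- a y - exp (- y)), and the real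
  part of the exponent removes exp (- a y).\<close>

lemma mellin_inversion_exp:
  assumes a: "a > 0"
  shows "(LINT v|lborel. Gamma (Complex a v) * exp (Complex a v * of_real y)) = of_real (2 * pi * exp (- exp (- y)))"
proof -
  define f :: "real \<Rightarrow> complex" where "f u = exp (of_real a * of_real u - of_real (exp u))" for u
  have bdd: "norm (f u) \<le> exp (a * ln a)" for u
  proof -
    \<comment> \<open>For this ratio, ln r <= r - 1 implies a u - exp u <= a ln a.\<close>
    define r where "r = exp u / a"
    have r: "r > 0" using a by (simp add: r_def)
    have "ln r \<le> r - 1" using r by (rule ln_le_minus_one)
    moreover have "ln r = u - ln a" using a by (simp add: r_def ln_div)
    ultimately have "u \<le> ln a + r" by simp
    then have "a * u \<le> a * (ln a + r)" using a by (intro mult_left_mono) auto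
    also have "\<dots> = a * ln a + exp u" using a by (simp add: r_def field_simps)
    finally show ?thesis by (simp add: f_def norm_exp_eq_Re)
  qed
  have *: "(LINT v|lborel. Gamma (Complex a v) * iexp (v * y)) = 2 * pi * f (- y)"
  proof (rule fourier_inversion)
    show "integrable lborel f"
      using Gamma_log_integral(1)[of "of_real a"] a by (simp add: f_def[abs_def])
    show "Gamma (Complex a v) = (LINT u|lborel. f u * iexp (v * u))" for v
      unfolding Gamma_log_integral(2)[of "Complex a v", simplified, OF a, symmetric] f_def exp_add[symmetric]
      by (intro Bochner_Integration.integral_cong refl arg_cong[where f = exp])
         (simp add: Complex_eq algebra_simps)
    show "integrable lborel (\<lambda>v. Gamma (Complex a v))" by (rule integrable_Gamma_vertical[OF a])
    show "isCont f u" for u unfolding f_def by (intro continuous_intros)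
  qed (rule bdd)
  have "(LINT v|lborel. Gamma (Complex a v) * exp (Complex a v * of_real y))
      = (LINT v|lborel. exp (of_real (a * y)) * (Gamma (Complex a v) * iexp (v * y)))"
    by (intro Bochner_Integration.integral_cong refl) (simp add: Complex_eq algebra_simps exp_add)
  also have "\<dots> = exp (of_real (a * y)) * (2 * pi * f (- y))"
    unfolding *[symmetric] by (rule integral_mult_right_zero)
  also have "\<dots> = 2 * pi * exp (of_real (a * y) + (of_real a * of_real (- y) - of_real (exp (- y))) :: complex)"
    by (simp only: exp_add f_def ac_simps)
  finally show ?thesis by (simp flip: exp_of_real)
qed

section \<open>Beta integrals in logarithmic coordinates\<close>

definition softplus :: "real \<Rightarrow> real" where "softplus r = ln (1 + exp r)"

lemma softplus_measurable [measurable]: "softplus \<in> borel_measurable borel"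
  unfolding softplus_def[abs_def] by measurable

lemma exp_softplus: "exp (softplus r) = 1 + exp r"
  by (simp add: softplus_def add_pos_pos)

text \<open>Since \<open>softplus r\<close> lies above both 0 and r, the exponent has real part at
  most - m |r|, with m the smaller of the two real parts. The exponential decay is then weakened to
  an inverse square.\<close>

lemma integrable_Beta_log:
  assumes "Re \<alpha> > 0" "Re \<beta> > 0"
  shows "integrable lborel (\<lambda>r. exp (\<beta> * of_real r - (\<alpha> + \<beta>) * of_real (softplus r)))"
proof -
  define m where "m = min (Re \<alpha>) (Re \<beta>)"
  have m: "m > 0" using assms by (simp add: m_def)
  have le: "norm (exp (\<beta> * of_real r - (\<alpha> + \<beta>) * of_real (softplus r))) \<le> (2 / m\<^sup>2) * (1 / (2 / m\<^sup>2 + r\<^sup>2))" for r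
  proof -
    have s0: "softplus r \<ge> 0" by (simp add: softplus_def)
    have sr: "softplus r \<ge> r" using exp_softplus[of r] by (smt (verit) exp_le_cancel_iff)
    have "Re \<beta> * r - (Re \<alpha> + Re \<beta>) * softplus r \<le> - (m * \<bar>r\<bar>)"
    proof (cases "r \<ge> 0")
      case True
      have "(Re \<alpha> + Re \<beta>) * r \<le> (Re \<alpha> + Re \<beta>) * softplus r" using sr assms by (intro mult_left_mono) auto
      moreover have "m * r \<le> Re \<alpha> * r" using True by (intro mult_right_mono) (auto simp: m_def)
      ultimately show ?thesis using True by (simp add: algebra_simps)
    next
      case False
      have "0 \<le> (Re \<alpha> + Re \<beta>) * softplus r" using s0 assms by simp
      moreover have "Re \<beta> * r \<le> m * r" using False by (intro mult_right_mono_neg) (auto simp: m_def)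
      ultimately have "Re \<beta> * r - (Re \<alpha> + Re \<beta>) * softplus r \<le> m * r" by linarith
      then show ?thesis using False by simp
    qed
    then have "norm (exp (\<beta> * of_real r - (\<alpha> + \<beta>) * of_real (softplus r))) \<le> exp (- (m * \<bar>r\<bar>))"
      by (simp add: norm_exp_eq_Re)
    also have "\<dots> \<le> 1 / (1 + (m * \<bar>r\<bar>)\<^sup>2 / 2)"
    proof -
      have "1 + (m * \<bar>r\<bar>)\<^sup>2 / 2 \<le> exp (m * \<bar>r\<bar>)"
        using exp_lower_Taylor_quadratic[of "m * \<bar>r\<bar>"] m by (smt (verit) abs_ge_zero mult_nonneg_nonneg)
      then show ?thesis
        unfolding exp_minus inverse_eq_divide by (intro divide_left_mono) (auto intro!: mult_pos_pos add_pos_nonneg)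
    qed
    also have "\<dots> = (2 / m\<^sup>2) * (1 / (2 / m\<^sup>2 + r\<^sup>2))"
    proof -
      have "2 / m\<^sup>2 + r\<^sup>2 > 0" using m by (auto intro: add_pos_nonneg)
      moreover have "(1 + (m * \<bar>r\<bar>)\<^sup>2 / 2) * 2 / m\<^sup>2 = 2 / m\<^sup>2 + r\<^sup>2"
        using m by (simp add: field_simps power_mult_distrib)
      ultimately show ?thesis using m by (simp add: field_simps)
    qed
    finally show ?thesis .
  qed
  have "integrable lborel (\<lambda>r. (2 / m\<^sup>2) * (1 / (2 / m\<^sup>2 + r\<^sup>2)))"
    using m by (intro integrable_mult_right integrable_inverse_square_plus) auto
  then show ?thesis
  proof (rule Bochner_Integration.integrable_bound)
    show "AE r in lborel. norm (exp (\<beta> * of_real r - (\<alpha> + \<beta>) * of_real (softplus r)))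
        \<le> norm (2 / m\<^sup>2 * (1 / (2 / m\<^sup>2 + r\<^sup>2)))"
      using order_trans[OF le abs_ge_self] by (intro AE_I2) simp
  qed measurable
qed

text \<open>In the double integral for the two Gamma values, over t (index \<open>False\<close>) and
  s (index \<open>True\<close>), the shears r = s - t and t + softplus r are applied; the latter is
  the logarithm of exp t + exp s. The exponent then splits into a Gamma integral with parameter
  \<alpha> + \<beta> and the integral sought. The last column of the main integral is treated by the
  same two shears.\<close>

lemma integral_Beta_log:
  assumes ab: "Re \<alpha> > 0" "Re \<beta> > 0"
  shows "(LINT r|lborel. exp (\<beta> * of_real r - (\<alpha> + \<beta>) * of_real (softplus r))) = Gamma \<alpha> * Gamma \<beta> / Gamma (\<alpha> + \<beta>)"
proof -
  define f where "f b = (\<lambda>t::real. exp ((if b then \<beta> else \<alpha>) * of_real t - of_real (exp t)))" for b :: bool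
  define g where "g b = (\<lambda>t::real. if b then exp (\<beta> * of_real t - (\<alpha> + \<beta>) * of_real (softplus t))
     else exp ((\<alpha> + \<beta>) * of_real t - of_real (exp t)))" for b :: bool
  have ab2: "Re (\<alpha> + \<beta>) > 0" using ab by simp
  have fi: "integrable lborel (f b)" for b
    using Gamma_log_integral(1)[OF ab(1)] Gamma_log_integral(1)[OF ab(2)] by (cases b) (simp_all add: f_def)
  have gi: "integrable lborel (g b)" for b
    using Gamma_log_integral(1)[OF ab2] integrable_Beta_log[OF ab] by (cases b) (simp_all add: g_def)
  define h1 where "h1 b = (\<lambda>x::bool \<Rightarrow> real. if b then - x False else 0)" for b
  define h2 where "h2 b = (\<lambda>x::bool \<Rightarrow> real. if b then 0 else softplus (x True))" for b
  let ?P = "PiR (UNIV :: bool set)"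
  have d1: "distr ?P ?P (\<lambda>x k. x k + h1 k x) = ?P"
  proof -
    have "distr ?P ?P (\<lambda>x. \<lambda>k\<in>UNIV. x k + h1 k x) = ?P"
      by (rule distr_PiR_triangular[where r = "\<lambda>b. if b then 1 else 0"])
         (auto simp: h1_def split: if_splits)
    then show ?thesis unfolding restrict_UNIV .
  qed
  have d2: "distr ?P ?P (\<lambda>x k. x k + h2 k x) = ?P"
  proof -
    have "distr ?P ?P (\<lambda>x. \<lambda>k\<in>UNIV. x k + h2 k x) = ?P"
      by (rule distr_PiR_triangular[where r = "\<lambda>b. if b then 0 else 1"])
         (auto simp: h2_def split: if_splits)
    then show ?thesis unfolding restrict_UNIV .
  qed
  have m1[measurable]: "(\<lambda>x k. x k + h1 k x) \<in> measurable ?P ?P"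
  proof -
    have "(\<lambda>x. \<lambda>k\<in>UNIV. x k + h1 k x) \<in> measurable ?P ?P"
      by (intro measurable_restrict) (auto simp: h1_def)
    then show ?thesis unfolding restrict_UNIV .
  qed
  have m2[measurable]: "(\<lambda>x k. x k + h2 k x) \<in> measurable ?P ?P"
  proof -
    have "(\<lambda>x. \<lambda>k\<in>UNIV. x k + h2 k x) \<in> measurable ?P ?P"
      by (intro measurable_restrict) (auto simp: h2_def)
    then show ?thesis unfolding restrict_UNIV .
  qed
  define Gp where "Gp x = (\<Prod>k\<in>UNIV. g k (x k))" for x :: "bool \<Rightarrow> real"
  have [measurable]: "g b \<in> borel_measurable borel" for b using gi[of b] by auto
  have [measurable]: "Gp \<in> borel_measurable ?P" unfolding Gp_def UNIV_bool by simp
  have "(LINT x|?P. Gp x) = (LINT x|?P. Gp (\<lambda>k. x k + h2 k x))"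
    by (subst d2[symmetric], subst integral_distr) auto
  also have "\<dots> = (LINT x|?P. Gp (\<lambda>k. (x k + h1 k x) + h2 k (\<lambda>k. x k + h1 k x)))"
    by (subst d1[symmetric], subst integral_distr) auto
  also have "\<dots> = (LINT x|?P. (\<Prod>k\<in>UNIV. f k (x k)))"
  proof (rule Bochner_Integration.integral_cong[OF refl])
    fix x :: "bool \<Rightarrow> real"
    define t s where "t = x False" and "s = x True"
    have e: "exp (t + softplus (s - t)) = exp t + exp s"
      by (simp add: exp_add exp_softplus distrib_left exp_diff)
    have "Gp (\<lambda>k. (x k + h1 k x) + h2 k (\<lambda>k. x k + h1 k x))
      = exp (((\<alpha> + \<beta>) * of_real (t + softplus (s - t)) - of_real (exp (t + softplus (s - t))))
         + (\<beta> * of_real (s - t) - (\<alpha> + \<beta>) * of_real (softplus (s - t))))"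
      unfolding exp_add[where 'a = complex] by (simp add: Gp_def UNIV_bool g_def h1_def h2_def t_def s_def)
    also have "\<dots> = exp ((\<alpha> * of_real t - of_real (exp t)) + (\<beta> * of_real s - of_real (exp s)))"
      unfolding e by (simp add: algebra_simps)
    also have "\<dots> = (\<Prod>k\<in>UNIV. f k (x k))"
      unfolding exp_add[where 'a = complex] by (simp add: UNIV_bool f_def t_def s_def)
    finally show "Gp (\<lambda>k. (x k + h1 k x) + h2 k (\<lambda>k. x k + h1 k x)) = (\<Prod>k\<in>UNIV. f k (x k))" .
  qed
  finally have "(\<Prod>k\<in>UNIV. LINT t|lborel. g k t) = (\<Prod>k\<in>UNIV. LINT t|lborel. f k t)"
    unfolding Gp_def using gi fi by (simp add: PiR.product_integral_prod)
  then have "Gamma (\<alpha> + \<beta>) * (LINT r|lborel. exp (\<beta> * of_real r - (\<alpha> + \<beta>) * of_real (softplus r))) = Gamma \<alpha> * Gamma \<beta>"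
    using Gamma_log_integral(2)[OF ab(1)] Gamma_log_integral(2)[OF ab(2)] Gamma_log_integral(2)[OF ab2]
    by (simp add: UNIV_bool f_def g_def)
  moreover have "Gamma (\<alpha> + \<beta>) \<noteq> 0"
    using ab2 by (simp add: Gamma_eq_zero_iff not_nonpos_Ints_if_Re_pos)
  ultimately show ?thesis by (simp add: field_simps)
qed

section \<open>Matrices as operators on coordinate functions\<close>

text \<open>Coordinates are indexed by the integers \<open>1, \<dots>, n, -n, \<dots>, -1\<close> (in this order), \<open>-k\<close> standing
  for the index \<open>2n + 1 - k\<close> dual to \<open>k\<close>.\<close>

definition valid :: "nat \<Rightarrow> int \<Rightarrow> bool" where
  "valid n k \<longleftrightarrow> 1 \<le> \<bar>k\<bar> \<and> \<bar>k\<bar> \<le> int n"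

definition pos :: "nat \<Rightarrow> int \<Rightarrow> nat" where
  "pos n k = (if k > 0 then nat (k - 1) else nat (2 * int n + k))"

definition ind :: "nat \<Rightarrow> nat \<Rightarrow> int" where
  "ind n p = (if p < n then int p + 1 else int p - 2 * int n)"

definition coord :: "nat \<Rightarrow> real Matrix.vec \<Rightarrow> int \<Rightarrow> real" where
  "coord n w k = (if valid n k then w $ pos n k else 0)"

lemma valid_uminus [simp]: "valid n (- k) \<longleftrightarrow> valid n k"
  by (simp add: valid_def)

lemma pos_less: "valid n k \<Longrightarrow> pos n k < 2 * n"
  by (auto simp: valid_def pos_def)

lemma pos_ind: "p < 2 * n \<Longrightarrow> valid n (ind n p) \<and> pos n (ind n p) = p"
  by (auto simp: valid_def pos_def ind_def)

lemma ind_pos: "valid n k \<Longrightarrow> ind n (pos n k) = k"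
  by (auto simp: valid_def pos_def ind_def)

lemma pos_eq_iff: "valid n k \<Longrightarrow> valid n l \<Longrightarrow> pos n k = pos n l \<longleftrightarrow> k = l"
  by (metis ind_pos)

lemma pos_uminus: "valid n k \<Longrightarrow> pos n (- k) = 2 * n - 1 - pos n k"
  by (auto simp: valid_def pos_def)

lemma coord_eqD: "w \<in> carrier_vec (2*n) \<Longrightarrow> w' \<in> carrier_vec (2*n) \<Longrightarrow> coord n w = coord n w' \<Longrightarrow> w = w'"
  by (rule eq_vecI) (metis carrier_vecD coord_def pos_ind)+

text \<open>Products of sparse matrices become compositions of function updates, so the computations
  with rows never touch matrix entries.\<close>

definition acts :: "nat \<Rightarrow> real mat \<Rightarrow> ((int \<Rightarrow> real) \<Rightarrow> int \<Rightarrow> real) \<Rightarrow> bool" where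
  "acts n A f \<longleftrightarrow> A \<in> carrier_mat (2*n) (2*n) \<and> (\<forall>w\<in>carrier_vec (2*n). coord n (A *\<^sub>v w) = f (coord n w))"

lemma actsD: "acts n A f \<Longrightarrow> w \<in> carrier_vec (2*n) \<Longrightarrow> coord n (A *\<^sub>v w) = f (coord n w)"
  and acts_carrier: "acts n A f \<Longrightarrow> A \<in> carrier_mat (2*n) (2*n)"
  by (auto simp: acts_def)

lemma acts_mult:
  assumes "acts n A f" "acts n B g"
  shows "acts n (A * B) (f \<circ> g)"
  using assms unfolding acts_def by (auto simp: assoc_mult_mat_vec[of A "2*n" "2*n" B "2*n"])

lemma acts_one: "acts n (1\<^sub>m (2*n)) id"
  by (auto simp: acts_def)

lemma acts_mult_list:
  assumes "\<And>a. a \<in> set ws \<Longrightarrow> acts n (A a) (f a)"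
  shows "acts n (mat_prod_list n (map A ws)) (foldr (\<lambda>a h. f a \<circ> h) ws id)"
  using assms by (induction ws) (auto simp: mat_prod_list_def acts_one intro!: acts_mult)

lemma index_mult_mat_sum:
  assumes "A \<in> carrier_mat N N" "B \<in> carrier_mat N N" "i < N" "j < N"
  shows "(A * B) $$ (i, j) = (\<Sum>q<N. A $$ (i, q) * B $$ (q, j))"
  using assms by (simp add: scalar_prod_def atLeast0LessThan)

lemma mat_eq_if_mult_vec_eq:
  assumes A: "A \<in> carrier_mat N N" and B: "B \<in> carrier_mat N N"
    and eq: "\<And>w. w \<in> carrier_vec N \<Longrightarrow> A *\<^sub>v w = B *\<^sub>v (w :: real Matrix.vec)"
  shows "A = B"
proof (rule eq_matI)
  fix i j assume ij: "i < dim_row B" "j < dim_col B"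
  have "(A *\<^sub>v unit_vec N j) $ i = (B *\<^sub>v unit_vec N j) $ i" by (simp add: eq)
  then show "A $$ (i, j) = B $$ (i, j)" using ij A B by simp
qed (use A B in auto)

lemma acts_unique: "acts n A f \<Longrightarrow> acts n B f \<Longrightarrow> A = B"
  by (rule mat_eq_if_mult_vec_eq[of _ "2*n"]) (auto simp: acts_def intro!: coord_eqD[of _ n])

section \<open>Root vectors and their exponentials\<close>

definition elem_op :: "int \<Rightarrow> int \<Rightarrow> real \<Rightarrow> (int \<Rightarrow> real) \<Rightarrow> int \<Rightarrow> real" where
  "elem_op a b c x = x(a := x a + c * x b, - b := x (- b) - c * x (- a))"

definition root_mat :: "nat \<Rightarrow> int \<Rightarrow> int \<Rightarrow> real mat" where
  "root_mat n a b = mat (2*n) (2*n) (\<lambda>(p, q).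
     (if p = pos n a \<and> q = pos n b then 1 else 0) - (if p = pos n (- b) \<and> q = pos n (- a) then 1 else 0))"

text \<open>For a = b the matrix \<open>root_mat n a b\<close> is diagonal and for a = - b it is
  zero; all other pairs give root vectors of type D.\<close>

definition root_pair :: "nat \<Rightarrow> int \<Rightarrow> int \<Rightarrow> bool" where
  "root_pair n a b \<longleftrightarrow> valid n a \<and> valid n b \<and> a \<noteq> b \<and> a \<noteq> - b"

lemma root_mat_carrier [simp]: "root_mat n a b \<in> carrier_mat (2*n) (2*n)"
  by (simp add: root_mat_def)

lemma root_mat_mult_vec:
  assumes "root_pair n a b" "w \<in> carrier_vec (2*n)" "p < 2*n"
  shows "(root_mat n a b *\<^sub>v w) $ p
    = (if p = pos n a then w $ pos n b else 0) - (if p = pos n (- b) then w $ pos n (- a) else 0)"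
proof -
  have v: "pos n b < 2*n" "pos n (- a) < 2*n"
    using assms by (auto simp: root_pair_def intro!: pos_less)
  have "(root_mat n a b *\<^sub>v w) $ p = (\<Sum>q<2*n. root_mat n a b $$ (p, q) * w $ q)"
    using assms by (simp add: root_mat_def scalar_prod_def atLeast0LessThan)
  also have "\<dots> = (\<Sum>q<2*n. (if q = pos n b then (if p = pos n a then w $ q else 0) else 0)
      - (if q = pos n (- a) then (if p = pos n (- b) then w $ q else 0) else 0))"
    using assms(3) by (intro sum.cong refl) (auto simp: root_mat_def)
  also have "\<dots> = (if p = pos n a then w $ pos n b else 0) - (if p = pos n (- b) then w $ pos n (- a) else 0)"
    using v by (simp add: sum_subtractf)
  finally show ?thesis .
qed

text \<open>The column indices b, - a of the two matrix units are distinct from their row indices a,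
  - b, so every product of units vanishes and the exponential series stops after the linear
  term.\<close>

lemma root_mat_square:
  assumes "root_pair n a b"
  shows "root_mat n a b * root_mat n a b = 0\<^sub>m (2*n) (2*n)"
proof (rule mat_eq_if_mult_vec_eq[of _ "2*n"])
  fix w :: "real Matrix.vec" assume w: "w \<in> carrier_vec (2*n)"
  have v: "valid n a" "valid n b" "valid n (-a)" "valid n (-b)" "a \<noteq> b" "a \<noteq> - b" "- b \<noteq> a" "b \<noteq> - b" "a \<noteq> - a"
    using assms by (auto simp: root_pair_def) (auto simp: valid_def)
  have l: "pos n b < 2*n" "pos n (- a) < 2*n" "pos n a < 2 * n" "pos n (- b) < 2*n"
    using v by (auto intro!: pos_less)
  have rw: "root_mat n a b *\<^sub>v w \<in> carrier_vec (2*n)" using w by (rule mult_mat_vec_carrier[OF root_mat_carrier])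
  have z: "0\<^sub>m (2*n) (2*n) *\<^sub>v w = 0\<^sub>v (2*n)" by (rule eq_vecI) (use w in \<open>auto simp: scalar_prod_def\<close>)
  show "root_mat n a b * root_mat n a b *\<^sub>v w = 0\<^sub>m (2*n) (2*n) *\<^sub>v w" unfolding z
    unfolding assoc_mult_mat_vec[OF root_mat_carrier root_mat_carrier w]
    by (rule eq_vecI)
       (use w v l in \<open>auto simp: root_mat_mult_vec[OF assms rw] root_mat_mult_vec[OF assms w] pos_eq_iff root_mat_def[THEN arg_cong[where f = dim_row]]
          simp del: index_mult_mat_vec\<close>)
qed (auto intro!: mult_carrier_mat[of _ _ "2*n"])

lemma mat_exp_nilpotent:
  assumes A: "A \<in> carrier_mat N N" and "A * A = 0\<^sub>m N N"
  shows "mat_exp A = 1\<^sub>m N + A"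
proof -
  have P: "A ^\<^sub>m Suc (Suc k) = 0\<^sub>m N N" for k
  proof (induction k)
    case 0 then show ?case using assms by simp
  next
    case (Suc k) then show ?case using A by simp
  qed
  have "(\<Sum>k. (A ^\<^sub>m k) $$ (i, j) / fact k) = (1\<^sub>m N + A) $$ (i, j)" if "i < N" "j < N" for i j
  proof -
    have "(\<lambda>k. (A ^\<^sub>m k) $$ (i, j) / fact k) sums (\<Sum>k\<in>{0, 1}. (A ^\<^sub>m k) $$ (i, j) / fact k)"
    proof (rule sums_finite)
      fix k :: nat assume "k \<notin> {0, 1}"
      then obtain k' where "k = Suc (Suc k')" by (metis insertCI not0_implies_Suc One_nat_def)
      then show "(A ^\<^sub>m k) $$ (i, j) / fact k = 0" using that P[of k'] by simp
    qed simp
    then show ?thesis using A that by (simp add: sums_unique[symmetric])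
  qed
  then show ?thesis using A by (intro eq_matI) (auto simp: mat_exp_def)
qed

lemma mat_exp_root_mat:
  assumes "root_pair n a b"
  shows "mat_exp (c \<cdot>\<^sub>m root_mat n a b) = 1\<^sub>m (2*n) + c \<cdot>\<^sub>m root_mat n a b"
proof (rule mat_exp_nilpotent)
  have "c \<cdot>\<^sub>m root_mat n a b * (c \<cdot>\<^sub>m root_mat n a b) = c \<cdot>\<^sub>m (c \<cdot>\<^sub>m (root_mat n a b * root_mat n a b))"
    using mult_smult_assoc_mat[of "root_mat n a b" "2*n" "2*n" "c \<cdot>\<^sub>m root_mat n a b" "2*n" c]
      mult_smult_distrib[of "root_mat n a b" "2*n" "2*n" "root_mat n a b" "2*n" c] by simp
  then show "c \<cdot>\<^sub>m root_mat n a b * (c \<cdot>\<^sub>m root_mat n a b) = 0\<^sub>m (2*n) (2*n)"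
    using root_mat_square[OF assms] by simp
qed simp

lemma smult_mat_mult_vec:
  fixes A :: "real mat"
  assumes "A \<in> carrier_mat nr nc" "w \<in> carrier_vec nc"
  shows "(c \<cdot>\<^sub>m A) *\<^sub>v w = c \<cdot>\<^sub>v (A *\<^sub>v w)"
  using assms by (intro eq_vecI) (auto simp: scalar_prod_def sum_distrib_left mult.assoc)

lemma acts_root_exp:
  assumes r: "root_pair n a b"
  shows "acts n (mat_exp (c \<cdot>\<^sub>m root_mat n a b)) (elem_op a b c)"
  unfolding acts_def
proof (intro conjI ballI ext)
  show "mat_exp (c \<cdot>\<^sub>m root_mat n a b) \<in> carrier_mat (2*n) (2*n)" by (simp add: mat_exp_root_mat[OF r])
  fix w :: "real Matrix.vec" and k assume w: "w \<in> carrier_vec (2*n)"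
  have v: "valid n a" "valid n b" "valid n (-a)" "valid n (-b)" "a \<noteq> b" "a \<noteq> - b"
    using r by (auto simp: root_pair_def)
  show "coord n (mat_exp (c \<cdot>\<^sub>m root_mat n a b) *\<^sub>v w) k = elem_op a b c (coord n w) k"
  proof (cases "valid n k")
    case True
    have "(mat_exp (c \<cdot>\<^sub>m root_mat n a b) *\<^sub>v w) = w + c \<cdot>\<^sub>v (root_mat n a b *\<^sub>v w)"
      using w unfolding mat_exp_root_mat[OF r]
      by (subst add_mult_distrib_mat_vec[where nr = "2*n" and nc = "2*n"])
         (auto simp: smult_mat_mult_vec[OF root_mat_carrier])
    then show ?thesis
      using True pos_less[OF True] w v
      by (auto simp: coord_def elem_op_def root_mat_mult_vec[OF r w] pos_eq_iff root_mat_def[THEN arg_cong[where f = dim_row]]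
          simp del: index_mult_mat_vec)
  next
    case False
    then show ?thesis using v by (auto simp: coord_def elem_op_def)
  qed
qed

text \<open>The two spin nodes differ in the sign of the index n, which stands for the matrix
  positions n and n + 1.\<close>

fun node_pair :: "nat \<Rightarrow> node \<Rightarrow> int \<times> int" where
  "node_pair n (Lin i) = (int i, int i + 1)"
| "node_pair n (Spin s) = (int n - 1, if s = 1 then int n else - int n)"

fun valid_node :: "nat \<Rightarrow> node \<Rightarrow> bool" where
  "valid_node n (Lin i) \<longleftrightarrow> 1 \<le> i \<and> i + 1 \<le> n"
| "valid_node n (Spin s) \<longleftrightarrow> 2 \<le> n"

lemma root_pair_node: "valid_node n a \<Longrightarrow> node_pair n a = (u, v) \<Longrightarrow> root_pair n u v"
  by (cases a) (auto simp: root_pair_def valid_def split: if_splits)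

lemma root_pair_swap: "root_pair n u v \<Longrightarrow> root_pair n v u"
  by (auto simp: root_pair_def)

lemma pos_int: "1 \<le> k \<Longrightarrow> Suc (pos n (int k)) = k" "1 \<le> k \<Longrightarrow> k \<le> 2 * n \<Longrightarrow> Suc (pos n (- int k)) = 2 * n + 1 - k"
  by (auto simp: pos_def nat_diff_distrib')

lemma mat_unit_diff:
  assumes "Suc (pos n u) = a" "Suc (pos n v) = b" "Suc (pos n (- v)) = c" "Suc (pos n (- u)) = d"
  shows "mat_unit n a b - mat_unit n c d = root_mat n u v"
  by (rule eq_matI) (auto simp: mat_unit_def root_mat_def assms[symmetric])

lemma chev_e_root_mat:
  assumes "valid_node n a" "node_pair n a = (u, v)"
  shows "chev_e n a = root_mat n u v"
proof (cases a)
  case (Lin i)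
  then have uv: "u = int i" "v = int i + 1" and i: "1 \<le> i" "i + 1 \<le> n" using assms by auto
  show ?thesis
    unfolding Lin uv chev_e.simps using i pos_int[of i n] pos_int[of "i + 1" n]
      by (intro mat_unit_diff) (auto simp: algebra_simps)
next
  case (Spin s)
  then have uv: "u = int n - 1" "v = (if s = 1 then int n else - int n)" and n: "2 \<le> n" using assms by auto
  show ?thesis
    unfolding Spin uv chev_e.simps using n pos_int[of n n] pos_int[of "n - 1" n]
    by (cases "s = 1") (simp_all only: if_True if_False simp_thms, (rule mat_unit_diff; simp add: of_nat_diff)+)
qed

lemma chev_f_root_mat:
  assumes "valid_node n a" "node_pair n a = (u, v)"
  shows "- chev_f n a = (-1) \<cdot>\<^sub>m root_mat n v u"
proof -
  have "chev_f n a = root_mat n v u"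
  proof (cases a)
    case (Lin i)
    then have uv: "u = int i" "v = int i + 1" and i: "1 \<le> i" "i + 1 \<le> n" using assms by auto
    show ?thesis
      unfolding Lin uv chev_f.simps using i pos_int[of i n] pos_int[of "i + 1" n]
      by (intro mat_unit_diff) (auto simp: algebra_simps)
  next
    case (Spin s)
    then have uv: "u = int n - 1" "v = (if s = 1 then int n else - int n)" and n: "2 \<le> n" using assms by auto
    show ?thesis
      unfolding Spin uv chev_f.simps using n pos_int[of n n] pos_int[of "n - 1" n]
      by (cases "s = 1") (simp_all only: if_True if_False simp_thms, (rule mat_unit_diff; simp add: of_nat_diff)+)
  qed
  then show ?thesis by (auto simp: root_mat_def)
qed

text \<open>The action of exp(e) exp(-f) exp(e): a signed transposition of \<open>a\<close> and
  \<open>b\<close>, and of their duals.\<close>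

definition refl_op :: "int \<Rightarrow> int \<Rightarrow> (int \<Rightarrow> real) \<Rightarrow> int \<Rightarrow> real" where
  "refl_op a b x = x(a := x b, b := - x a, - b := - x (- a), - a := x (- b))"

lemma refl_op_elem:
  assumes "a \<noteq> b" "a \<noteq> - b" "a \<noteq> 0" "b \<noteq> 0"
  shows "elem_op a b 1 \<circ> (elem_op b a (-1) \<circ> elem_op a b 1) = refl_op a b"
  using assms by (auto simp: fun_eq_iff elem_op_def refl_op_def)

lemma acts_refl:
  assumes a: "valid_node n a" and uv: "node_pair n a = (u, v)"
  shows "acts n (mat_exp (chev_e n a) * mat_exp (- chev_f n a) * mat_exp (chev_e n a)) (refl_op u v)"
proof -
  have r: "root_pair n u v" by (rule root_pair_node[OF a uv])
  have one: "1 \<cdot>\<^sub>m root_mat n u v = root_mat n u v" by (rule eq_matI) auto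
  have e: "acts n (mat_exp (chev_e n a)) (elem_op u v 1)"
    using acts_root_exp[OF r, of 1] chev_e_root_mat[OF a uv] by (simp add: one)
  have f: "acts n (mat_exp (- chev_f n a)) (elem_op v u (-1))"
    using acts_root_exp[OF root_pair_swap[OF r], of "-1"] chev_f_root_mat[OF a uv] by simp
  have "(elem_op u v 1 \<circ> elem_op v u (-1)) \<circ> elem_op u v 1 = refl_op u v"
    using refl_op_elem[of u v] r by (auto simp: root_pair_def valid_def comp_assoc)
  then show ?thesis using acts_mult[OF acts_mult[OF e f] e] by simp
qed

section \<open>Words of Chevalley generators as operators\<close>

definition word_op :: "nat \<Rightarrow> (real \<times> node) list \<Rightarrow> (int \<Rightarrow> real) \<Rightarrow> int \<Rightarrow> real" where
  "word_op n ws = foldr (\<lambda>(c, a) h. elem_op (fst (node_pair n a)) (snd (node_pair n a)) c \<circ> h) ws id"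

definition word_refl :: "nat \<Rightarrow> (real \<times> node) list \<Rightarrow> (int \<Rightarrow> real) \<Rightarrow> int \<Rightarrow> real" where
  "word_refl n ws = foldr (\<lambda>(c, a) h. refl_op (fst (node_pair n a)) (snd (node_pair n a)) \<circ> h) ws id"

lemma word_op_simps [simp]:
  "word_op n [] = id"
  "word_op n ((c, a) # ws) = elem_op (fst (node_pair n a)) (snd (node_pair n a)) c \<circ> word_op n ws"
  by (simp_all add: word_op_def)

lemma word_op_append: "word_op n (ws @ vs) = word_op n ws \<circ> word_op n vs"
  by (induction ws) auto

lemma word_refl_simps [simp]:
  "word_refl n [] = id"
  "word_refl n ((c, a) # ws) = refl_op (fst (node_pair n a)) (snd (node_pair n a)) \<circ> word_refl n ws"
  by (simp_all add: word_refl_def)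

lemma word_refl_append: "word_refl n (ws @ vs) = word_refl n ws \<circ> word_refl n vs"
  by (induction ws) auto

lemma full_word_valid:
  assumes "n \<ge> 2" "(c, a) \<in> set (full_word n t s)"
  shows "valid_node n a"
  using assms by (auto simp: full_word_def row_word_def)

lemma acts_X_mat:
  assumes "n \<ge> 2"
  shows "acts n (X_mat n t s) (word_op n (full_word n t s))"
proof -
  have "acts n (X_mat n t s) (foldr (\<lambda>ca h. (case ca of (c, a) \<Rightarrow> elem_op (fst (node_pair n a)) (snd (node_pair n a)) c) \<circ> h)
      (full_word n t s) id)"
    unfolding X_mat_def
    by (rule acts_mult_list)
       (auto simp: chev_e_root_mat[OF full_word_valid[OF assms] prod.collapse[symmetric]]
         intro!: acts_root_exp root_pair_node[OF full_word_valid[OF assms] prod.collapse[symmetric]])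
  also have "(\<lambda>ca h. (case ca of (c, a) \<Rightarrow> elem_op (fst (node_pair n a)) (snd (node_pair n a)) c) \<circ> h)
     = (\<lambda>(c, a) h. elem_op (fst (node_pair n a)) (snd (node_pair n a)) c \<circ> h)" by auto
  finally show ?thesis by (simp only: word_op_def)
qed

lemma acts_w0_lift:
  assumes "n \<ge> 2"
  shows "acts n (w0_lift n) (word_refl n (full_word n (\<lambda>_. 1) (\<lambda>_. 1)))"
proof -
  have "acts n (w0_lift n) (foldr (\<lambda>ca h. (case ca of (c, a) \<Rightarrow> refl_op (fst (node_pair n a)) (snd (node_pair n a))) \<circ> h)
      (full_word n (\<lambda>_. 1) (\<lambda>_. 1)) id)"
    unfolding w0_lift_def
    by (rule acts_mult_list)
       (auto intro!: acts_refl full_word_valid[OF assms])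
  also have "(\<lambda>ca h. (case ca of (c, a) \<Rightarrow> refl_op (fst (node_pair n a)) (snd (node_pair n a))) \<circ> h)
     = (\<lambda>(c, a) h. refl_op (fst (node_pair n a)) (snd (node_pair n a)) \<circ> h)" by auto
  finally show ?thesis by (simp only: word_refl_def)
qed

section \<open>The torus\<close>

definition torus_val :: "(nat \<Rightarrow> real) \<Rightarrow> int \<Rightarrow> real" where
  "torus_val T k = (if k > 0 then T (nat k) else inverse (T (nat (- k))))"

definition torus_op :: "nat \<Rightarrow> (nat \<Rightarrow> real) \<Rightarrow> (int \<Rightarrow> real) \<Rightarrow> int \<Rightarrow> real" where
  "torus_op n T x k = (if valid n k then torus_val T k * x k else x k)"

lemma acts_torus: "acts n (torus_mat n T) (torus_op n T)"
  unfolding acts_def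
proof (intro conjI ballI ext)
  show "torus_mat n T \<in> carrier_mat (2*n) (2*n)" by (simp add: torus_mat_def)
  fix w :: "real Matrix.vec" and k assume w: "w \<in> carrier_vec (2*n)"
  show "coord n (torus_mat n T *\<^sub>v w) k = torus_op n T (coord n w) k"
  proof (cases "valid n k")
    case True
    define p where "p = pos n k"
    have p: "p < 2*n" using pos_less[OF True] by (simp add: p_def)
    define D where "D = (if p < n then T (Suc p) else inverse (T (2*n - p)))"
    have "(torus_mat n T *\<^sub>v w) $ p = (\<Sum>q<2*n. torus_mat n T $$ (p, q) * w $ q)"
      using p w by (simp add: torus_mat_def scalar_prod_def atLeast0LessThan)
    also have "\<dots> = (\<Sum>q<2*n. (if q = p then D * w $ q else 0))"
      using p by (intro sum.cong refl) (auto simp: torus_mat_def D_def)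
    also have "\<dots> = D * w $ p" using p by simp
    also have "D = torus_val T k"
    proof (cases "k > 0")
      case True
      then have "p = nat k - 1" "p < n" "Suc p = nat k" using \<open>valid n k\<close> by (auto simp: p_def pos_def valid_def)
      then show ?thesis using True by (simp add: D_def torus_val_def)
    next
      case False
      then have "p = nat (2 * int n + k)" "\<not> p < n" "2 * n - p = nat (- k)"
        using \<open>valid n k\<close> by (auto simp: p_def pos_def valid_def)
      then show ?thesis using False by (simp add: D_def torus_val_def)
    qed
    finally show ?thesis using True by (simp add: coord_def torus_op_def p_def)
  next
    case False then show ?thesis by (simp add: coord_def torus_op_def)
  qed
qed

lemma mat_exp_cartan: "mat_exp (- cartan_mat n x) = torus_mat n (\<lambda>k. exp (- x k))"
proof -
  define D where "D i = (if i < n then - x (Suc i) else x (2*n - i))" for i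
  define A where "A = mat (2*n) (2*n) (\<lambda>(i, j). if i = j then D i else (0::real))"
  have A: "- cartan_mat n x = A"
    by (rule eq_matI) (auto simp: cartan_mat_def A_def D_def)
  have pw: "A ^\<^sub>m k = mat (2*n) (2*n) (\<lambda>(i, j). if i = j then D i ^ k else 0)" for k
  proof (induction k)
    case 0 show ?case by (rule eq_matI) (auto simp: A_def)
  next
    case (Suc k)
    show ?case
    proof (rule eq_matI)
      fix i j assume "i < dim_row (mat (2*n) (2*n) (\<lambda>(i, j). if i = j then D i ^ Suc k else 0))"
        "j < dim_col (mat (2*n) (2*n) (\<lambda>(i, j). if i = j then D i ^ Suc k else 0))"
      then have ij: "i < 2*n" "j < 2*n" by auto
      have cA: "A \<in> carrier_mat (2*n) (2*n)" by (simp add: A_def)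
      then have cAk: "A ^\<^sub>m k \<in> carrier_mat (2*n) (2*n)" by simp
      have "(A ^\<^sub>m Suc k) $$ (i, j) = (\<Sum>q<2*n. (A ^\<^sub>m k) $$ (i, q) * A $$ (q, j))"
        using index_mult_mat_sum[OF cAk cA ij] by simp
      also have "\<dots> = (\<Sum>q<2*n. (if i = q then D i ^ k else 0) * (if q = j then D q else 0))"
        unfolding Suc by (intro sum.cong refl) (use ij in \<open>auto simp: A_def\<close>)
      also have "\<dots> = (\<Sum>q<2*n. if q = i then (if i = j then D i ^ k * D i else 0) else 0)"
        by (intro sum.cong refl) auto
      also have "\<dots> = (if i = j then D i ^ Suc k else 0)" using ij by simp
      finally show "(A ^\<^sub>m Suc k) $$ (i, j) = mat (2*n) (2*n) (\<lambda>(i, j). if i = j then D i ^ Suc k else 0) $$ (i, j)"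
        using ij by simp
    qed (auto simp: A_def Suc)
  qed
  show ?thesis
  proof (rule eq_matI)
    fix i j assume "i < dim_row (torus_mat n (\<lambda>k. exp (- x k)))" "j < dim_col (torus_mat n (\<lambda>k. exp (- x k)))"
    then have ij: "i < 2*n" "j < 2*n" by (auto simp: torus_mat_def)
    have "mat_exp (- cartan_mat n x) $$ (i, j) = (\<Sum>k. (if i = j then D i ^ k else 0) / fact k)"
      unfolding A using ij by (simp add: mat_exp_def pw) (simp add: A_def)
    also have "\<dots> = (if i = j then exp (D i) else 0)"
      by (auto simp: exp_def divide_inverse scaleR_conv_of_real mult.commute)
    also have "\<dots> = torus_mat n (\<lambda>k. exp (- x k)) $$ (i, j)"
      using ij by (auto simp: torus_mat_def D_def exp_minus)
    finally show "mat_exp (- cartan_mat n x) $$ (i, j) = torus_mat n (\<lambda>k. exp (- x k)) $$ (i, j)" .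
  qed (auto simp: A mat_exp_def torus_mat_def A_def)
qed

section \<open>The orthogonal group and triangular factorizations\<close>

definition op_form :: "nat \<Rightarrow> (int \<Rightarrow> real) \<Rightarrow> (int \<Rightarrow> real) \<Rightarrow> real" where
  "op_form n X Y = (\<Sum>k | valid n k. X k * Y (- k))"

definition form_pres :: "nat \<Rightarrow> ((int \<Rightarrow> real) \<Rightarrow> int \<Rightarrow> real) \<Rightarrow> bool" where
  "form_pres n f \<longleftrightarrow> (\<forall>X Y. op_form n (f X) (f Y) = op_form n X Y)"

lemma finite_valid [simp]: "finite {k. valid n k}"
  by (rule finite_subset[of _ "{- int n..int n}"]) (auto simp: valid_def)

lemma split_form_coord: "split_form n x y = op_form n (coord n x) (coord n y)"
  unfolding split_form_def op_form_def
  by (rule sum.reindex_bij_witness[where i = "pos n" and j = "ind n"])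
     (auto simp: pos_ind ind_pos pos_less coord_def pos_uminus)

lemma form_pres_comp: "form_pres n f \<Longrightarrow> form_pres n g \<Longrightarrow> form_pres n (f \<circ> g)"
  by (simp add: form_pres_def)

lemma form_pres_id: "form_pres n id"
  by (simp add: form_pres_def)

lemma form_pres_elem:
  assumes "root_pair n a b"
  shows "form_pres n (elem_op a b c)"
  unfolding form_pres_def
proof (intro allI)
  fix X Y :: "int \<Rightarrow> real"
  have v: "valid n a" "valid n b" "a \<noteq> b" "a \<noteq> - b" "a \<noteq> - a" "b \<noteq> - b" "- a \<noteq> b" "- b \<noteq> a"
    using assms by (auto simp: root_pair_def valid_def)
  let ?S = "{k. valid n k}"
  have "op_form n (elem_op a b c X) (elem_op a b c Y)
     = (\<Sum>k\<in>?S. X k * Y (- k) + ((if k = a then c * X b * Y (- a) else 0) - (if k = - b then c * X (- a) * Y b else 0))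
        + ((if k = - a then c * X (- a) * Y b else 0) - (if k = b then c * X b * Y (- a) else 0)))"
    unfolding op_form_def elem_op_def using v by (intro sum.cong refl) (auto simp: algebra_simps)
  also have "\<dots> = op_form n X Y"
    using v by (simp add: sum.distrib sum_subtractf op_form_def)
  finally show "op_form n (elem_op a b c X) (elem_op a b c Y) = op_form n X Y" .
qed

lemma form_pres_refl:
  assumes "root_pair n a b"
  shows "form_pres n (refl_op a b)"
proof -
  have "form_pres n (elem_op a b 1 \<circ> (elem_op b a (-1) \<circ> elem_op a b 1))"
    by (intro form_pres_comp form_pres_elem assms root_pair_swap[OF assms])
  then show ?thesis using assms by (subst (asm) refl_op_elem) (auto simp: root_pair_def valid_def)
qed

lemma form_pres_torus:
  assumes "positive_torus n T"
  shows "form_pres n (torus_op n T)"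
proof -
  have "torus_val T k * torus_val T (- k) = 1" if "valid n k" for k
  proof -
    have "nat \<bar>k\<bar> \<in> {1..n}" using that by (auto simp: valid_def)
    then have "T (nat \<bar>k\<bar>) \<noteq> 0" using assms by (force simp: positive_torus_def)
    then show ?thesis using that by (auto simp: torus_val_def valid_def split: if_splits)
  qed
  then have eq: "torus_val T k * X k * (torus_val T (- k) * Y (- k)) = X k * Y (- k)" if "valid n k" for k X and Y :: "int \<Rightarrow> real"
  proof -
    have "torus_val T k * X k * (torus_val T (- k) * Y (- k)) = (torus_val T k * torus_val T (- k)) * (X k * Y (- k))"
      by simp
    then show ?thesis using \<open>\<And>k. valid n k \<Longrightarrow> torus_val T k * torus_val T (- k) = 1\<close>[OF that] by simp
  qed
  show ?thesis
    unfolding form_pres_def op_form_def torus_op_def by (intro allI sum.cong refl) (simp only: mem_Collect_eq valid_uminus if_True eq)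
qed

lemma form_pres_word:
  assumes "\<And>c a. (c, a) \<in> set ws \<Longrightarrow> valid_node n a"
  shows "form_pres n (word_op n ws) \<and> form_pres n (word_refl n ws)"
  using assms
proof (induction ws)
  case (Cons ca ws)
  obtain c a where ca: "ca = (c, a)" by force
  have r: "root_pair n (fst (node_pair n a)) (snd (node_pair n a))"
    using Cons.prems[of c a] by (intro root_pair_node[of n a]) (auto simp: ca)
  have IH: "form_pres n (word_op n ws) \<and> form_pres n (word_refl n ws)"
    using Cons.prems by (intro Cons.IH) auto
  then show ?case unfolding ca word_op_simps word_refl_simps
    by (intro conjI form_pres_comp form_pres_elem form_pres_refl r) simp_all
qed (auto simp: form_pres_id)

lemma acts_split_form:
  assumes "acts n A f" "form_pres n f" "x \<in> carrier_vec (2*n)" "y \<in> carrier_vec (2*n)"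
  shows "split_form n (A *\<^sub>v x) (A *\<^sub>v y) = split_form n x y"
  using assms by (simp add: split_form_coord actsD form_pres_def)

lemma split_form_unit:
  assumes "a < 2*n" "b < 2*n"
  shows "split_form n (unit_vec (2*n) a) (unit_vec (2*n) b) = (if a + b = 2*n - 1 then 1 else 0)"
proof -
  have "split_form n (unit_vec (2*n) a) (unit_vec (2*n) b) = (\<Sum>i<2*n. if i = a then (if a + b = 2*n - 1 then 1 else 0) else 0)"
    unfolding split_form_def using assms by (intro sum.cong refl) auto
  then show ?thesis using assms by simp
qed

text \<open>Pairing columns a < n and q >= n of \<open>Y\<close> under the form expresses the entry
  of column q in row 2n - 1 - a through known ones: indices i < a vanish by the upper half, indices
  a < i < n by induction (from a = n - 1 downwards), and i >= n again by the upper half.\<close>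

lemma lower_unipotent_if_upper_half:
  assumes Y: "Y \<in> carrier_mat (2*n) (2*n)"
    and form: "\<And>x y. x \<in> carrier_vec (2*n) \<Longrightarrow> y \<in> carrier_vec (2*n) \<Longrightarrow>
        split_form n (Y *\<^sub>v x) (Y *\<^sub>v y) = split_form n x y"
    and upper: "\<And>p q. p < n \<Longrightarrow> p \<le> q \<Longrightarrow> q < 2*n \<Longrightarrow> Y $$ (p, q) = (if p = q then 1 else 0)"
  shows "Y \<in> lower_unipotent n"
proof -
  have lower: "Y $$ (2*n - 1 - a, q) = (if 2*n - 1 - a = q then 1 else 0)"
    if q: "n \<le> q" "q < 2*n" and a: "a < n" "2*n - 1 - q \<le> a" for a q
    using a
  proof (induction "n - a" arbitrary: a rule: less_induct)
    case (less a)
    have "(\<Sum>i<2*n. Y $$ (i, a) * Y $$ (2*n - 1 - i, q)) = split_form n (Y *\<^sub>v unit_vec (2*n) a) (Y *\<^sub>v unit_vec (2*n) q)"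
      unfolding split_form_def using Y less.prems q by (intro sum.cong refl) auto
    also have "\<dots> = (if a + q = 2*n - 1 then 1 else 0)"
      using form split_form_unit less.prems q by simp
    also have "(\<Sum>i<2*n. Y $$ (i, a) * Y $$ (2*n - 1 - i, q)) = (\<Sum>i\<in>{a}. Y $$ (i, a) * Y $$ (2*n - 1 - i, q))"
    proof (rule sum.mono_neutral_right)
      show "\<forall>i\<in>{..<2*n} - {a}. Y $$ (i, a) * Y $$ (2*n - 1 - i, q) = 0"
      proof
        fix i assume i: "i \<in> {..<2*n} - {a}"
        consider "i < a" | "a < i" "i < n" | "n \<le> i" using i by fastforce
        then show "Y $$ (i, a) * Y $$ (2*n - 1 - i, q) = 0"
        proof cases
          case 1 then show ?thesis using upper[of i a] less.prems by simp
        next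
          case 2
          then have "Y $$ (2*n - 1 - i, q) = (if 2*n - 1 - i = q then 1 else 0)"
            using less.prems by (intro less.hyps) auto
          then show ?thesis using 2 less.prems q by auto
        next
          case 3
          then have "Y $$ (2*n - 1 - i, q) = 0" using i q upper[of "2*n - 1 - i" q] by auto
          then show ?thesis by simp
        qed
      qed
    qed (use less.prems in auto)
    also have "\<dots> = Y $$ (2*n - 1 - a, q)"
      using upper[of a a] less.prems by simp
    finally show ?case using less.prems q by auto
  qed
  have all: "Y $$ (p, q) = (if p = q then 1 else 0)" if "p \<le> q" "q < 2*n" for p q
  proof (cases "p < n")
    case True then show ?thesis using upper that by blast
  next
    case False
    then show ?thesis using lower[of q "2*n - 1 - p"] that by auto
  qed
  have "Determinant.det Y = prod_list (diag_mat Y)"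
    using all by (intro det_lower_triangular[OF _ Y]) auto
  also have "\<dots> = 1"
    using Y all by (simp add: prod_list_diag_prod)
  finally have "Determinant.det Y = 1" .
  then show ?thesis
    using Y form all by (simp add: lower_unipotent_def SO_split_def)
qed

lemma one_lower_unipotent: "1\<^sub>m (2*n) \<in> lower_unipotent n"
  by (rule lower_unipotent_if_upper_half) auto

text \<open>In row p the columns q < p determine \<open>Y\<close> to the left of the diagonal, by
  substitution through the nonzero diagonal of \<open>U\<close>. All columns together then determine
  row p of \<open>U\<close>, and one proceeds to the next row.\<close>

lemma lower_upper_unique:
  fixes Y U :: "real mat"
  assumes c: "Y \<in> carrier_mat N N" "U \<in> carrier_mat N N" "Y' \<in> carrier_mat N N" "U' \<in> carrier_mat N N"
    and eq: "Y * U = Y' * U'"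
    and Y: "\<And>i. i < N \<Longrightarrow> Y $$ (i, i) = 1" "\<And>i j. i < j \<Longrightarrow> j < N \<Longrightarrow> Y $$ (i, j) = 0"
    and Y': "\<And>i. i < N \<Longrightarrow> Y' $$ (i, i) = 1" "\<And>i j. i < j \<Longrightarrow> j < N \<Longrightarrow> Y' $$ (i, j) = 0"
    and U: "\<And>i. i < N \<Longrightarrow> U $$ (i, i) \<noteq> 0" "\<And>i j. j < i \<Longrightarrow> i < N \<Longrightarrow> U $$ (i, j) = 0"
    and U': "\<And>i j. j < i \<Longrightarrow> i < N \<Longrightarrow> U' $$ (i, j) = 0"
  shows "U = U'"
proof -
  have row: "(\<Sum>r<p. Y $$ (p, r) * U $$ (r, q)) + U $$ (p, q) = (\<Sum>r<p. Y' $$ (p, r) * U' $$ (r, q)) + U' $$ (p, q)"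
    if "p < N" "q < N" for p q
  proof -
    have *: "(A * B) $$ (p, q) = (\<Sum>r<p. A $$ (p, r) * B $$ (r, q)) + B $$ (p, q)"
      if "A \<in> carrier_mat N N" "B \<in> carrier_mat N N" "A $$ (p, p) = 1" "\<And>j. p < j \<Longrightarrow> j < N \<Longrightarrow> A $$ (p, j) = 0" for A B :: "real mat"
    proof -
      have "(A * B) $$ (p, q) = (\<Sum>r\<in>{..p}. A $$ (p, r) * B $$ (r, q))"
        unfolding index_mult_mat_sum[OF that(1,2) \<open>p < N\<close> \<open>q < N\<close>]
        using that(4) \<open>p < N\<close> by (intro sum.mono_neutral_right) auto
      then show ?thesis using that(3) by (simp add: lessThan_Suc_atMost[symmetric])
    qed
    show ?thesis using *[OF c(1,2)] *[OF c(3,4)] Y Y' eq that by simp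
  qed
  have main: "\<forall>q<N. U $$ (p, q) = U' $$ (p, q)" if "p < N" for p
    using that
  proof (induction p rule: less_induct)
    case (less p)
    have IH: "U $$ (r, q) = U' $$ (r, q)" if "r < p" "q < N" for r q
      using less that by auto
    have YY: "Y $$ (p, q) = Y' $$ (p, q)" if "q < p" for q
      using that
    proof (induction q rule: less_induct)
      case (less q)
      have tri: "(\<Sum>r<p. A $$ (p, r) * U $$ (r, q)) = (\<Sum>r<q. A $$ (p, r) * U $$ (r, q)) + A $$ (p, q) * U $$ (q, q)" for A :: "real mat"
      proof -
        have "(\<Sum>r<p. A $$ (p, r) * U $$ (r, q)) = (\<Sum>r\<in>{..q}. A $$ (p, r) * U $$ (r, q))"
          using U(2) less.prems \<open>p < N\<close> by (intro sum.mono_neutral_right) auto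
        then show ?thesis by (simp add: lessThan_Suc_atMost[symmetric])
      qed
      have q: "q < N" using less.prems \<open>p < N\<close> by simp
      have "(\<Sum>r<p. Y' $$ (p, r) * U' $$ (r, q)) = (\<Sum>r<p. Y' $$ (p, r) * U $$ (r, q))"
        using IH q by simp
      moreover have "U $$ (p, q) = 0" "U' $$ (p, q) = 0" using U(2) U' less.prems \<open>p < N\<close> by auto
      moreover have "(\<Sum>r<q. Y $$ (p, r) * U $$ (r, q)) = (\<Sum>r<q. Y' $$ (p, r) * U $$ (r, q))"
        using less by (intro sum.cong) auto
      ultimately have "Y $$ (p, q) * U $$ (q, q) = Y' $$ (p, q) * U $$ (q, q)"
        using row[OF \<open>p < N\<close> q] tri[of Y] tri[of Y'] by linarith
      then show ?case using U(1)[OF q] by simp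
    qed
    show ?case
    proof (intro allI impI)
      fix q assume q: "q < N"
      have "(\<Sum>r<p. Y $$ (p, r) * U $$ (r, q)) = (\<Sum>r<p. Y' $$ (p, r) * U' $$ (r, q))"
        using IH YY q by simp
      then show "U $$ (p, q) = U' $$ (p, q)" using row[OF less.prems q] by simp
    qed
  qed
  then show ?thesis using c by (intro eq_matI) auto
qed

text \<open>On the unipotent radical of the Borel subgroup, the sum of the coefficients of the simple root
  vectors is a homomorphism. It recovers the exponent of the right Whittaker vector without
  solving for the coordinates.\<close>

definition upper_uni :: "nat \<Rightarrow> real mat \<Rightarrow> bool" where
  "upper_uni n M \<longleftrightarrow> M \<in> carrier_mat (2*n) (2*n) \<and> (\<forall>i<2*n. M $$ (i, i) = 1)
     \<and> (\<forall>i<2*n. \<forall>j<i. M $$ (i, j) = 0) \<and> M $$ (n - 1, n) = 0"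

text \<open>With entries counted from 0, the superdiagonal part belongs to the nodes
  \<open>Lin\<close> and \<open>Spin 1\<close>; the node \<open>Spin (-1)\<close> sits one column
  further, at (n - 2, n).\<close>

definition simple_sum :: "nat \<Rightarrow> real mat \<Rightarrow> real" where
  "simple_sum n M = (\<Sum>k<n-1. M $$ (k, Suc k)) + M $$ (n - 2, n)"

text \<open>Superdiagonal entries of unipotent matrices add. The entry (n - 2, n) is on the second
  diagonal; its cross term contains the entry (n - 1, n) of \<open>B\<close>, which is 0 by
  \<open>upper_uni\<close>. That entry is itself superdiagonal, so it stays 0 in products.\<close>

lemma upper_uni_mult:
  assumes n: "n \<ge> 2" and A: "upper_uni n A" and B: "upper_uni n B"
  shows "upper_uni n (A * B) \<and> simple_sum n (A * B) = simple_sum n A + simple_sum n B"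
proof -
  have cA: "A \<in> carrier_mat (2*n) (2*n)" and cB: "B \<in> carrier_mat (2*n) (2*n)"
    using A B by (auto simp: upper_uni_def)
  have *: "(A * B) $$ (i, j) = (\<Sum>q\<in>{i..j}. A $$ (i, q) * B $$ (q, j))" if "i < 2*n" "j < 2*n" for i j
    unfolding index_mult_mat_sum[OF cA cB that]
  proof (rule sum.mono_neutral_right)
    show "\<forall>q\<in>{..<2*n} - {i..j}. A $$ (i, q) * B $$ (q, j) = 0"
      using A B that by (auto simp: upper_uni_def not_le)
  qed (use that in auto)
  have d: "A $$ (i, i) = 1" "B $$ (i, i) = 1" if "i < 2*n" for i using A B that by (auto simp: upper_uni_def)
  have z: "A $$ (n - 1, n) = 0" "B $$ (n - 1, n) = 0" using A B by (auto simp: upper_uni_def)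
  have sd: "(A * B) $$ (i, Suc i) = A $$ (i, Suc i) + B $$ (i, Suc i)" if "Suc i < 2*n" for i
    using that d by (simp add: * atLeastAtMostSuc_conv)
  obtain m where m: "n = Suc (Suc m)" using n by (metis add_2_eq_Suc le_Suc_ex)
  have e1: "(A * B) $$ (n - 2, n) = A $$ (n - 2, n) + B $$ (n - 2, n)"
    using d[of m] d[of "Suc (Suc m)"] z unfolding m by (simp add: *[unfolded m] atLeastAtMostSuc_conv)
  have e2: "(A * B) $$ (n - 1, n) = 0" using sd[of "n - 1"] n z by simp
  show ?thesis
  proof
    show "upper_uni n (A * B)"
      unfolding upper_uni_def
    proof (intro conjI allI impI)
      show "A * B \<in> carrier_mat (2*n) (2*n)" using cA cB by (rule mult_carrier_mat)
      show "(A * B) $$ (i, i) = 1" if "i < 2*n" for i using *[OF that that] d[OF that] by simp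
      show "(A * B) $$ (i, j) = 0" if "i < 2*n" "j < i" for i j using *[of i j] that by simp
    qed (rule e2)
    have "(\<Sum>k<n-1. (A * B) $$ (k, Suc k)) = (\<Sum>k<n-1. A $$ (k, Suc k) + B $$ (k, Suc k))"
      using n by (intro sum.cong refl sd) auto
    then show "simple_sum n (A * B) = simple_sum n A + simple_sum n B"
      unfolding simple_sum_def e1 by (simp add: sum.distrib)
  qed
qed

lemma upper_uni_one: "n \<ge> 2 \<Longrightarrow> upper_uni n (1\<^sub>m (2*n)) \<and> simple_sum n (1\<^sub>m (2*n)) = 0"
  by (auto simp: upper_uni_def simple_sum_def)

lemma upper_uni_exp:
  assumes n: "n \<ge> 2" and a: "valid_node n a"
  shows "upper_uni n (mat_exp (c \<cdot>\<^sub>m chev_e n a)) \<and> simple_sum n (mat_exp (c \<cdot>\<^sub>m chev_e n a)) = c"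
proof -
  obtain u v where uv: "node_pair n a = (u, v)" by force
  define M where "M = 1\<^sub>m (2*n) + c \<cdot>\<^sub>m root_mat n u v"
  have M: "mat_exp (c \<cdot>\<^sub>m chev_e n a) = M"
    unfolding chev_e_root_mat[OF a uv] M_def by (rule mat_exp_root_mat[OF root_pair_node[OF a uv]])
  have ent: "M $$ (i, j) = (if i = j then 1 else 0) + c * ((if i = pos n u \<and> j = pos n v then 1 else 0)
     - (if i = pos n (- v) \<and> j = pos n (- u) then 1 else 0))" if "i < 2*n" "j < 2*n" for i j
    using that by (simp add: M_def root_mat_def)
  \<comment> \<open>Only the matrix unit at (u, v) can meet the entries counted by
    \<open>simple_sum\<close>: the dual one lies in a row from n - 1 on.\<close>
  have *: "pos n u < pos n v \<and> pos n (- v) < pos n (- u) \<and> (pos n u \<noteq> n - 1 \<or> pos n v \<noteq> n)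
     \<and> (pos n (-v) \<noteq> n - 1 \<or> pos n (-u) \<noteq> n) \<and> pos n (- v) \<ge> n - 1
     \<and> ((pos n u < n - 1 \<and> pos n v = Suc (pos n u)) \<or> (pos n u = n - 2 \<and> pos n v = n))"
  proof (cases a)
    case (Lin i)
    then have i: "1 \<le> i" "i + 1 \<le> n" and u: "u = int i" "v = int (i + 1)" using a uv by auto
    have "pos n u = i - 1" "pos n v = i" "pos n (- u) = 2*n - i" "pos n (- v) = 2*n - i - 1"
      unfolding u using i pos_int(1)[of i n] pos_int(1)[of "i + 1" n] pos_int(2)[of i n] pos_int(2)[of "i + 1" n]
      by simp_all
    then show ?thesis using i by auto
  next
    case (Spin s)
    have k: "1 \<le> n - 1" "n - 1 \<le> 2 * n" "1 \<le> n" "n \<le> 2 * n" using n by auto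
    show ?thesis
    proof (cases "s = 1")
      case True
      then have u: "u = int (n - 1)" "v = int n" using Spin a uv n by auto
      have "pos n u = n - 2" "pos n v = n - 1" "pos n (- u) = n + 1" "pos n (- v) = n"
        unfolding u using n pos_int(1)[OF k(1), of n] pos_int(1)[OF k(3), of n] pos_int(2)[OF k(1,2)] pos_int(2)[OF k(3,4)]
        by linarith+
      then show ?thesis using n by auto
    next
      case False
      then have u: "u = int (n - 1)" "v = - int n" using Spin a uv n by auto
      have "pos n u = n - 2" "pos n v = n" "pos n (- u) = n + 1" "pos n (- v) = n - 1"
        unfolding u minus_minus using n pos_int(1)[OF k(1), of n] pos_int(1)[OF k(3), of n] pos_int(2)[OF k(1,2)] pos_int(2)[OF k(3,4)]
        by linarith+
      then show ?thesis using n by auto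
    qed
  qed
  have "upper_uni n M"
    unfolding upper_uni_def
  proof (intro conjI allI impI)
    have o: "pos n u < pos n v" "pos n (- v) < pos n (- u)" using * by blast+
    show "M \<in> carrier_mat (2*n) (2*n)" by (simp add: M_def)
    show "M $$ (i, i) = 1" if "i < 2*n" for i
    proof -
      have "\<not> (i = pos n u \<and> i = pos n v)" "\<not> (i = pos n (- v) \<and> i = pos n (- u))" using o by auto
      then show ?thesis unfolding ent[OF that that] by (simp only: if_False if_True simp_thms) simp
    qed
    show "M $$ (i, j) = 0" if "i < 2*n" "j < i" for i j
    proof -
      have "\<not> (i = pos n u \<and> j = pos n v)" "\<not> (i = pos n (- v) \<and> j = pos n (- u))" "i \<noteq> j" "j < 2*n"
        using o that by auto
      then show ?thesis using ent[OF that(1), of j] by (simp only: if_False if_True simp_thms) simp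
    qed
    have "\<not> (n - 1 = pos n u \<and> n = pos n v)" "\<not> (n - 1 = pos n (- v) \<and> n = pos n (- u))" "n - 1 \<noteq> n" "n - 1 < 2*n" "n < 2*n"
      using * n by auto
    then show "M $$ (n - 1, n) = 0" using ent[of "n - 1" n] by (simp only: if_False if_True simp_thms) simp
  qed
  moreover have ge: "pos n (- v) \<ge> n - 1"
    and dj: "(pos n u < n - 1 \<and> pos n v = Suc (pos n u)) \<or> (pos n u = n - 2 \<and> pos n v = n)"
    using * by blast+
  from dj have "simple_sum n M = c"
  proof (elim conjE disjE)
    assume "pos n u < n - 1" "pos n v = Suc (pos n u)"
    note h = this ge
    have "M $$ (k, Suc k) = (if k = pos n u then c else 0)" if "k < n - 1" for k
      using that h by (auto simp: ent)
    moreover have "M $$ (n - 2, n) = 0" using h n by (auto simp: ent)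
    ultimately show ?thesis using h by (simp add: simple_sum_def)
  next
    assume "pos n u = n - 2" "pos n v = n"
    note h = this ge
    have "M $$ (k, Suc k) = 0" if "k < n - 1" for k
      using that h by (auto simp: ent)
    moreover have "M $$ (n - 2, n) = c" using h n by (auto simp: ent)
    ultimately show ?thesis by (simp add: simple_sum_def)
  qed
  ultimately show ?thesis using M by simp
qed

lemma upper_uni_X_mat:
  assumes n: "n \<ge> 2"
  shows "upper_uni n (X_mat n t s)" "simple_sum n (X_mat n t s) = (\<Sum>(c, a)\<leftarrow>full_word n t s. c)"
proof -
  have "upper_uni n (mat_prod_list n (map (\<lambda>(c, a). mat_exp (c \<cdot>\<^sub>m chev_e n a)) ws))
     \<and> simple_sum n (mat_prod_list n (map (\<lambda>(c, a). mat_exp (c \<cdot>\<^sub>m chev_e n a)) ws)) = (\<Sum>(c, a)\<leftarrow>ws. c)"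
    if "\<And>c a. (c, a) \<in> set ws \<Longrightarrow> valid_node n a" for ws
    using that
  proof (induction ws)
    case Nil
    then show ?case using upper_uni_one[OF n] by (simp add: mat_prod_list_def)
  next
    case (Cons ca ws)
    obtain c a where ca: "ca = (c, a)" by force
    have IH: "upper_uni n (mat_prod_list n (map (\<lambda>(c, a). mat_exp (c \<cdot>\<^sub>m chev_e n a)) ws))
     \<and> simple_sum n (mat_prod_list n (map (\<lambda>(c, a). mat_exp (c \<cdot>\<^sub>m chev_e n a)) ws)) = (\<Sum>(c, a)\<leftarrow>ws. c)"
      using Cons.prems by (intro Cons.IH) auto
    have e: "upper_uni n (mat_exp (c \<cdot>\<^sub>m chev_e n a)) \<and> simple_sum n (mat_exp (c \<cdot>\<^sub>m chev_e n a)) = c"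
      using Cons.prems by (intro upper_uni_exp[OF n]) (auto simp: ca)
    have P: "mat_prod_list n (map (\<lambda>(c, a). mat_exp (c \<cdot>\<^sub>m chev_e n a)) (ca # ws))
       = mat_exp (c \<cdot>\<^sub>m chev_e n a) * mat_prod_list n (map (\<lambda>(c, a). mat_exp (c \<cdot>\<^sub>m chev_e n a)) ws)"
      by (simp add: mat_prod_list_def ca)
    show ?case unfolding P using upper_uni_mult[OF n, of "mat_exp (c \<cdot>\<^sub>m chev_e n a)"] IH e by (simp add: ca)
  qed
  then show "upper_uni n (X_mat n t s)" "simple_sum n (X_mat n t s) = (\<Sum>(c, a)\<leftarrow>full_word n t s. c)"
    unfolding X_mat_def using full_word_valid[OF n] by blast+
qed

lemma idx_Sigma: "idx n = Sigma {1..<n} (\<lambda>i. {i+1..n})"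
  by (auto simp: idx_def)

lemma finite_idx [simp]: "finite (idx n)"
  by (simp add: idx_Sigma)

lemma sum_idx: "(\<Sum>p\<in>idx n. f p) = (\<Sum>i=1..<n. \<Sum>j=i+1..n. f (i, j))"
  by (simp add: idx_Sigma sum.Sigma)

lemma sum_list_full_word: "(\<Sum>(c, a)\<leftarrow>full_word n t s. c) = (\<Sum>p\<in>idx n. t p + s p)"
proof -
  have row: "(\<Sum>(c, a)\<leftarrow>row_word n t s i. c) = (\<Sum>j=i+1..n. t (i, j) + s (i, j))" if "i < n" for i
  proof -
    have *: "sum_list (map f [i+1..<n]) = sum f {i+1..<n}" for f :: "nat \<Rightarrow> real"
      by (subst sum_set_upt_conv_sum_list_nat[symmetric]) simp
    have "{i+1..n} = insert n {i+1..<n}" using that by auto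
    then show ?thesis using *[of "\<lambda>j. s (i, j)"] *[of "\<lambda>j. t (i, j)"]
      by (simp add: row_word_def comp_def rev_map[symmetric] sum.distrib del: upt_Suc)
  qed
  have "(\<Sum>(c, a)\<leftarrow>full_word n t s. c) = (\<Sum>i\<leftarrow>rev [1..<n]. \<Sum>(c, a)\<leftarrow>row_word n t s i. c)"
  proof -
    have "(\<Sum>(c, a)\<leftarrow>concat (map f xs). c) = (\<Sum>i\<leftarrow>xs. \<Sum>(c, a)\<leftarrow>f i. c)" for f :: "nat \<Rightarrow> (real \<times> node) list" and xs
      by (induction xs) auto
    then show ?thesis by (simp add: full_word_def)
  qed
  also have "\<dots> = (\<Sum>i\<leftarrow>[1..<n]. \<Sum>(c, a)\<leftarrow>row_word n t s i. c)"
    by (simp only: rev_map[symmetric] sum_list_rev)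
  also have "\<dots> = (\<Sum>i=1..<n. \<Sum>(c, a)\<leftarrow>row_word n t s i. c)"
    by (subst sum_set_upt_conv_sum_list_nat[symmetric]) simp
  also have "\<dots> = (\<Sum>i=1..<n. \<Sum>j=i+1..n. t (i, j) + s (i, j))"
    by (intro sum.cong refl row) auto
  finally show ?thesis by (simp add: sum_idx)
qed

section \<open>Whittaker vectors in coordinates\<close>

lemma torus_val_uminus: "k \<noteq> 0 \<Longrightarrow> torus_val T (- k) = inverse (torus_val T k)"
  by (auto simp: torus_val_def)

lemma torus_val_nonzero:
  assumes "valid n k" "\<And>l. l \<in> {1..n} \<Longrightarrow> T l \<noteq> 0"
  shows "torus_val T k \<noteq> 0"
proof -
  have "nat \<bar>k\<bar> \<in> {1..n}" using assms(1) by (auto simp: valid_def)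
  then have "T (nat \<bar>k\<bar>) \<noteq> 0" by (rule assms(2))
  then show ?thesis by (auto simp: torus_val_def)
qed

text \<open>The inverse of the simple root of the node at T: the factor which the coefficient of an
  exponential acquires when T passes it from right to left.\<close>

definition node_ratio :: "nat \<Rightarrow> (nat \<Rightarrow> real) \<Rightarrow> node \<Rightarrow> real" where
  "node_ratio n T a = torus_val T (snd (node_pair n a)) / torus_val T (fst (node_pair n a))"

lemma elem_torus_commute:
  assumes r: "root_pair n a b" and T: "\<And>l. l \<in> {1..n} \<Longrightarrow> T l \<noteq> 0"
  shows "elem_op a b c (torus_op n T x) = torus_op n T (elem_op a b (c * (torus_val T b / torus_val T a)) x)"
proof
  fix k
  have v: "valid n a" "valid n b" "a \<noteq> b" "a \<noteq> - b" "a \<noteq> 0" "b \<noteq> 0"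
    using r by (auto simp: root_pair_def valid_def)
  have nz: "torus_val T a \<noteq> 0" "torus_val T b \<noteq> 0"
    using torus_val_nonzero[OF v(1) T] torus_val_nonzero[OF v(2) T] by auto
  show "elem_op a b c (torus_op n T x) k = torus_op n T (elem_op a b (c * (torus_val T b / torus_val T a)) x) k"
    using v nz by (auto simp: elem_op_def torus_op_def torus_val_uminus field_simps)
qed

lemma word_torus_commute:
  assumes T: "\<And>l. l \<in> {1..n} \<Longrightarrow> T l \<noteq> 0" and "\<And>c a. (c, a) \<in> set ws \<Longrightarrow> valid_node n a"
  shows "word_op n ws (torus_op n T x) = torus_op n T (word_op n (map (\<lambda>(c, a). (c * node_ratio n T a, a)) ws) x)"
  using assms(2)
proof (induction ws)
  case (Cons ca ws)
  obtain c a where ca: "ca = (c, a)" by force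
  have r: "root_pair n (fst (node_pair n a)) (snd (node_pair n a))"
    using Cons.prems[of c a] by (intro root_pair_node[of n a]) (auto simp: ca)
  let ?z = "word_op n (map (\<lambda>(c, a). (c * node_ratio n T a, a)) ws) x"
  have "word_op n ws (torus_op n T x) = torus_op n T ?z"
    using Cons.prems by (intro Cons.IH) auto
  then have "word_op n (ca # ws) (torus_op n T x) = elem_op (fst (node_pair n a)) (snd (node_pair n a)) c (torus_op n T ?z)"
    by (simp add: ca)
  also have "\<dots> = torus_op n T (elem_op (fst (node_pair n a)) (snd (node_pair n a)) (c * node_ratio n T a) ?z)"
    unfolding node_ratio_def by (rule elem_torus_commute[OF r]) (rule T)
  finally show ?case by (simp add: ca)
qed simp

definition t_node :: "nat \<Rightarrow> nat \<times> nat \<Rightarrow> node" where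
  "t_node n = (\<lambda>(i, j). if j < n then Lin (j - 1) else Spin (sgn_pow (n - i + 1)))"

definition s_node :: "nat \<Rightarrow> nat \<times> nat \<Rightarrow> node" where
  "s_node n = (\<lambda>(i, j). if j < n then Lin (j - 1) else Spin (sgn_pow (n - i)))"

lemma full_word_scale:
  "full_word n (\<lambda>p. t p * r (t_node n p)) (\<lambda>p. s p * r (s_node n p)) = map (\<lambda>(c, a). (c * r a, a)) (full_word n t s)"
proof -
  have "row_word n (\<lambda>p. t p * r (t_node n p)) (\<lambda>p. s p * r (s_node n p)) i = map (\<lambda>(c, a). (c * r a, a)) (row_word n t s i)" for i
    by (simp add: row_word_def t_node_def s_node_def rev_map[symmetric] del: upt_Suc)
  then show ?thesis by (auto simp: full_word_def map_concat comp_def intro!: arg_cong[where f = concat] map_cong)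
qed

lemma full_word_uminus:
  "full_word n (\<lambda>p. - t p) (\<lambda>p. - s p) = map (\<lambda>(c, a). (- c, a)) (full_word n t s)"
  using full_word_scale[of n t "\<lambda>_. -1" s] by simp

lemma X_mat_torus:
  assumes n: "n \<ge> 2" and T: "\<And>l. l \<in> {1..n} \<Longrightarrow> T l \<noteq> 0"
  shows "X_mat n t s * torus_mat n T
    = torus_mat n T * X_mat n (\<lambda>p. t p * node_ratio n T (t_node n p)) (\<lambda>p. s p * node_ratio n T (s_node n p))"
proof (rule acts_unique[OF acts_mult[OF acts_X_mat[OF n] acts_torus]])
  have "word_op n (full_word n t s) \<circ> torus_op n T
     = torus_op n T \<circ> word_op n (full_word n (\<lambda>p. t p * node_ratio n T (t_node n p)) (\<lambda>p. s p * node_ratio n T (s_node n p)))"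
    unfolding full_word_scale using word_torus_commute[OF T full_word_valid[OF n]] by (auto simp: fun_eq_iff)
  then show "acts n (torus_mat n T * X_mat n (\<lambda>p. t p * node_ratio n T (t_node n p)) (\<lambda>p. s p * node_ratio n T (s_node n p)))
     (word_op n (full_word n t s) \<circ> torus_op n T)"
    using acts_mult[OF acts_torus[of n T] acts_X_mat[OF n]] by simp
qed

lemma index_torus_mult:
  assumes "A \<in> carrier_mat (2*n) (2*n)" "i < 2*n" "j < 2*n"
  shows "(torus_mat n T * A) $$ (i, j) = torus_mat n T $$ (i, i) * A $$ (i, j)"
proof -
  have c: "torus_mat n T \<in> carrier_mat (2*n) (2*n)" by (simp add: torus_mat_def)
  have "(torus_mat n T * A) $$ (i, j) = (\<Sum>q<2*n. if q = i then torus_mat n T $$ (i, i) * A $$ (i, j) else 0)"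
    unfolding index_mult_mat_sum[OF c assms] using assms by (intro sum.cong refl) (auto simp: torus_mat_def)
  then show ?thesis using assms by simp
qed

lemma torus_mat_diag_nonzero:
  assumes "positive_torus n T" "i < 2*n"
  shows "torus_mat n T $$ (i, i) \<noteq> 0"
proof (cases "i < n")
  case True
  then have "Suc i \<in> {1..n}" by simp
  then have "T (Suc i) > 0" using assms(1) unfolding positive_torus_def by blast
  then show ?thesis using assms True by (simp add: torus_mat_def)
next
  case False
  then have "2*n - i \<in> {1..n}" using assms by auto
  then have "T (2*n - i) > 0" using assms(1) unfolding positive_torus_def by blast
  then show ?thesis using assms False by (simp add: torus_mat_def)
qed

text \<open>Triangular uniqueness gives the torus from the diagonal and then equality of the two
  matrices X; \<open>simple_sum\<close> converts this into equality of the total parameters. The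
  Whittaker vectors depend on these data only, so the single parameters are not recovered.\<close>

lemma triangular_coordinates_unique:
  assumes n: "n \<ge> 2"
    and Y: "Y \<in> lower_unipotent n" "Y' \<in> lower_unipotent n"
    and T: "positive_torus n T" "positive_torus n T'"
    and eq: "Y * torus_mat n T * X_mat n t s = Y' * torus_mat n T' * X_mat n t' s'"
  shows "(\<forall>k\<in>{1..n}. T k = T' k) \<and> (\<Sum>p\<in>idx n. t p + s p) = (\<Sum>p\<in>idx n. t' p + s' p)"
proof -
  let ?X = "X_mat n t s" and ?X' = "X_mat n t' s'"
  have X: "upper_uni n ?X" "upper_uni n ?X'" using upper_uni_X_mat[OF n] by auto
  have cX: "?X \<in> carrier_mat (2*n) (2*n)" "?X' \<in> carrier_mat (2*n) (2*n)" using X by (auto simp: upper_uni_def)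
  have cT: "torus_mat n T \<in> carrier_mat (2*n) (2*n)" for T by (simp add: torus_mat_def)
  have cY: "Y \<in> carrier_mat (2*n) (2*n)" "Y' \<in> carrier_mat (2*n) (2*n)"
    using Y by (auto simp: lower_unipotent_def SO_split_def)
  have U: "torus_mat n T * ?X = torus_mat n T' * ?X'"
  proof (rule lower_upper_unique[OF cY(1) mult_carrier_mat[OF cT cX(1)] cY(2) mult_carrier_mat[OF cT cX(2)]])
    show "Y * (torus_mat n T * ?X) = Y' * (torus_mat n T' * ?X')"
      using eq by (simp add: assoc_mult_mat[OF cY(1) cT cX(1)] assoc_mult_mat[OF cY(2) cT cX(2)])
  qed (use Y X cX T torus_mat_diag_nonzero in \<open>auto simp: lower_unipotent_def upper_uni_def index_torus_mult simp del: index_mult_mat(1)\<close>)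
  have ent: "torus_mat n T $$ (i, i) * ?X $$ (i, j) = torus_mat n T' $$ (i, i) * ?X' $$ (i, j)" if "i < 2*n" "j < 2*n" for i j
    using index_torus_mult[OF cX(1) that, of T] index_torus_mult[OF cX(2) that, of T'] U by simp
  have diag: "torus_mat n T $$ (i, i) = torus_mat n T' $$ (i, i)" if "i < 2*n" for i
    using ent[OF that that] X that by (simp add: upper_uni_def)
  have XX: "?X = ?X'"
  proof (rule eq_matI)
    fix i j assume "i < dim_row ?X'" "j < dim_col ?X'"
    then have ij: "i < 2*n" "j < 2*n" using cX by auto
    then show "?X $$ (i, j) = ?X' $$ (i, j)"
      using ent[OF ij] diag[OF ij(1)] torus_mat_diag_nonzero[OF T(1) ij(1)] by simp
  qed (use cX in auto)
  have "T k = T' k" if "k \<in> {1..n}" for k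
    using diag[of "k - 1"] that by (cases k) (auto simp: torus_mat_def)
  moreover have "(\<Sum>p\<in>idx n. t p + s p) = (\<Sum>p\<in>idx n. t' p + s' p)"
    using upper_uni_X_mat(2)[OF n, of t s] upper_uni_X_mat(2)[OF n, of t' s'] XX
    by (simp add: sum_list_full_word)
  ultimately show ?thesis by blast
qed

lemma torus_char_cong: "(\<forall>k\<in>{1..n}. T k = T' k) \<Longrightarrow> torus_char n nu T = torus_char n nu T'"
  by (simp add: torus_char_def)

lemma right_whittaker_eq:
  assumes n: "n \<ge> 2" and "Y \<in> lower_unipotent n" "positive_torus n T" "positive_array n t" "positive_array n s"
    and "g = Y * torus_mat n T * X_mat n t s"
  shows "right_whittaker n mu g = torus_char n mu T * exp_char n t s"
  unfolding right_whittaker_def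
proof (rule the_equality)
  show "\<exists>Y T' t' s'. Y \<in> lower_unipotent n \<and> positive_torus n T' \<and> positive_array n t' \<and> positive_array n s' \<and>
     g = Y * torus_mat n T' * X_mat n t' s' \<and> torus_char n mu T * exp_char n t s = torus_char n mu T' * exp_char n t' s'"
    using assms by blast
next
  fix z assume "\<exists>Y T t s. Y \<in> lower_unipotent n \<and> positive_torus n T \<and> positive_array n t \<and> positive_array n s \<and>
     g = Y * torus_mat n T * X_mat n t s \<and> z = torus_char n mu T * exp_char n t s"
  then obtain Y' T' t' s' where *: "Y' \<in> lower_unipotent n" "positive_torus n T'"
    "g = Y' * torus_mat n T' * X_mat n t' s'" "z = torus_char n mu T' * exp_char n t' s'" by blast
  have "(\<forall>k\<in>{1..n}. T k = T' k) \<and> (\<Sum>p\<in>idx n. t p + s p) = (\<Sum>p\<in>idx n. t' p + s' p)"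
    using assms * by (intro triangular_coordinates_unique[OF n, of Y Y']) auto
  then show "z = torus_char n mu T * exp_char n t s"
    using *(4) torus_char_cong[of n T T' mu] by (simp add: exp_char_def)
qed

text \<open>Conjugation by the diagonal signs negates every simple root vector. Hence X(-t,-s)
  depends only on the matrix X(t,s), and the left Whittaker vector is a function of the group
  element.\<close>

lemma X_mat_uminus:
  assumes n: "n \<ge> 2"
  defines "S \<equiv> torus_mat n (\<lambda>k. (-1) ^ k)"
  shows "X_mat n (\<lambda>p. - t p) (\<lambda>p. - s p) = S * X_mat n t s * S"
proof (rule acts_unique[OF acts_X_mat[OF n]])
  let ?T = "\<lambda>k. (-1) ^ k :: real"
  let ?W = "full_word n (\<lambda>p. - t p) (\<lambda>p. - s p)"
  have r: "node_ratio n ?T a = -1" if a: "valid_node n a" for a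
  proof (cases a)
    case (Lin i)
    then show ?thesis using a by (simp add: node_ratio_def torus_val_def nat_add_distrib)
  next
    case (Spin s)
    then obtain m where "n = Suc m" "m \<ge> 1" using a by (cases n) auto
    then show ?thesis using Spin by (auto simp: node_ratio_def torus_val_def nat_add_distrib minus_one_power_iff)
  qed
  have "map (\<lambda>(c, a). (c * node_ratio n ?T a, a)) ?W = full_word n t s"
    unfolding full_word_uminus using full_word_valid[OF n, of _ _ t s]
    by (auto simp: comp_def case_prod_unfold r intro!: map_idI)
  then have *: "word_op n ?W (torus_op n ?T x) = torus_op n ?T (word_op n (full_word n t s) x)" for x
    using word_torus_commute[of n ?T ?W x] full_word_valid[OF n] by simp
  have inv: "torus_op n ?T (torus_op n ?T x) = x" for x
    by (auto simp: torus_op_def torus_val_def fun_eq_iff power_mult_distrib[symmetric] power_inverse[symmetric] simp flip: mult.assoc)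
  have "word_op n ?W = (torus_op n ?T \<circ> word_op n (full_word n t s)) \<circ> torus_op n ?T"
    using *[of "torus_op n ?T _"] by (auto simp: fun_eq_iff inv)
  then show "acts n (S * X_mat n t s * S) (word_op n ?W)"
    unfolding S_def using acts_mult[OF acts_mult[OF acts_torus acts_X_mat[OF n]] acts_torus] by simp
qed

lemma left_whittaker_eq:
  assumes n: "n \<ge> 2" and ts: "positive_array n t" "positive_array n s"
    and "Y \<in> lower_unipotent n" "positive_torus n T" "positive_array n p" "positive_array n q"
    and "X_mat n (\<lambda>r. - t r) (\<lambda>r. - s r) * w0_lift n = Y * torus_mat n T * X_mat n p q"
  shows "left_whittaker n nu (X_mat n t s) = torus_char n nu T * exp_char n p q"
  unfolding left_whittaker_def
proof (rule the_equality)
  show "\<exists>t' s' Y T' p' q'. positive_array n t' \<and> positive_array n s' \<and> X_mat n t s = X_mat n t' s' \<and>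
     Y \<in> lower_unipotent n \<and> positive_torus n T' \<and> positive_array n p' \<and> positive_array n q' \<and>
     X_mat n (\<lambda>r. - t' r) (\<lambda>r. - s' r) * w0_lift n = Y * torus_mat n T' * X_mat n p' q' \<and>
     torus_char n nu T * exp_char n p q = torus_char n nu T' * exp_char n p' q'"
    using assms by blast
next
  fix z assume "\<exists>t' s' Y T p q. positive_array n t' \<and> positive_array n s' \<and> X_mat n t s = X_mat n t' s' \<and>
     Y \<in> lower_unipotent n \<and> positive_torus n T \<and> positive_array n p \<and> positive_array n q \<and>
     X_mat n (\<lambda>r. - t' r) (\<lambda>r. - s' r) * w0_lift n = Y * torus_mat n T * X_mat n p q \<and>
     z = torus_char n nu T * exp_char n p q"
  then obtain t' s' Y' T' p' q' where *: "X_mat n t s = X_mat n t' s'" "Y' \<in> lower_unipotent n" "positive_torus n T'"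
     "X_mat n (\<lambda>r. - t' r) (\<lambda>r. - s' r) * w0_lift n = Y' * torus_mat n T' * X_mat n p' q'"
     "z = torus_char n nu T' * exp_char n p' q'" by blast
  have "X_mat n (\<lambda>r. - t r) (\<lambda>r. - s r) = X_mat n (\<lambda>r. - t' r) (\<lambda>r. - s' r)"
    unfolding X_mat_uminus[OF n] *(1) ..
  then have "Y * torus_mat n T * X_mat n p q = Y' * torus_mat n T' * X_mat n p' q'"
    using assms(8) *(4) by simp
  then have "(\<forall>k\<in>{1..n}. T k = T' k) \<and> (\<Sum>r\<in>idx n. p r + q r) = (\<Sum>r\<in>idx n. p' r + q' r)"
    using assms * by (intro triangular_coordinates_unique[OF n, of Y Y']) auto
  then show "z = torus_char n nu T * exp_char n p q"
    using *(5) torus_char_cong[of n T T' nu] by (simp add: exp_char_def)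
qed

text \<open>\<open>tri_rel n V U\<close> says that the passage from \<open>V\<close> to \<open>U\<close> is lower unipotent on the upper half of the
  coordinates; by orthogonality this is all that has to be known.\<close>

definition tri_rel :: "nat \<Rightarrow> (int \<Rightarrow> real) \<Rightarrow> (int \<Rightarrow> real) \<Rightarrow> bool" where
  "tri_rel n V U \<longleftrightarrow> (\<forall>k\<in>{1..n}. (\<forall>l\<in>{1..<k}. V (int l) = 0) \<longrightarrow> U (int k) = V (int k))"

text \<open>Put \<open>Y = M * B'\<close> with \<open>B'\<close> inverse to \<open>B\<close>. If B u
  is the unit vector j and i <= j, its coordinates before i vanish, so \<open>tri_rel\<close> gives
  row i < n of \<open>Y\<close> on and above the diagonal. The lower half follows because
  \<open>M\<close> and \<open>B\<close> preserve the form.\<close>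

lemma factorization_if_tri_rel:
  assumes n: "n \<ge> 2" and T: "positive_torus n T"
    and tri: "\<And>x. tri_rel n (torus_op n T (word_op n (full_word n p q) x))
        (word_op n (full_word n (\<lambda>r. - t r) (\<lambda>r. - s r)) (word_refl n (full_word n (\<lambda>_. 1) (\<lambda>_. 1)) x))"
  shows "\<exists>Y\<in>lower_unipotent n. X_mat n (\<lambda>r. - t r) (\<lambda>r. - s r) * w0_lift n = Y * torus_mat n T * X_mat n p q"
proof -
  define M where "M = X_mat n (\<lambda>r. - t r) (\<lambda>r. - s r) * w0_lift n"
  define B where "B = torus_mat n T * X_mat n p q"
  define m where "m = word_op n (full_word n (\<lambda>r. - t r) (\<lambda>r. - s r)) \<circ> word_refl n (full_word n (\<lambda>_. 1) (\<lambda>_. 1))"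
  define b where "b = torus_op n T \<circ> word_op n (full_word n p q)"
  have M: "acts n M m" unfolding M_def m_def by (rule acts_mult[OF acts_X_mat[OF n] acts_w0_lift[OF n]])
  have B: "acts n B b" unfolding B_def b_def by (rule acts_mult[OF acts_torus acts_X_mat[OF n]])
  have cM: "M \<in> carrier_mat (2*n) (2*n)" and cB: "B \<in> carrier_mat (2*n) (2*n)"
    using acts_carrier M B by auto
  have fm: "form_pres n m" and fb: "form_pres n b"
    unfolding m_def b_def using form_pres_word full_word_valid[OF n] form_pres_torus[OF T]
    by (auto intro!: form_pres_comp)
  have X: "upper_uni n (X_mat n p q)" by (rule upper_uni_X_mat[OF n])
  have entB: "B $$ (i, j) = torus_mat n T $$ (i, i) * X_mat n p q $$ (i, j)" if "i < 2*n" "j < 2*n" for i j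
    unfolding B_def using X that by (intro index_torus_mult) (auto simp: upper_uni_def)
  have "Determinant.det B = prod_list (diag_mat B)"
    using X entB cB by (intro det_upper_triangular[OF _ cB]) (auto simp: upper_uni_def upper_triangular_def)
  also have "\<dots> \<noteq> 0"
    using X entB cB torus_mat_diag_nonzero[OF T] by (auto simp: upper_uni_def diag_mat_def prod_list_zero_iff)
  finally have "Determinant.det B \<noteq> 0" .
  then have "B \<in> Units (ring_mat TYPE(real) (2*n) ())" using cB by (rule det_non_zero_imp_unit[rotated])
  then obtain B' where B': "B' \<in> carrier_mat (2*n) (2*n)" "B' * B = 1\<^sub>m (2*n)" "B * B' = 1\<^sub>m (2*n)"
    unfolding Units_def by (auto simp: ring_mat_simps)
  define Y where "Y = M * B'"
  have cY: "Y \<in> carrier_mat (2*n) (2*n)" unfolding Y_def using cM B'(1) by (rule mult_carrier_mat)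
  have YB: "Y * B = M"
    unfolding Y_def using assoc_mult_mat[OF cM B'(1) cB] B'(2) cM by simp
  have Bu: "\<exists>u\<in>carrier_vec (2*n). v = B *\<^sub>v u" if v: "v \<in> carrier_vec (2*n)" for v
  proof
    show "B' *\<^sub>v v \<in> carrier_vec (2*n)" using B'(1) v by (rule mult_mat_vec_carrier)
    show "v = B *\<^sub>v (B' *\<^sub>v v)" using assoc_mult_mat_vec[OF cB B'(1) v] B'(3) v by simp
  qed
  have YBu: "Y *\<^sub>v (B *\<^sub>v u) = M *\<^sub>v u" if "u \<in> carrier_vec (2*n)" for u
    using assoc_mult_mat_vec[OF cY cB that] YB by simp
  have "Y \<in> lower_unipotent n"
  proof (rule lower_unipotent_if_upper_half[OF cY])
    fix x y :: "real Matrix.vec" assume xy: "x \<in> carrier_vec (2*n)" "y \<in> carrier_vec (2*n)"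
    obtain u v where uv: "u \<in> carrier_vec (2*n)" "x = B *\<^sub>v u" "v \<in> carrier_vec (2*n)" "y = B *\<^sub>v v"
      using Bu[OF xy(1)] Bu[OF xy(2)] by auto
    show "split_form n (Y *\<^sub>v x) (Y *\<^sub>v y) = split_form n x y"
      unfolding uv(2,4) YBu[OF uv(1)] YBu[OF uv(3)]
      using acts_split_form[OF M fm uv(1,3)] acts_split_form[OF B fb uv(1,3)] by simp
  next
    fix i j assume ij: "i < n" "i \<le> j" "j < 2*n"
    obtain u where u: "u \<in> carrier_vec (2*n)" "unit_vec (2*n) j = B *\<^sub>v u"
      using Bu[of "unit_vec (2*n) j"] by auto
    have V: "torus_op n T (word_op n (full_word n p q) (coord n u)) = coord n (unit_vec (2*n) j)"
      using actsD[OF B u(1)] u(2) by (simp add: b_def)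
    have U: "word_op n (full_word n (\<lambda>r. - t r) (\<lambda>r. - s r)) (word_refl n (full_word n (\<lambda>_. 1) (\<lambda>_. 1)) (coord n u))
        = coord n (Y *\<^sub>v unit_vec (2*n) j)"
      using actsD[OF M u(1)] u(2) YBu[OF u(1)] by (simp add: m_def)
    have c: "coord n w (int (Suc l)) = w $ l" if "l < n" for w l
      using that by (simp add: coord_def valid_def pos_def)
    have "\<forall>l\<in>{1..<Suc i}. coord n (unit_vec (2*n) j) (int l) = 0"
    proof
      fix l assume "l \<in> {1..<Suc i}"
      then obtain l' where "l = Suc l'" "l' < i" by (cases l) auto
      then show "coord n (unit_vec (2*n) j) (int l) = 0" using c[of l'] ij by simp
    qed
    then have "coord n (Y *\<^sub>v unit_vec (2*n) j) (int (Suc i)) = coord n (unit_vec (2*n) j) (int (Suc i))"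
      using tri[of "coord n u"] ij unfolding V U tri_rel_def by force
    then have "(Y *\<^sub>v unit_vec (2*n) j) $ i = unit_vec (2*n) j $ i"
      using c[OF ij(1)] by simp
    then show "Y $$ (i, j) = (if i = j then 1 else 0)" using ij cY by simp
  qed
  moreover have "M = Y * torus_mat n T * X_mat n p q"
    using YB assoc_mult_mat[OF cY acts_carrier[OF acts_torus] acts_carrier[OF acts_X_mat[OF n]]]
    by (simp add: B_def)
  ultimately show ?thesis unfolding M_def by blast
qed

section \<open>One row of the factorization\<close>

definition pc :: "(int \<Rightarrow> real) \<Rightarrow> nat \<Rightarrow> real" where "pc x k = x (int k)"
definition nc :: "(int \<Rightarrow> real) \<Rightarrow> nat \<Rightarrow> real" where "nc x k = x (- int k)"

lemma pc_nc_eqI: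
  assumes "\<And>k. pc x k = pc y k" "\<And>k. nc x k = nc y k"
  shows "x = y"
proof
  fix l show "x l = y l"
    using assms(1)[of "nat l"] assms(2)[of "nat (- l)"] by (cases "l \<ge> 0") (auto simp: pc_def nc_def)
qed

lemma elem_op_succ:
  assumes "1 \<le> a"
  shows "pc (elem_op (int a) (int (Suc a)) c x) k = (if k = a then pc x a + c * pc x (Suc a) else pc x k)"
    and "nc (elem_op (int a) (int (Suc a)) c x) k = (if k = Suc a then nc x k - c * nc x a else nc x k)"
  using assms by (auto simp: pc_def nc_def elem_op_def add.commute)

lemma elem_op_spin:
  assumes "1 \<le> a"
  shows "pc (elem_op (int a) (- int (Suc a)) c x) k
      = (if k = a then pc x a + c * nc x (Suc a) else if k = Suc a then pc x k - c * nc x a else pc x k)"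
    and "nc (elem_op (int a) (- int (Suc a)) c x) k = nc x k"
  using assms by (auto simp: pc_def nc_def elem_op_def add.commute)

lemma refl_op_succ:
  assumes "1 \<le> a"
  shows "pc (refl_op (int a) (int (Suc a)) x) k = (if k = a then pc x (Suc a) else if k = Suc a then - pc x a else pc x k)"
    and "nc (refl_op (int a) (int (Suc a)) x) k = (if k = a then nc x (Suc a) else if k = Suc a then - nc x a else nc x k)"
  using assms by (auto simp: pc_def nc_def refl_op_def add.commute)

lemma refl_op_spin:
  assumes "1 \<le> a"
  shows "pc (refl_op (int a) (- int (Suc a)) x) k = (if k = a then nc x (Suc a) else if k = Suc a then - nc x a else pc x k)"
    and "nc (refl_op (int a) (- int (Suc a)) x) k = (if k = a then pc x (Suc a) else if k = Suc a then - pc x a else nc x k)"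
  using assms by (auto simp: pc_def nc_def refl_op_def add.commute)

section \<open>The two halves of a row\<close>

primrec low_chain :: "(nat \<Rightarrow> real) \<Rightarrow> nat \<Rightarrow> nat \<Rightarrow> (int \<Rightarrow> real) \<Rightarrow> int \<Rightarrow> real" where
  "low_chain t i 0 = id"
| "low_chain t i (Suc m) = elem_op (int (i + m)) (int (Suc (i + m))) (t (Suc (i + m))) \<circ> low_chain t i m"

primrec up_chain :: "(nat \<Rightarrow> real) \<Rightarrow> nat \<Rightarrow> nat \<Rightarrow> (int \<Rightarrow> real) \<Rightarrow> int \<Rightarrow> real" where
  "up_chain t i 0 = id"
| "up_chain t i (Suc m) = up_chain t i m \<circ> elem_op (int (i + m)) (int (Suc (i + m))) (t (Suc (i + m)))"

text \<open>The order of the factors decides which side is explicit. In \<open>low_chain\<close> the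
  generator at k acts before the one at k + 1, so a positive coordinate receives the old value of
  its neighbour and a negative one the new value; in \<open>up_chain\<close> it is the other way
  round.\<close>

lemma low_chain_pc:
  "1 \<le> i \<Longrightarrow> pc (low_chain t i m x) k = (if i \<le> k \<and> k < i + m then pc x k + t (Suc k) * pc x (Suc k) else pc x k)"
  by (induction m arbitrary: k) (auto simp: elem_op_succ simp del: of_nat_Suc of_nat_add)

lemma low_chain_nc:
  "1 \<le> i \<Longrightarrow> nc (low_chain t i m x) (Suc k)
     = (if i \<le> k \<and> k < i + m then nc x (Suc k) - t (Suc k) * nc (low_chain t i m x) k else nc x (Suc k))"
  "1 \<le> i \<Longrightarrow> k \<le> i \<Longrightarrow> nc (low_chain t i m x) k = nc x k"
proof (induction m)
  case (Suc m)
  {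
    case 1
    then show ?case using Suc by (auto simp: elem_op_succ simp del: of_nat_Suc of_nat_add)
  next
    case 2
    then show ?case using Suc by (auto simp: elem_op_succ simp del: of_nat_Suc of_nat_add)
  }
qed auto

lemma up_chain_pc:
  "1 \<le> i \<Longrightarrow> pc (up_chain t i m x) k
     = (if i \<le> k \<and> k < i + m then pc x k + t (Suc k) * pc (up_chain t i m x) (Suc k) else pc x k)"
proof (induction m arbitrary: x)
  case (Suc m)
  define y where "y = elem_op (int (i + m)) (int (Suc (i + m))) (t (Suc (i + m))) x"
  have u: "up_chain t i (Suc m) x = up_chain t i m y" by (simp add: y_def)
  have y: "pc y l = (if l = i + m then pc x l + t (Suc l) * pc x (Suc l) else pc x l)" for l
    unfolding y_def using Suc.prems by (subst elem_op_succ) auto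
  have "pc (up_chain t i m y) (Suc (i + m)) = pc y (Suc (i + m))"
  proof -
    have "pc (up_chain t i m y) l = pc y l" if "l \<ge> i + m" for l
      using that Suc.prems
      by (induction m arbitrary: y) (auto simp: elem_op_succ simp del: of_nat_Suc of_nat_add)
    then show ?thesis by simp
  qed
  then show ?case unfolding u using Suc.IH[of y] Suc.prems y by (auto simp: less_Suc_eq)
qed simp

lemma up_chain_pc_top: "1 \<le> i \<Longrightarrow> i + m \<le> l \<Longrightarrow> pc (up_chain t i m x) l = pc x l"
  by (induction m arbitrary: x) (auto simp: elem_op_succ simp del: of_nat_Suc of_nat_add)

lemma up_chain_nc:
  "1 \<le> i \<Longrightarrow> nc (up_chain t i m x) k
     = (if Suc i \<le> k \<and> k \<le> i + m then nc x k - t k * nc x (k - 1) else nc x k)"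
  by (induction m arbitrary: x) (auto simp: elem_op_succ le_Suc_eq simp del: of_nat_Suc of_nat_add)

text \<open>The two spin factors stand in a fixed order, \<open>g n\<close> at the node
  \<open>Spin 1\<close> and \<open>d n\<close> at \<open>Spin (-1)\<close>. The parity of n - i is
  thereby moved into the choice of \<open>g n\<close> and \<open>d n\<close>.\<close>

definition row_op :: "nat \<Rightarrow> (nat \<Rightarrow> real) \<Rightarrow> (nat \<Rightarrow> real) \<Rightarrow> nat \<Rightarrow> (int \<Rightarrow> real) \<Rightarrow> int \<Rightarrow> real" where
  "row_op n g d i = up_chain d i (n - 1 - i) \<circ> elem_op (int (n - 1)) (int n) (g n)
     \<circ> elem_op (int (n - 1)) (- int n) (d n) \<circ> low_chain g i (n - 1 - i)"

text \<open>Relations between neighbouring coordinates are recorded instead of closed sums, because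
  they are the steps of the inductions in \<open>row_identity\<close>.\<close>

lemma row_op_rel:
  fixes x :: "int \<Rightarrow> real" and g d :: "nat \<Rightarrow> real"
  assumes i: "1 \<le> i" "i \<le> m"
  defines "y \<equiv> low_chain g i (m - i) x" and "z \<equiv> row_op (Suc m) g d i x"
  shows "nc y i = nc x i"
    and "\<And>k. i \<le> k \<Longrightarrow> k < m \<Longrightarrow> nc y (Suc k) = nc x (Suc k) - g (Suc k) * nc y k"
    and "\<And>k. i \<le> k \<Longrightarrow> k < m \<Longrightarrow> pc z k = pc x k + g (Suc k) * pc x (Suc k) + d (Suc k) * pc z (Suc k)"
    and "\<And>k. i \<le> k \<Longrightarrow> k < m \<Longrightarrow> nc z (Suc k) = nc x (Suc k) - (g (Suc k) + d (Suc k)) * nc y k"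
    and "pc z m = pc x m + d (Suc m) * nc x (Suc m) + g (Suc m) * pc z (Suc m)"
    and "pc z (Suc m) = pc x (Suc m) - d (Suc m) * nc y m"
    and "nc z (Suc m) = nc x (Suc m) - g (Suc m) * nc y m"
    and "\<And>k. k \<le> i \<Longrightarrow> nc z k = nc x k"
    and "\<And>k. k < i \<Longrightarrow> pc z k = pc x k"
    and "\<And>k. k > Suc m \<Longrightarrow> pc z k = pc x k"
    and "\<And>k. k > Suc m \<Longrightarrow> nc z k = nc x k"
proof -
  have m1: "1 \<le> m" using i by simp
  define v where "v = elem_op (int m) (- int (Suc m)) (d (Suc m)) y"
  define u where "u = elem_op (int m) (int (Suc m)) (g (Suc m)) v"
  have z: "z = up_chain d i (m - i) u" by (simp add: z_def row_op_def u_def v_def y_def)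
  have im: "i + (m - i) = m" using i by simp
  note yp = low_chain_pc[OF i(1), of g "m - i" x, folded y_def, unfolded im]
  note yn = low_chain_nc(1)[OF i(1), of g "m - i" x, folded y_def, unfolded im]
  note yn2 = low_chain_nc(2)[OF i(1), of _ g "m - i" x, folded y_def]
  note zp = up_chain_pc[OF i(1), of d "m - i" u, folded z, unfolded im]
  note zt = up_chain_pc_top[OF i(1), of "m - i" _ d u, folded z, unfolded im]
  note zn = up_chain_nc[OF i(1), of d "m - i" u, folded z, unfolded im]
  have vp: "pc v k = (if k = m then pc y m + d (Suc m) * nc y (Suc m) else if k = Suc m then pc y k - d (Suc m) * nc y m else pc y k)"
    and vn: "nc v k = nc y k" for k
    unfolding v_def using elem_op_spin[OF m1] by auto
  have up: "pc u k = (if k = m then pc v m + g (Suc m) * pc v (Suc m) else pc v k)"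
    and un: "nc u k = (if k = Suc m then nc v k - g (Suc m) * nc v m else nc v k)" for k
    unfolding u_def using elem_op_succ[OF m1] by auto
  show "nc y i = nc x i" using yn2[of i] by simp
  show "nc y (Suc k) = nc x (Suc k) - g (Suc k) * nc y k" if "i \<le> k" "k < m" for k using yn[of k] that by simp
  show "pc z k = pc x k + g (Suc k) * pc x (Suc k) + d (Suc k) * pc z (Suc k)" if "i \<le> k" "k < m" for k
    using zp[of k] up[of k] vp[of k] yp[of k] that by simp
  show "nc z (Suc k) = nc x (Suc k) - (g (Suc k) + d (Suc k)) * nc y k" if "i \<le> k" "k < m" for k
    using zn[of "Suc k"] un[of k] un[of "Suc k"] vn[of k] vn[of "Suc k"] yn[of k] that by (simp add: algebra_simps)
  show "pc z (Suc m) = pc x (Suc m) - d (Suc m) * nc y m"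
    using zt[of "Suc m"] up[of "Suc m"] vp[of "Suc m"] yp[of "Suc m"] by simp
  then show "pc z m = pc x m + d (Suc m) * nc x (Suc m) + g (Suc m) * pc z (Suc m)"
    using zt[of m] up[of m] vp[of m] vp[of "Suc m"] yp[of m] yp[of "Suc m"] yn[of m] by simp
  show "nc z (Suc m) = nc x (Suc m) - g (Suc m) * nc y m"
    using zn[of "Suc m"] un[of "Suc m"] vn[of m] vn[of "Suc m"] yn[of m] by simp
  show "nc z k = nc x k" if "k \<le> i" for k using zn[of k] un[of k] vn[of k] yn2[of k] that i by simp
  show "pc z k = pc x k" if "k < i" for k using zp[of k] up[of k] vp[of k] yp[of k] that i by simp
  show "pc z k = pc x k" if "k > Suc m" for k using zp[of k] up[of k] vp[of k] yp[of k] that by simp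
  show "nc z k = nc x k" if "k > Suc m" for k
    using zn[of k] un[of k] vn[of k] yn[of "k - 1"] that by (cases k) auto
qed

text \<open>The longest element of type D on the coordinates i, ..., n, in the lift given by rows i,
  ..., n - 1. Sign changes come in pairs: for odd n - i all indices are negated, for even n - i the
  index n is spared.\<close>

definition weyl_op :: "nat \<Rightarrow> nat \<Rightarrow> (int \<Rightarrow> real) \<Rightarrow> int \<Rightarrow> real" where
  "weyl_op n i x k = (if int i \<le> \<bar>k\<bar> \<and> \<bar>k\<bar> < int n then (-1) ^ (n - i) * x (- k)
     else if \<bar>k\<bar> = int n then (-1) ^ (n - i) * x (if odd (n - i) then - k else k) else x k)"

lemma weyl_op_pc: "pc (weyl_op n i x) k = (if i \<le> k \<and> k < n then (-1) ^ (n - i) * nc x k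
     else if k = n then (-1) ^ (n - i) * (if odd (n - i) then nc x k else pc x k) else pc x k)"
  and weyl_op_nc: "nc (weyl_op n i x) k = (if i \<le> k \<and> k < n then (-1) ^ (n - i) * pc x k
     else if k = n then (-1) ^ (n - i) * (if odd (n - i) then pc x k else nc x k) else nc x k)"
  by (auto simp: weyl_op_def pc_def nc_def)

text \<open>Relative to the positive parameters \<open>g\<close>, \<open>d\<close> of a row, these are the parameters of the row
  of the transformed element.\<close>

definition row_rho :: "nat \<Rightarrow> nat \<Rightarrow> (nat \<Rightarrow> real) \<Rightarrow> (nat \<Rightarrow> real) \<Rightarrow> nat \<Rightarrow> real" where
  "row_rho n i g d k = (if k = i \<or> k = n then 1 else 1 + g k / d k)"

definition row_g :: "nat \<Rightarrow> nat \<Rightarrow> (nat \<Rightarrow> real) \<Rightarrow> (nat \<Rightarrow> real) \<Rightarrow> nat \<Rightarrow> real" where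
  "row_g n i g d k = row_rho n i g d (k - 1) / (row_rho n i g d k * (if k = n \<and> odd (n - i) then g k else d k))"

definition row_d :: "nat \<Rightarrow> nat \<Rightarrow> (nat \<Rightarrow> real) \<Rightarrow> (nat \<Rightarrow> real) \<Rightarrow> nat \<Rightarrow> real" where
  "row_d n i g d k = row_rho n i g d (k - 1) / (row_rho n i g d k * (if k = n \<and> odd (n - i) then d k else g k))"

text \<open>One row of the factorization: \<open>z'\<close> is the negated row after the longest
  element on i, ..., n, and \<open>w\<close> the longest element on i + 1, ..., n after the positive
  row. Coordinate i differs by a torus factor; when it vanishes, so do all others up to their own
  torus factors, except the one at - i, about which nothing is claimed. This is lower triangularity
  in the form used by \<open>tri_rel\<close>.\<close>

lemma row_identity:
  fixes x :: "int \<Rightarrow> real"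
  assumes i: "1 \<le> i" "i \<le> m" and n: "n = Suc m"
    and pos: "\<And>j. i < j \<Longrightarrow> j \<le> n \<Longrightarrow> g j > 0" "\<And>j. i < j \<Longrightarrow> j \<le> n \<Longrightarrow> d j > 0"
  defines "z \<equiv> row_op n (row_g n i g d) (row_d n i g d) i x"
    and "z' \<equiv> row_op n (\<lambda>j. - g j) (\<lambda>j. - d j) i (weyl_op n i x)"
  defines "w \<equiv> weyl_op n (Suc i) z"
  shows "pc z' i = (\<Prod>j\<in>{i<..n}. g j * d j) * pc w i"
    and "pc z i = 0 \<Longrightarrow> i < k \<Longrightarrow> k < n \<Longrightarrow> pc z' k = (g k / d k) * pc w k \<and> nc z' k = (d k / g k) * nc w k"
    and "pc z i = 0 \<Longrightarrow> pc z' n = (d n / g n) * pc w n \<and> nc z' n = (g n / d n) * nc w n"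
    and "k < i \<or> n < k \<Longrightarrow> pc z' k = pc w k \<and> nc z' k = nc w k"
    and "pc w i = pc z i"
proof -
  define rho where "rho = row_rho n i g d"
  define gp where "gp = row_g n i g d"
  define dp where "dp = row_d n i g d"
  define e :: real where "e = (-1) ^ (n - i)"
  have e: "e = 1 \<or> e = -1" by (auto simp: e_def minus_one_power_iff)
  have ee: "e * e = 1" "e * (e * a) = a" for a using e by auto
  define x' where "x' = weyl_op n i x"
  define y where "y = low_chain gp i (m - i) x"
  define y' where "y' = low_chain (\<lambda>j. - g j) i (m - i) x'"
  have z1: "z = row_op (Suc m) gp dp i x" and z2: "z' = row_op (Suc m) (\<lambda>j. - g j) (\<lambda>j. - d j) i x'"
    unfolding z_def z'_def gp_def dp_def x'_def by (simp_all only: n)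
  note R = row_op_rel(1,2)[OF i, where g = gp and x = x, folded y_def]
    row_op_rel(3-11)[OF i, where g = gp and x = x and d = dp, folded y_def z1]
  note R' = row_op_rel(1,2)[OF i, where g = "\<lambda>j. - g j" and x = x', folded y'_def]
    row_op_rel(3-11)[OF i, where g = "\<lambda>j. - g j" and x = x' and d = "\<lambda>j. - d j", folded y'_def z2]
  have rho_i: "rho i = 1" and rho_n: "rho n = 1" by (auto simp: rho_def row_rho_def)
  have rho: "rho k = 1 + g k / d k" if "i < k" "k \<le> m" for k using that by (simp add: rho_def row_rho_def n)
  have rho0: "rho k > 0" if "i \<le> k" "k \<le> n" for k
    using that pos[of k] by (auto simp: rho_def row_rho_def intro!: add_pos_pos)
  have gp: "gp (Suc k) = rho k / (rho (Suc k) * d (Suc k))" and dp: "dp (Suc k) = rho k / (rho (Suc k) * g (Suc k))"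
    if "k < m" for k using that by (auto simp: gp_def dp_def rho_def row_g_def row_d_def n)
  have x'n: "nc x' k = e * pc x k" and x'p: "pc x' k = e * nc x k" if "i \<le> k" "k \<le> m" for k
    using that by (auto simp: x'_def weyl_op_pc weyl_op_nc n e_def)
  have wp: "pc w k = - e * nc z k" and wn: "nc w k = - e * pc z k" if "i < k" "k \<le> m" for k
  proof -
    have "(-1) ^ (n - Suc i) = - e" using i n by (simp add: e_def Suc_diff_le)
    then show "pc w k = - e * nc z k" "nc w k = - e * pc z k"
      using that by (auto simp: w_def weyl_op_pc weyl_op_nc n)
  qed
  show wi: "pc w i = pc z i" using i by (simp add: w_def weyl_op_pc n)
  define tau where "tau k = (\<Prod>j\<in>{i<..k}. g j)" for k
  have tau_Suc: "tau (Suc k) = tau k * g (Suc k)" if "i \<le> k" for k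
  proof -
    have "{i<..Suc k} = insert (Suc k) {i<..k}" using that by auto
    then show ?thesis by (simp add: tau_def)
  qed
  \<comment> \<open>Two invariants carry the proof, \<open>A\<close> running upwards from i and
    \<open>B\<close> downwards from m. They are linked in the last column, through \<open>Am\<close>
    and \<open>Bm\<close>.\<close>
  have A: "rho k * tau k * pc z i = e * rho k * nc y' k + pc z k - pc x k" if "i \<le> k" "k \<le> m" for k
    using that
  proof (induction k rule: dec_induct)
    case base
    show ?case using R'(1) x'n[of i] i by (simp add: rho_i tau_def ee)
  next
    case (step k)
    define r r' G D where "r = rho k" and "r' = rho (Suc k)" and "G = g (Suc k)" and "D = d (Suc k)"
    have p: "r > 0" "r' > 0" "G > 0" "D > 0"
      using rho0[of k] rho0[of "Suc k"] pos[of "Suc k"] step by (auto simp: r_def r'_def G_def D_def n)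
    have r': "r' = 1 + G / D" using rho[of "Suc k"] step by (simp add: r'_def G_def D_def)
    have "r * tau k * pc z i = e * r * nc y' k + (r / (r' * D)) * pc x (Suc k) + (r / (r' * G)) * pc z (Suc k)"
      using step R(3)[of k] gp[of k] dp[of k] by (simp add: r_def r'_def G_def D_def)
    then have "r * (tau k * pc z i) = r * (e * nc y' k + pc x (Suc k) / (r' * D) + pc z (Suc k) / (r' * G))"
      by (simp add: algebra_simps)
    then have "tau k * pc z i = e * nc y' k + pc x (Suc k) / (r' * D) + pc z (Suc k) / (r' * G)"
      using p by simp
    then have "r' * (tau k * G) * pc z i = r' * G * (e * nc y' k + pc x (Suc k) / (r' * D) + pc z (Suc k) / (r' * G))"
      by (simp add: algebra_simps)
    also have "\<dots> = e * r' * (G * nc y' k) + (G / D) * pc x (Suc k) + pc z (Suc k)"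
      using p by (simp add: field_simps)
    also have "G * nc y' k = nc y' (Suc k) - e * pc x (Suc k)"
      using R'(2)[of k] x'n[of "Suc k"] step by (simp add: G_def)
    also have "e * r' * (nc y' (Suc k) - e * pc x (Suc k)) + (G / D) * pc x (Suc k) + pc z (Suc k)
       = e * r' * nc y' (Suc k) + pc z (Suc k) - pc x (Suc k)"
      using e by (auto simp: r' algebra_simps)
    finally show ?case using tau_Suc[of k] step by (simp add: r'_def G_def)
  qed
  define r where "r = rho m"
  define G D where "G = g n" and "D = d n"
  have p: "r > 0" "G > 0" "D > 0" using rho0[of m] pos[of n] i by (auto simp: r_def G_def D_def n)
  have gpn: "gp n = r / (if odd (n - i) then G else D)" and dpn: "dp n = r / (if odd (n - i) then D else G)"
    using rho_n by (auto simp: gp_def dp_def row_g_def row_d_def rho_def r_def G_def D_def n)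
  have zm: "pc z m = pc x m + dp n * nc x n + gp n * pc z n" "pc z n = pc x n - dp n * nc y m" "nc z n = nc x n - gp n * nc y m"
    using R(5-7) by (auto simp: n)
  have z'm: "pc z' m = pc x' m - D * nc x' n - G * pc z' n" "pc z' n = pc x' n + D * nc y' m" "nc z' n = nc x' n + G * nc y' m"
    using R'(5-7) by (auto simp: n G_def D_def)
  have Am: "tau m * pc z i = e * nc y' m + (dp n / r) * nc x n + (gp n / r) * pc x n - (gp n / r) * dp n * nc y m"
  proof -
    have h: "r * (tau m * pc z i) = e * r * nc y' m + dp n * nc x n + gp n * (pc x n - dp n * nc y m)"
      using A[of m] i zm by (simp add: r_def algebra_simps)
    have "tau m * pc z i = r * (tau m * pc z i) / r" using p by simp
    also have "\<dots> = e * nc y' m + (dp n / r) * nc x n + (gp n / r) * pc x n - (gp n / r) * dp n * nc y m"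
      unfolding h using p by (simp add: add_divide_distrib diff_divide_distrib right_diff_distrib)
    finally show ?thesis .
  qed
  \<comment> \<open>The parity of n - i decides whether coordinate n is exchanged with its dual;
    \<open>row_g\<close> and \<open>row_d\<close> swap roles in the last column accordingly, so both
    cases lead to the same equation.\<close>
  have Bm: "e * pc z' m = nc x m - rho m * nc y m - G * D * tau m * pc z i"
    and Cn: "pc z i = 0 \<Longrightarrow> pc z' n = (d n / g n) * pc w n \<and> nc z' n = (g n / d n) * nc w n"
  proof -
    have s1: "(-1) ^ (n - Suc i) = - e" using i n by (simp add: e_def Suc_diff_le)
    have par: "odd (n - Suc i) \<longleftrightarrow> even (n - i)" using i n by (simp add: Suc_diff_le)
    show "e * pc z' m = nc x m - rho m * nc y m - G * D * tau m * pc z i" (is ?B)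
    proof (cases "odd (n - i)")
      case True
      then have e1: "e = -1" by (simp add: e_def)
      have gd: "gp n = r / G" "dp n = r / D" using True by (simp_all add: gpn dpn)
      have x': "pc x' n = - nc x n" "nc x' n = - pc x n" using True by (simp_all add: x'_def weyl_op_pc weyl_op_nc)
      have "G * D * (tau m * pc z i) = - (G * D * nc y' m) + G * nc x n + D * pc x n - r * nc y m"
        unfolding Am using p by (simp add: e1 gd field_simps)
      then show ?B using z'm x' x'p[of m] i by (simp add: e1 r_def algebra_simps)
    next
      case False
      then have e1: "e = 1" by (simp add: e_def)
      have gd: "gp n = r / D" "dp n = r / G" using False by (simp_all add: gpn dpn)
      have x': "pc x' n = pc x n" "nc x' n = nc x n" using False by (simp_all add: x'_def weyl_op_pc weyl_op_nc)
      have "G * D * (tau m * pc z i) = G * D * nc y' m + D * nc x n + G * pc x n - r * nc y m"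
        unfolding Am using p by (simp add: e1 gd field_simps)
      then show ?B using z'm x' x'p[of m] i by (simp add: e1 r_def algebra_simps)
    qed
    assume z0: "pc z i = 0"
    show "pc z' n = (d n / g n) * pc w n \<and> nc z' n = (g n / d n) * nc w n"
    proof (cases "odd (n - i)")
      case True
      then have e1: "e = -1" by (simp add: e_def)
      have gd: "gp n = r / G" "dp n = r / D" using True by (simp_all add: gpn dpn)
      have x': "pc x' n = - nc x n" "nc x' n = - pc x n" using True by (simp_all add: x'_def weyl_op_pc weyl_op_nc)
      have w: "pc w n = pc z n" "nc w n = nc z n" using True par s1 by (simp_all add: w_def weyl_op_pc weyl_op_nc e1)
      have "nc y' m = nc x n / D + pc x n / G - r * nc y m / (G * D)"
        using Am z0 p by (simp add: e1 gd field_simps)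
      then show ?thesis using z'm x' w zm p by (simp add: e1 gd flip: G_def D_def) (simp add: field_simps)
    next
      case False
      then have e1: "e = 1" by (simp add: e_def)
      have gd: "gp n = r / D" "dp n = r / G" using False by (simp_all add: gpn dpn)
      have x': "pc x' n = pc x n" "nc x' n = nc x n" using False by (simp_all add: x'_def weyl_op_pc weyl_op_nc)
      have w: "pc w n = - nc z n" "nc w n = - pc z n" using False par s1 by (simp_all add: w_def weyl_op_pc weyl_op_nc e1)
      have "nc y' m = - (nc x n / G) - pc x n / D + r * nc y m / (G * D)"
        using Am z0 p by (simp add: e1 gd field_simps)
      then show ?thesis using z'm x' w zm p by (simp add: e1 gd flip: G_def D_def) (simp add: field_simps)
    qed
  qed
  \<comment> \<open>The value at m is - G D tau m, and each step down multiplies by - d, so that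
    \<open>kap i\<close> is the torus factor up to the sign \<open>e\<close>.\<close>
  define kap where "kap k = (-1) ^ (Suc m - k) * (\<Prod>j\<in>{k<..n}. d j) * (\<Prod>j\<in>{i<..n}. g j)" for k
  have B: "e * pc z' k = nc x k - rho k * nc y k + kap k * pc z i" if "i \<le> k" "k \<le> m" for k
    using that(2,1)
  proof (induction k rule: inc_induct)
    case base
    have "{m<..n} = {n}" "{i<..n} = insert n {i<..m}" using i n by auto
    then have "kap m = - (G * D * tau m)" by (simp add: kap_def tau_def G_def D_def n)
    then show ?case using Bm by simp
  next
    case (step k)
    have k: "i \<le> Suc k" "k < m" using step by auto
    have kap: "kap k = - d (Suc k) * kap (Suc k)"
    proof -
      have "{k<..n} = insert (Suc k) {Suc k<..n}" "Suc m - k = Suc (Suc m - Suc k)" using k n by auto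
      then show ?thesis by (simp add: kap_def)
    qed
    define G D r r' where "G = g (Suc k)" and "D = d (Suc k)" and "r = rho k" and "r' = rho (Suc k)"
    have p: "r > 0" "r' > 0" "G > 0" "D > 0"
      using rho0[of k] rho0[of "Suc k"] pos[of "Suc k"] step by (auto simp: r_def r'_def G_def D_def n)
    \<comment> \<open>This equation explains the form of \<open>row_rho\<close>: it cancels the term
      in \<open>nc x (Suc k)\<close> below.\<close>
    have r': "D * r' = D + G" using rho[of "Suc k"] step p by (simp add: r'_def G_def D_def field_simps)
    have "e * pc z' k = e * pc x' k - G * (e * pc x' (Suc k)) - D * (e * pc z' (Suc k))"
    proof -
      have h: "pc z' k = pc x' k - G * pc x' (Suc k) - D * pc z' (Suc k)"
        using R'(3)[of k] step by (simp add: G_def D_def)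
      show ?thesis unfolding h by (simp add: algebra_simps)
    qed
    also have "\<dots> = nc x k - G * nc x (Suc k) - D * (nc x (Suc k) - r' * nc y (Suc k) + kap (Suc k) * pc z i)"
      using x'p[of k] x'p[of "Suc k"] step k by (simp add: ee r'_def)
    also have "nc y (Suc k) = nc x (Suc k) - r / (r' * D) * nc y k"
      using R(2)[of k] gp[of k] step by (simp add: r_def r'_def D_def)
    also have "nc x k - G * nc x (Suc k) - D * (nc x (Suc k) - r' * (nc x (Suc k) - r / (r' * D) * nc y k) + kap (Suc k) * pc z i)
       = nc x k - r * nc y k - D * kap (Suc k) * pc z i + (D * r' - D - G) * nc x (Suc k)"
      using p by (simp add: field_simps)
    also have "D * r' - D - G = 0" using r' by simp
    finally show ?case by (simp add: kap r_def D_def)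
  qed
  \<comment> \<open>At k = i one has rho = 1 and \<open>nc y i = nc x i\<close>, so only the
    \<open>kap\<close> term of \<open>B\<close> survives.\<close>
  show "pc z' i = (\<Prod>j\<in>{i<..n}. g j * d j) * pc w i"
  proof -
    have "Suc m - i = n - i" by (simp add: n)
    then have "kap i = e * (\<Prod>j\<in>{i<..n}. g j * d j)"
      by (simp only: kap_def e_def prod.distrib ac_simps)
    then have "e * pc z' i = e * ((\<Prod>j\<in>{i<..n}. g j * d j) * pc z i)"
      using B[of i] i R(1) by (simp add: rho_i)
    then show ?thesis using e wi by auto
  qed
  \<comment> \<open>On the hyperplane \<open>pc z i = 0\<close> the invariants \<open>A\<close> and
    \<open>B\<close> become relations between the coordinates at k alone.\<close>
  show "pc z' k = (g k / d k) * pc w k \<and> nc z' k = (d k / g k) * nc w k" if z0: "pc z i = 0" and k: "i < k" "k < n"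
  proof -
    obtain l where l: "k = Suc l" "i \<le> l" "l < m" using k n by (cases k) auto
    define G D r r' where "G = g k" and "D = d k" and "r = rho l" and "r' = rho k"
    have p: "r > 0" "r' > 0" "G > 0" "D > 0"
      using rho0[of l] rho0[of k] pos[of k] l k by (auto simp: r_def r'_def G_def D_def n)
    have r': "r' = 1 + G / D" using rho[of k] l by (simp add: r'_def G_def D_def)
    have h1: "e * pc z' k = nc x k - r' * nc y k" using B[of k] l z0 by (simp add: r'_def)
    have h2: "nc y k = nc x k - r / (r' * D) * nc y l"
      using R(2)[of l] gp[of l] l by (simp add: r_def r'_def D_def)
    have h3: "nc z k = nc x k - (r / (r' * D) + r / (r' * G)) * nc y l"
      using R(4)[of l] gp[of l] dp[of l] l by (simp add: r_def r'_def D_def G_def)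
    have h4: "r / (r' * D) + r / (r' * G) = r / G"
    proof -
      have DG: "D + G = r' * D" using p by (simp add: r' field_simps)
      have "r / (r' * D) + r / (r' * G) = r * (D + G) / (r' * D * G)" using p by (simp add: field_simps)
      then show ?thesis unfolding DG using p by simp
    qed
    have "e * pc z' k = nc x k - r' * nc x k + (r' * (r / (r' * D))) * nc y l"
      unfolding h1 h2 by (simp add: algebra_simps)
    also have "r' * (r / (r' * D)) = r / D" using p by simp
    also have "nc x k - r' * nc x k + r / D * nc y l = - (G / D) * (nc x k - (r / G) * nc y l)"
      using p by (simp add: r' field_simps)
    finally have "e * pc z' k = - (G / D) * nc z k" unfolding h3 h4 .
    then have 1: "pc z' k = (g k / d k) * pc w k"
      using e wp[of k] l by (auto simp: G_def D_def)
    have y': "G * nc y' l = nc y' k - e * pc x k"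
      using R'(2)[of l] x'n[of k] l by (simp add: G_def)
    have "r' * (e * nc y' k) = pc x k - pc z k" using A[of k] l z0 by (simp add: r'_def algebra_simps)
    then have ry: "r' * nc y' k = e * (pc x k - pc z k)" using e by auto
    have "nc z' k = e * pc x k + (G + D) * nc y' l"
      using R'(4)[of l] x'n[of k] l by (simp add: G_def D_def algebra_simps)
    also have "G + D = (r' * D / G) * G" using p by (simp add: r' field_simps)
    also have "e * pc x k + (r' * D / G) * G * nc y' l = e * pc x k + (D / G) * (r' * (G * nc y' l))" by simp
    also have "r' * (G * nc y' l) = r' * nc y' k - e * r' * pc x k" unfolding y' by (simp add: algebra_simps)
    also have "\<dots> = e * (pc x k - pc z k) - e * r' * pc x k" by (simp only: ry)
    also have "e * pc x k + (D / G) * (e * (pc x k - pc z k) - e * r' * pc x k) = - (D / G) * (e * pc z k)"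
      using p by (simp add: r' field_simps)
    finally have "nc z' k = (d k / g k) * nc w k" using wn[of k] l by (simp add: G_def D_def)
    with 1 show ?thesis by simp
  qed
  show "pc z i = 0 \<Longrightarrow> pc z' n = (d n / g n) * pc w n \<and> nc z' n = (g n / d n) * nc w n" by (rule Cn)
  show "k < i \<or> n < k \<Longrightarrow> pc z' k = pc w k \<and> nc z' k = nc w k"
    using R(8-11)[of k] R'(8-11)[of k] i by (auto simp: x'_def w_def weyl_op_pc weyl_op_nc n)
qed

section \<open>The factorization of the left Whittaker vector\<close>

type_synonym rarray = "nat \<times> nat \<Rightarrow> real"

text \<open>The node of \<open>t (i, n)\<close> depends on the parity of \<open>n - i\<close>. In the last column \<open>gpart\<close> collects the
  parameters of the node \<open>Spin 1\<close>, and \<open>dpart\<close> those of \<open>Spin (-1)\<close>.\<close>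

definition sw :: "nat \<Rightarrow> nat \<times> nat \<Rightarrow> bool" where
  "sw n p \<longleftrightarrow> snd p = n \<and> even (n - fst p)"

definition gpart :: "nat \<Rightarrow> rarray \<Rightarrow> rarray \<Rightarrow> rarray" where
  "gpart n t s p = (if sw n p then s p else t p)"

definition dpart :: "nat \<Rightarrow> rarray \<Rightarrow> rarray \<Rightarrow> rarray" where
  "dpart n t s p = (if sw n p then t p else s p)"

lemma part_part [simp]: "gpart n (gpart n g d) (dpart n g d) = g" "dpart n (gpart n g d) (dpart n g d) = d"
  by (auto simp: gpart_def dpart_def)

lemma up_chain_cong: "(\<And>j. i < j \<Longrightarrow> j \<le> i + m \<Longrightarrow> f j = f' j) \<Longrightarrow> up_chain f i m = up_chain f' i m"
  by (induction m) auto

lemma low_chain_cong: "(\<And>j. i < j \<Longrightarrow> j \<le> i + m \<Longrightarrow> f j = f' j) \<Longrightarrow> low_chain f i m = low_chain f' i m"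
  by (induction m) auto

lemma word_op_up: "word_op n (map (\<lambda>j. (f j, Lin (j - 1))) [Suc i..<Suc i + m]) = up_chain f i m"
  by (induction m) (simp_all add: word_op_append add.commute)

lemma word_op_low: "word_op n (map (\<lambda>j. (f j, Lin (j - 1))) (rev [Suc i..<Suc i + m])) = low_chain f i m"
  by (induction m) (simp_all add: add.commute)

lemma spin_commute:
  assumes "2 \<le> n"
  shows "elem_op (int n - 1) (int n) a \<circ> elem_op (int n - 1) (- int n) b
    = elem_op (int n - 1) (- int n) b \<circ> elem_op (int n - 1) (int n) a"
  using assms by (auto simp: fun_eq_iff elem_op_def algebra_simps)

lemma sgn_pow_eq: "sgn_pow k = 1 \<longleftrightarrow> even k"
  by (auto simp: sgn_pow_def minus_one_power_iff)

text \<open>The spin factors of a row commute, so they can be brought into the order of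
  \<open>row_op\<close>; \<open>sw\<close> records which of \<open>t\<close>, \<open>s\<close>
  belongs to which node.\<close>

lemma word_op_row:
  assumes i: "1 \<le> i" "i < n"
  shows "word_op n (row_word n t s i) = row_op n (\<lambda>j. gpart n t s (i, j)) (\<lambda>j. dpart n t s (i, j)) i"
proof -
  have n2: "2 \<le> n" using i by simp
  define m where "m = n - 1 - i"
  have m: "[i + 1..<n] = [Suc i..<Suc i + m]" "n = Suc (i + m)" using i by (auto simp: m_def)
  have in1: "int (n - 1) = int n - 1" using n2 by (simp add: of_nat_diff)
  have up: "up_chain (\<lambda>j. s (i, j)) i m = up_chain (\<lambda>j. dpart n t s (i, j)) i m"
    by (rule up_chain_cong) (auto simp: dpart_def sw_def m(2))
  have low: "low_chain (\<lambda>j. t (i, j)) i m = low_chain (\<lambda>j. gpart n t s (i, j)) i m"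
    by (rule low_chain_cong) (auto simp: gpart_def sw_def m(2))
  have mid: "word_op n [(s (i, n), Spin (sgn_pow (n - i))), (t (i, n), Spin (sgn_pow (n - i + 1)))]
      = elem_op (int n - 1) (int n) (gpart n t s (i, n)) \<circ> elem_op (int n - 1) (- int n) (dpart n t s (i, n))"
    using spin_commute[OF n2] by (auto simp: sgn_pow_eq gpart_def dpart_def sw_def)
  show ?thesis
    unfolding row_word_def word_op_append m(1) word_op_up word_op_low up low mid row_op_def in1 m_def[symmetric]
    by (simp add: comp_assoc)
qed

text \<open>Passing from i + 1 to i adds the same reflection on both sides of the word, hence the
  downward induction. It starts from the two spin reflections, one for each sign in either
  order.\<close>

lemma word_refl_row:
  fixes f h :: "nat \<Rightarrow> real" and a b :: real
  assumes i: "1 \<le> i" "i < n" and uv: "(u = 1 \<and> v \<noteq> 1) \<or> (u \<noteq> 1 \<and> v = 1)"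
  defines "X \<equiv> \<lambda>i. word_refl n (map (\<lambda>j. (f j, Lin (j - 1))) [Suc i..<n] @ [(a, Spin u), (b, Spin v)]
      @ map (\<lambda>j. (h j, Lin (j - 1))) (rev [Suc i..<n]))"
  shows "pc (X i x) k = (if k = i then (-1) ^ (n - i) * nc x k else if i < k \<and> k < n then - pc x k else if k = n then - nc x k else pc x k)
     \<and> nc (X i x) k = (if k = i then (-1) ^ (n - i) * pc x k else if i < k \<and> k < n then - nc x k else if k = n then - pc x k else nc x k)"
proof -
  obtain m where n: "n = Suc m" using i by (cases n) auto
  have im: "i \<le> m" using i n by simp
  have m1: "1 \<le> m" using i n by simp
  show ?thesis
    using im i(1)
  proof (induction i arbitrary: x k rule: inc_induct)
    case base
    have "X m = refl_op (int m) (if u = 1 then int (Suc m) else - int (Suc m)) \<circ> refl_op (int m) (if v = 1 then int (Suc m) else - int (Suc m))"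
      by (auto simp: X_def n)
    then show ?case using uv refl_op_succ[OF m1] refl_op_spin[OF m1] by (auto simp: n)
  next
    case (step k0)
    have l: "[Suc k0..<n] = Suc k0 # [Suc (Suc k0)..<n]" using step n by (intro upt_conv_Cons) auto
    have "X k0 = refl_op (int k0) (int (Suc k0)) \<circ> (X (Suc k0) \<circ> refl_op (int k0) (int (Suc k0)))"
      unfolding X_def l by (simp add: word_refl_append comp_assoc add.commute)
    then have X: "X k0 x = refl_op (int k0) (int (Suc k0)) (X (Suc k0) (refl_op (int k0) (int (Suc k0)) x))" by simp
    have "(-1 :: real) ^ (n - k0) = - ((-1) ^ (n - Suc k0))"
      using step n by (simp add: Suc_diff_le)
    then show ?case
      unfolding X using step refl_op_succ[of k0] n by auto
  qed
qed

section \<open>The remaining rows and the lift of the longest element\<close>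

definition tail_word :: "nat \<Rightarrow> rarray \<Rightarrow> rarray \<Rightarrow> nat \<Rightarrow> (real \<times> node) list" where
  "tail_word n t s i = concat (map (row_word n t s) (rev [i..<n]))"

lemma tail_word_top: "tail_word n t s n = []"
  by (simp add: tail_word_def)

lemma tail_word_step: "i < n \<Longrightarrow> tail_word n t s i = tail_word n t s (Suc i) @ row_word n t s i"
  by (simp add: tail_word_def upt_conv_Cons)

lemma full_word_tail: "full_word n t s = tail_word n t s 1"
  by (simp add: full_word_def tail_word_def)

lemma word_refl_tail:
  assumes "i \<le> n" "1 \<le> i"
  shows "word_refl n (tail_word n t s i) x = weyl_op n i x"
  using assms
proof (induction i arbitrary: x rule: inc_induct)
  case base
  show ?case by (rule pc_nc_eqI) (auto simp: tail_word_top weyl_op_pc weyl_op_nc)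
next
  case (step k)
  let ?r = "word_refl n (row_word n t s k) x"
  have s: "(-1 :: real) ^ (n - k) = - ((-1) ^ (n - Suc k))" "odd (n - k) \<longleftrightarrow> even (n - Suc k)"
  proof -
    have "n - k = Suc (n - Suc k)" using step by simp
    then show "(-1 :: real) ^ (n - k) = - ((-1) ^ (n - Suc k))" "odd (n - k) \<longleftrightarrow> even (n - Suc k)" by simp_all
  qed
  have uv: "(sgn_pow (n - k) = 1 \<and> sgn_pow (n - k + 1) \<noteq> 1) \<or> (sgn_pow (n - k) \<noteq> 1 \<and> sgn_pow (n - k + 1) = 1)"
    by (auto simp: sgn_pow_eq)
  have r: "row_word n t s k = map (\<lambda>j. (s (k, j), Lin (j - 1))) [Suc k..<n]
     @ [(s (k, n), Spin (sgn_pow (n - k))), (t (k, n), Spin (sgn_pow (n - k + 1)))]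
     @ map (\<lambda>j. (t (k, j), Lin (j - 1))) (rev [Suc k..<n])"
    by (simp add: row_word_def)
  note R = word_refl_row[OF \<open>1 \<le> k\<close> \<open>k < n\<close> uv, where f = "\<lambda>j. s (k, j)" and a = "s (k, n)" and b = "t (k, n)" and h = "\<lambda>j. t (k, j)" and x = x, folded r]
  have "word_refl n (tail_word n t s k) x = weyl_op n (Suc k) ?r"
    using step by (simp add: tail_word_step word_refl_append)
  also have "\<dots> = weyl_op n k x"
    by (rule pc_nc_eqI) (use R s step in \<open>auto simp: weyl_op_pc weyl_op_nc\<close>)
  finally show ?case .
qed

text \<open>Counted from the last row, because row 1 acts first and the factorization is proved by
  peeling off the row which acts first.\<close>

primrec rows :: "nat \<Rightarrow> rarray \<Rightarrow> rarray \<Rightarrow> nat \<Rightarrow> (int \<Rightarrow> real) \<Rightarrow> int \<Rightarrow> real" where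
  "rows n g d 0 = id"
| "rows n g d (Suc m) = rows n g d m \<circ> row_op n (\<lambda>j. g (n - Suc m, j)) (\<lambda>j. d (n - Suc m, j)) (n - Suc m)"

lemma word_op_tail:
  "m < n \<Longrightarrow> word_op n (tail_word n t s (n - m)) = rows n (gpart n t s) (dpart n t s) m"
proof (induction m)
  case 0 then show ?case by (simp add: tail_word_top)
next
  case (Suc m)
  have "Suc (n - Suc m) = n - m" using Suc.prems by simp
  then show ?case
    using Suc tail_word_step[of "n - Suc m" n t s] word_op_row[of "n - Suc m" n t s] by (simp add: word_op_append)
qed

section \<open>Moving torus elements across the rows\<close>

lemma torus_op_pc: "pc (torus_op n T x) k = (if 1 \<le> k \<and> k \<le> n then T k * pc x k else pc x k)"
  and torus_op_nc: "nc (torus_op n T x) k = (if 1 \<le> k \<and> k \<le> n then inverse (T k) * nc x k else nc x k)"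
  by (auto simp: pc_def nc_def torus_op_def valid_def torus_val_def)

lemma torus_op_one: "(\<And>k. 1 \<le> k \<Longrightarrow> k \<le> n \<Longrightarrow> T k = 1) \<Longrightarrow> torus_op n T x = x"
  by (rule pc_nc_eqI) (auto simp: torus_op_pc torus_op_nc)

lemma row_op_torus:
  assumes i: "1 \<le> i" "i < n" and T: "\<And>l. l \<in> {1..n} \<Longrightarrow> T l \<noteq> 0"
  shows "row_op n g d i (torus_op n T x)
    = torus_op n T (row_op n (\<lambda>j. g j * (T j / T (j - 1))) (\<lambda>j. d j * (if j = n then 1 / (T n * T (n - 1)) else T j / T (j - 1))) i x)"
proof -
  have succ: "elem_op (int a) (int (Suc a)) c (torus_op n T x) = torus_op n T (elem_op (int a) (int (Suc a)) (c * (T (Suc a) / T a)) x)"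
    if "1 \<le> a" "a < n" for a c x
    using elem_torus_commute[of n "int a" "int (Suc a)" T c x] that T
    by (simp add: root_pair_def valid_def torus_val_def nat_add_distrib)
  have spin: "elem_op (int (n - 1)) (- int n) c (torus_op n T x) = torus_op n T (elem_op (int (n - 1)) (- int n) (c * (1 / (T n * T (n - 1)))) x)" for c x
    using elem_torus_commute[of n "int (n - 1)" "- int n" T c x] i T
    by (simp add: root_pair_def valid_def torus_val_def of_nat_diff nat_diff_distrib divide_inverse)
  have low: "low_chain f i m (torus_op n T x) = torus_op n T (low_chain (\<lambda>j. f j * (T j / T (j - 1))) i m x)"
    if "i + m < n" for f m x
    using that by (induction m) (use i succ in \<open>auto simp del: of_nat_Suc of_nat_add\<close>)
  have up: "up_chain f i m (torus_op n T x) = torus_op n T (up_chain (\<lambda>j. f j * (T j / T (j - 1))) i m x)"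
    if "i + m < n" for f m x
    using that by (induction m arbitrary: x) (use i succ in \<open>auto simp del: of_nat_Suc of_nat_add\<close>)
  have "int n = int (Suc (n - 1))" using i by simp
  then have succn: "elem_op (int (n - 1)) (int n) c (torus_op n T x) = torus_op n T (elem_op (int (n - 1)) (int n) (c * (T n / T (n - 1))) x)" for c x
    using succ[of "n - 1" c x] i by simp
  have E: "up_chain (\<lambda>j. d j * (if j = n then 1 / (T n * T (n - 1)) else T j / T (j - 1))) i (n - 1 - i)
      = up_chain (\<lambda>j. d j * (T j / T (j - 1))) i (n - 1 - i)"
    using i by (intro up_chain_cong) auto
  have l: "i + (n - 1 - i) < n" using i by simp
  show ?thesis
    by (simp only: row_op_def o_apply low[OF l] up[OF l] spin succn E if_True refl)
qed

text \<open>If A, B are the accumulated entries at n and n - 1, the parameters moved across row i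
  are G = g A / B and D = d / (A B). The new entry at n is A D / G = d / (g A), hence the
  reciprocal. Rows start at 1, so the values at 0 and 1 are trivial.\<close>

primrec acc_last :: "nat \<Rightarrow> rarray \<Rightarrow> rarray \<Rightarrow> nat \<Rightarrow> real" where
  "acc_last n g d 0 = 1"
| "acc_last n g d (Suc i) = (if i = 0 then 1 else d (i, n) / (g (i, n) * acc_last n g d i))"

text \<open>\<open>acc n g d i\<close> is the torus element accumulated from the rows before \<open>i\<close>, and \<open>gtil\<close>, \<open>dtil\<close> are
  the parameters after moving it across the row.\<close>

definition acc :: "nat \<Rightarrow> rarray \<Rightarrow> rarray \<Rightarrow> nat \<Rightarrow> nat \<Rightarrow> real" where
  "acc n g d i l = (if l = n then acc_last n g d i else (\<Prod>r\<in>{1..<i}. g (r, l) / d (r, l)))"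

definition gtil :: "nat \<Rightarrow> rarray \<Rightarrow> rarray \<Rightarrow> rarray" where
  "gtil n g d = (\<lambda>(i, l). g (i, l) * (acc n g d i l / acc n g d i (l - 1)))"

definition dtil :: "nat \<Rightarrow> rarray \<Rightarrow> rarray \<Rightarrow> rarray" where
  "dtil n g d = (\<lambda>(i, l). d (i, l) * (if l = n then 1 / (acc n g d i n * acc n g d i (n - 1))
     else acc n g d i l / acc n g d i (l - 1)))"

text \<open>Row k is the last one to change entry k, by the product occurring in
  \<open>row_identity\<close>.\<close>

definition fin_torus :: "nat \<Rightarrow> rarray \<Rightarrow> rarray \<Rightarrow> nat \<Rightarrow> real" where
  "fin_torus n g d k = acc n g d k k * (\<Prod>l\<in>{k<..n}. gtil n g d (k, l) * dtil n g d (k, l))"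

definition p_g :: "nat \<Rightarrow> rarray \<Rightarrow> rarray \<Rightarrow> rarray" where
  "p_g n g d = (\<lambda>(i, l). row_g n i (\<lambda>j. gtil n g d (i, j)) (\<lambda>j. dtil n g d (i, j)) l)"

definition p_d :: "nat \<Rightarrow> rarray \<Rightarrow> rarray \<Rightarrow> rarray" where
  "p_d n g d = (\<lambda>(i, l). row_d n i (\<lambda>j. gtil n g d (i, j)) (\<lambda>j. dtil n g d (i, j)) l)"

text \<open>Interpolates between the trivial torus element for i = 1 and \<open>fin_torus\<close>
  for i = n: rows before i have completed their own entries.\<close>

definition stage_torus :: "nat \<Rightarrow> rarray \<Rightarrow> rarray \<Rightarrow> nat \<Rightarrow> nat \<Rightarrow> real" where
  "stage_torus n g d i k = (if k < i then fin_torus n g d k else acc n g d i k)"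

text \<open>The outcome of \<open>row_identity\<close> in a form stable under later rows. These
  neither read nor change the coordinates \<open>i\<close> and \<open>- i\<close>, so the unknown
  coordinate at \<open>- i\<close> cannot spread.\<close>

definition agree :: "nat \<Rightarrow> (int \<Rightarrow> real) \<Rightarrow> (int \<Rightarrow> real) \<Rightarrow> bool" where
  "agree i u v \<longleftrightarrow> (\<forall>k\<le>i. pc u k = pc v k) \<and> (pc v i = 0 \<longrightarrow> (\<forall>k. pc u k = pc v k) \<and> (\<forall>k. k \<noteq> i \<longrightarrow> nc u k = nc v k))"

lemma agree_succ: "agree i u v \<Longrightarrow> i < a \<Longrightarrow> agree i (elem_op (int a) (int (Suc a)) c u) (elem_op (int a) (int (Suc a)) c v)"
  unfolding agree_def by (auto simp: elem_op_succ simp del: of_nat_Suc)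

lemma agree_spin: "agree i u v \<Longrightarrow> i < a \<Longrightarrow> agree i (elem_op (int a) (- int (Suc a)) c u) (elem_op (int a) (- int (Suc a)) c v)"
  unfolding agree_def by (auto simp: elem_op_spin simp del: of_nat_Suc)

lemma agree_row:
  assumes "agree i u v" "i < r" "r < n"
  shows "agree i (row_op n g d r u) (row_op n g d r v)"
proof -
  have low: "agree i (low_chain f r m u) (low_chain f r m v)" if "agree i u v" for f m u v
    using that by (induction m) (use assms(2) in \<open>auto intro!: agree_succ simp del: of_nat_Suc of_nat_add\<close>)
  have up: "agree i (up_chain f r m u) (up_chain f r m v)" if "agree i u v" for f m u v
    using that
  proof (induction m arbitrary: u v)
    case (Suc m)
    show ?case
      using Suc.IH[OF agree_succ[OF Suc.prems, of "r + m" "f (Suc (r + m))"]] assms(2) by simp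
  qed simp
  obtain m where n: "n = Suc m" "i < m" using assms by (cases n) auto
  show ?thesis
    using low[OF assms(1), of g "n - 1 - r"] n unfolding row_op_def
    by (auto intro!: up agree_succ agree_spin simp del: of_nat_Suc)
qed

lemma agree_rows: "agree i u v \<Longrightarrow> m + i < n \<Longrightarrow> agree i (rows n g d m u) (rows n g d m v)"
proof (induction m arbitrary: u v)
  case (Suc m)
  show ?case
    using Suc.IH[OF agree_row[OF Suc.prems(1), of "n - Suc m" n]] Suc.prems(2) by simp
qed simp

context
  fixes n :: nat and g d :: rarray
  assumes n: "n \<ge> 2" and pos: "positive_array n g" "positive_array n d"
begin

lemma gd_pos: "1 \<le> i \<Longrightarrow> i < j \<Longrightarrow> j \<le> n \<Longrightarrow> g (i, j) > 0" "1 \<le> i \<Longrightarrow> i < j \<Longrightarrow> j \<le> n \<Longrightarrow> d (i, j) > 0"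
  using pos by (auto simp: positive_array_def idx_def)

lemma acc_last_pos: "i \<le> n \<Longrightarrow> acc_last n g d i > 0"
  by (induction i) (auto simp: gd_pos)

lemma acc_pos: "i \<le> l \<Longrightarrow> l \<le> n \<Longrightarrow> acc n g d i l > 0"
  by (auto simp: acc_def acc_last_pos gd_pos intro!: prod_pos)

lemma til_pos:
  assumes "1 \<le> i" "i < l" "l \<le> n"
  shows "gtil n g d (i, l) > 0" "dtil n g d (i, l) > 0"
proof -
  have "acc n g d i l > 0" "acc n g d i (l - 1) > 0" "acc n g d i (n - 1) > 0"
    using assms by (auto intro!: acc_pos)
  then show "gtil n g d (i, l) > 0" "dtil n g d (i, l) > 0"
    using gd_pos[OF assms] assms by (auto simp: gtil_def dtil_def)
qed

lemma fin_torus_pos: "1 \<le> k \<Longrightarrow> k \<le> n \<Longrightarrow> fin_torus n g d k > 0"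
  by (auto simp: fin_torus_def til_pos acc_pos intro!: mult_pos_pos prod_pos)

lemma stage_torus_pos: "k \<in> {1..n} \<Longrightarrow> stage_torus n g d i k > 0" if "i \<le> n"
  using that by (auto simp: stage_torus_def fin_torus_pos acc_pos)

lemma row_rho_pos: "1 \<le> i \<Longrightarrow> i \<le> k \<Longrightarrow> k \<le> n \<Longrightarrow> row_rho n i (\<lambda>j. gtil n g d (i, j)) (\<lambda>j. dtil n g d (i, j)) k > 0"
  using til_pos[of i k] by (auto simp: row_rho_def intro!: add_pos_pos)

lemma p_pos: "positive_array n (p_g n g d)" "positive_array n (p_d n g d)"
  using row_rho_pos til_pos
  by (auto simp: positive_array_def idx_def p_g_def p_d_def row_g_def row_d_def intro!: divide_pos_pos mult_pos_pos)

text \<open>Induction on the number of remaining rows, generalized by the torus accumulated so far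
  and the longest element on the remaining coordinates. The torus is moved across the row acting
  first, \<open>row_identity\<close> compares the two sides, and \<open>agree\<close> carries the
  comparison through the later rows to the induction hypothesis.\<close>

lemma tri_rel_rows:
  assumes "m < n"
  shows "tri_rel n (torus_op n (fin_torus n g d) (rows n (p_g n g d) (p_d n g d) m x))
    (rows n (\<lambda>p. - g p) (\<lambda>p. - d p) m (torus_op n (stage_torus n g d (n - m)) (weyl_op n (n - m) x)))"
  using assms
proof (induction m arbitrary: x)
  case 0
  have "weyl_op n n x = x" by (rule pc_nc_eqI) (auto simp: weyl_op_pc weyl_op_nc)
  moreover have "torus_op n (stage_torus n g d n) x = torus_op n (fin_torus n g d) x"
    by (rule pc_nc_eqI) (auto simp: torus_op_pc torus_op_nc stage_torus_def fin_torus_def)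
  ultimately show ?case by (simp add: tri_rel_def)
next
  case (Suc m)
  define i where "i = n - Suc m"
  have i: "1 \<le> i" "i < n" "n - m = Suc i" "m + i < n" using Suc.prems by (auto simp: i_def)
  define G D where "G j = gtil n g d (i, j)" and "D j = dtil n g d (i, j)" for j
  define z where "z = row_op n (row_g n i G D) (row_d n i G D) i x"
  define z' where "z' = row_op n (\<lambda>j. - G j) (\<lambda>j. - D j) i (weyl_op n i x)"
  define w where "w = weyl_op n (Suc i) z"
  have GD: "G j > 0" "D j > 0" if "i < j" "j \<le> n" for j
    using til_pos[OF i(1) that] by (auto simp: G_def D_def)
  define A where "A = stage_torus n g d i"
  define A' where "A' = stage_torus n g d (Suc i)"
  have A0: "A l > 0" "A' l > 0" if "l \<in> {1..n}" for l
    using stage_torus_pos that i unfolding A_def A'_def by auto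
  have row: "row_op n (\<lambda>j. - g (i, j)) (\<lambda>j. - d (i, j)) i (torus_op n A (weyl_op n i x)) = torus_op n A z'"
  proof -
    have nz: "A l \<noteq> 0" if "l \<in> {1..n}" for l using A0(1)[OF that] by simp
    have e1: "low_chain (\<lambda>j. - g (i, j) * (A j / A (j - 1))) i (n - 1 - i) = low_chain (\<lambda>j. - G j) i (n - 1 - i)"
      using i by (intro low_chain_cong) (auto simp: G_def gtil_def A_def stage_torus_def)
    have e2: "up_chain (\<lambda>j. - d (i, j) * (if j = n then 1 / (A n * A (n - 1)) else A j / A (j - 1))) i (n - 1 - i) = up_chain (\<lambda>j. - D j) i (n - 1 - i)"
      using i by (intro up_chain_cong) (auto simp: D_def dtil_def A_def stage_torus_def)
    have e3: "- g (i, n) * (A n / A (n - 1)) = - G n" "- d (i, n) * (1 / (A n * A (n - 1))) = - D n"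
      using i by (auto simp: G_def gtil_def D_def dtil_def A_def stage_torus_def)
    show ?thesis
      unfolding z'_def
      by (subst row_op_torus[OF i(1,2) nz]) (assumption, simp only: row_op_def o_apply e1 e2 e3 if_True refl)
  qed
  define U where "U = rows n (\<lambda>p. - g p) (\<lambda>p. - d p) m (torus_op n A z')"
  define U2 where "U2 = rows n (\<lambda>p. - g p) (\<lambda>p. - d p) m (torus_op n A' w)"
  define V where "V = torus_op n (fin_torus n g d) (rows n (p_g n g d) (p_d n g d) m z)"
  have IH: "tri_rel n V U2"
    using Suc.IH[of z] Suc.prems i by (simp add: V_def U2_def w_def A'_def)
  obtain m' where m': "n = Suc m'" "i \<le> m'" using i by (cases n) auto
  note RI0 = row_identity[OF i(1) m'(2,1), where g = G and d = D and x = x, folded z_def z'_def, folded w_def]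
  have RI1: "pc z' i = (\<Prod>j\<in>{i<..n}. G j * D j) * pc w i"
    by (rule RI0(1)) (simp_all add: GD)
  have RI2: "pc z' k = (G k / D k) * pc w k \<and> nc z' k = (D k / G k) * nc w k" if "pc z i = 0" "i < k" "k < n" for k
    by (rule RI0(2)) (simp_all add: GD that)
  have RI3: "pc z' n = (D n / G n) * pc w n \<and> nc z' n = (G n / D n) * nc w n" if "pc z i = 0"
    by (rule RI0(3)) (simp_all add: GD that)
  have RI4: "pc z' k = pc w k \<and> nc z' k = nc w k" if "k < i \<or> n < k" for k
    by (rule RI0(4)) (simp_all add: GD that)
  have RI5: "pc w i = pc z i"
    by (rule RI0(5)) (simp_all add: GD)
  have Ai: "A i * (\<Prod>j\<in>{i<..n}. G j * D j) = A' i"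
    by (simp add: A_def A'_def stage_torus_def fin_torus_def G_def D_def)
  have Ak: "A k * (G k / D k) = A' k" if "i < k" "k < n" for k
  proof -
    have "acc n g d i k > 0" "acc n g d i (k - 1) > 0" using that by (auto intro!: acc_pos)
    then have "G k / D k = g (i, k) / d (i, k)" using that by (simp add: G_def D_def gtil_def dtil_def)
    moreover have "{1..<Suc i} = insert i {1..<i}" using i by auto
    ultimately show ?thesis using that by (simp add: A_def A'_def stage_torus_def acc_def)
  qed
  have An: "A n * (D n / G n) = A' n"
  proof -
    have "acc n g d i n > 0" "acc n g d i (n - 1) > 0" using i by (auto intro!: acc_pos)
    moreover have "acc n g d i n = acc_last n g d i" by (simp add: acc_def)
    ultimately show ?thesis
      using i gd_pos[of i n] by (simp add: A_def A'_def stage_torus_def G_def D_def gtil_def dtil_def acc_def field_simps)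
  qed
  have ag: "agree i (torus_op n A z') (torus_op n A' w)"
    unfolding agree_def
  proof (intro conjI allI impI)
    fix k assume "k \<le> i"
    then consider "k < i" | "k = i" by linarith
    then show "pc (torus_op n A z') k = pc (torus_op n A' w) k"
    proof cases
      case 1
      then have "A k = A' k" by (simp add: A_def A'_def stage_torus_def)
      with 1 RI4[of k] show ?thesis by (simp add: torus_op_pc)
    next
      case 2
      then show ?thesis using i RI1 by (simp add: torus_op_pc flip: Ai)
    qed
  next
    assume "pc (torus_op n A' w) i = 0"
    then have z0: "pc z i = 0" using A0(2)[of i] i RI5 by (simp add: torus_op_pc)
    show pck: "pc (torus_op n A z') k = pc (torus_op n A' w) k" for k
    proof -
      consider "k < i" | "k = i" | "i < k" "k < n" | "k = n" | "n < k" by linarith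
      then show ?thesis
      proof cases
        case 1
        then have "A k = A' k" by (simp add: A_def A'_def stage_torus_def)
        with 1 RI4[of k] show ?thesis by (simp add: torus_op_pc)
      next
        case 2 then show ?thesis using i RI1 by (simp add: torus_op_pc flip: Ai)
      next
        case 3 then show ?thesis using i RI2[OF z0, of k] by (simp add: torus_op_pc flip: Ak)
      next
        case 4 then show ?thesis using i RI3[OF z0] by (simp add: torus_op_pc flip: An)
      next
        case 5 then show ?thesis using RI4[of k] by (simp add: torus_op_pc)
      qed
    qed
    show "nc (torus_op n A z') k = nc (torus_op n A' w) k" if ki: "k \<noteq> i" for k
    proof -
      consider "k < i" | "i < k" "k < n" | "k = n" | "n < k" using ki by linarith
      then show ?thesis
      proof cases
        case 1
        then have "A k = A' k" by (simp add: A_def A'_def stage_torus_def)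
        with 1 RI4[of k] show ?thesis by (simp add: torus_op_nc)
      next
        case 2 then show ?thesis using i RI2[OF z0, of k] by (simp add: torus_op_nc divide_inverse mult_ac flip: Ak)
      next
        case 3 then show ?thesis using i RI3[OF z0] by (simp add: torus_op_nc divide_inverse mult_ac flip: An)
      next
        case 4 then show ?thesis using RI4[of k] by (simp add: torus_op_nc)
      qed
    qed
  qed
  have agU: "agree i U U2"
    unfolding U_def U2_def using ag i(4) by (rule agree_rows)
  have "tri_rel n V U"
    unfolding tri_rel_def
  proof (intro ballI impI)
    fix k assume k: "k \<in> {1..n}" and V0: "\<forall>l\<in>{1..<k}. V (int l) = 0"
    have U2k: "pc U2 k = pc V k" using IH k V0 by (simp add: tri_rel_def pc_def)
    have "pc U k = pc U2 k"
    proof (cases "k \<le> i")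
      case True then show ?thesis using agU by (simp add: agree_def)
    next
      case False
      \<comment> \<open>For k > i the coordinates of \<open>V\<close> assumed to vanish include the
        one at i, which puts the row comparison on its hyperplane.\<close>
      then have "pc U2 i = V (int i)" using IH i V0 by (auto simp: tri_rel_def pc_def)
      also have "\<dots> = 0" using False i V0 by simp
      finally show ?thesis using agU by (simp add: agree_def)
    qed
    then show "U (int k) = V (int k)" using U2k by (simp add: pc_def)
  qed
  moreover have "rows n (\<lambda>p. - g p) (\<lambda>p. - d p) (Suc m) (torus_op n (stage_torus n g d (n - Suc m)) (weyl_op n (n - Suc m) x)) = U"
    using row by (simp add: U_def i_def A_def)
  moreover have "torus_op n (fin_torus n g d) (rows n (p_g n g d) (p_d n g d) (Suc m) x) = V"
    by (simp add: V_def z_def p_g_def p_d_def i_def G_def[abs_def] D_def[abs_def])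
  ultimately show ?case by simp
qed

lemma left_whittaker_formula:
  "left_whittaker n nu (X_mat n (gpart n g d) (dpart n g d))
    = torus_char n nu (fin_torus n g d) * exp_char n (p_g n g d) (p_d n g d)"
proof -
  let ?t = "gpart n g d" and ?s = "dpart n g d"
  let ?p = "gpart n (p_g n g d) (p_d n g d)" and ?q = "dpart n (p_g n g d) (p_d n g d)"
  have neg: "gpart n (\<lambda>r. - ?t r) (\<lambda>r. - ?s r) = (\<lambda>p. - g p)" "dpart n (\<lambda>r. - ?t r) (\<lambda>r. - ?s r) = (\<lambda>p. - d p)"
    by (auto simp: gpart_def dpart_def)
  have n1: "n - 1 < n" "n - (n - 1) = 1" using n by auto
  have T1: "stage_torus n g d 1 k = 1" if "1 \<le> k" "k \<le> n" for k
    using that by (auto simp: stage_torus_def acc_def)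
  have T: "positive_torus n (fin_torus n g d)" using fin_torus_pos by (auto simp: positive_torus_def)
  have tri: "tri_rel n (torus_op n (fin_torus n g d) (word_op n (full_word n ?p ?q) x))
        (word_op n (full_word n (\<lambda>r. - ?t r) (\<lambda>r. - ?s r)) (word_refl n (full_word n (\<lambda>_. 1) (\<lambda>_. 1)) x))" for x
    using tri_rel_rows[OF n1(1), of x] word_op_tail[OF n1(1)] word_refl_tail[of 1 n] n
    by (simp add: full_word_tail n1(2)[unfolded One_nat_def] neg torus_op_one[OF T1[unfolded One_nat_def]])
  obtain Y where Y: "Y \<in> lower_unipotent n"
    "X_mat n (\<lambda>r. - ?t r) (\<lambda>r. - ?s r) * w0_lift n = Y * torus_mat n (fin_torus n g d) * X_mat n ?p ?q"
    using factorization_if_tri_rel[OF n T tri] by blast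
  have "left_whittaker n nu (X_mat n ?t ?s) = torus_char n nu (fin_torus n g d) * exp_char n ?p ?q"
    using pos p_pos fin_torus_pos
    by (intro left_whittaker_eq[OF n _ _ Y(1) _ _ _ Y(2)])
       (auto simp: positive_array_def positive_torus_def gpart_def dpart_def)
  also have "exp_char n ?p ?q = exp_char n (p_g n g d) (p_d n g d)"
    unfolding exp_char_def by (intro arg_cong[where f = "\<lambda>x. of_real (exp (- x))"] sum.cong) (auto simp: gpart_def dpart_def)
  finally show ?thesis .
qed

end

section \<open>Decoupling of the integral\<close>

type_synonym slot = "(nat \<times> nat) \<times> bool"

definition slots :: "nat \<Rightarrow> slot set" where
  "slots n = idx n \<times> UNIV"

lemma finite_slots [simp]: "finite (slots n)"
  by (simp add: slots_def)

lemma mem_slots [simp]: "(p, b) \<in> slots n \<longleftrightarrow> p \<in> idx n"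
  by (simp add: slots_def)

lemma prod_slots: "(\<Prod>k\<in>slots n. f k) = (\<Prod>p\<in>idx n. f (p, False) * f (p, True))"
  unfolding slots_def using prod.cartesian_product[of "\<lambda>p b. f (p, b)" UNIV "idx n"] by (simp add: UNIV_bool)

lemma sum_slots: "(\<Sum>k\<in>slots n. f k) = (\<Sum>p\<in>idx n. f (p, False) + f (p, True))"
  unfolding slots_def using sum.cartesian_product[of "\<lambda>p b. f (p, b)" UNIV "idx n"] by (simp add: UNIV_bool)

text \<open>The minus sign turns exp (- g) into exp (- exp (- y)), the form to which
  \<open>mellin_inversion_exp\<close> applies.\<close>

definition g_of :: "(slot \<Rightarrow> real) \<Rightarrow> rarray" where "g_of y p = exp (- y (p, False))"
definition d_of :: "(slot \<Rightarrow> real) \<Rightarrow> rarray" where "d_of y p = exp (- y (p, True))"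

primrec lacc_last :: "nat \<Rightarrow> (slot \<Rightarrow> real) \<Rightarrow> nat \<Rightarrow> real" where
  "lacc_last n y 0 = 0"
| "lacc_last n y (Suc i) = (if i = 0 then 0 else y ((i, n), False) - y ((i, n), True) - lacc_last n y i)"

definition lacc :: "nat \<Rightarrow> (slot \<Rightarrow> real) \<Rightarrow> nat \<Rightarrow> nat \<Rightarrow> real" where
  "lacc n y i l = (if l = n then lacc_last n y i else (\<Sum>r\<in>{1..<i}. y ((r, l), True) - y ((r, l), False)))"

text \<open>Minus the logarithm of \<open>gtil\<close> (see \<open>gtil_exp\<close>); it is linear
  in \<open>y\<close>, and its corrections involve earlier rows only.\<close>

definition lg :: "nat \<Rightarrow> (slot \<Rightarrow> real) \<Rightarrow> rarray" where
  "lg n y = (\<lambda>(i, l). y ((i, l), False) + (lacc n y i (l - 1) - lacc n y i l))"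

definition ld :: "nat \<Rightarrow> (slot \<Rightarrow> real) \<Rightarrow> rarray" where
  "ld n y = (\<lambda>(i, l). y ((i, l), True)
     + (if l = n then lacc n y i (n - 1) + lacc n y i n else lacc n y i (l - 1) - lacc n y i l))"

lemma acc_exp: "acc n (g_of y) (d_of y) i l = exp (lacc n y i l)"
proof -
  have "acc_last n (g_of y) (d_of y) i = exp (lacc_last n y i)"
    by (induction i) (auto simp: g_of_def d_of_def exp_diff exp_minus exp_add field_simps)
  moreover have "(\<Prod>r\<in>{1..<i}. g_of y (r, l) / d_of y (r, l)) = exp (\<Sum>r\<in>{1..<i}. y ((r, l), True) - y ((r, l), False))"
    unfolding exp_sum[OF finite_atLeastLessThan]
    by (intro prod.cong refl) (simp add: g_of_def d_of_def exp_diff exp_minus field_simps)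
  ultimately show ?thesis by (simp add: acc_def lacc_def)
qed

lemma gtil_exp: "gtil n (g_of y) (d_of y) p = exp (- lg n y p)"
  by (cases p) (simp add: gtil_def lg_def acc_exp g_of_def exp_add exp_diff exp_minus field_simps)

lemma dtil_exp: "dtil n (g_of y) (d_of y) p = exp (- ld n y p)"
  by (cases p) (simp add: dtil_def ld_def acc_exp d_of_def exp_add exp_diff exp_minus field_simps)

lemma fin_torus_exp:
  "fin_torus n (g_of y) (d_of y) k = exp (lacc n y k k - (\<Sum>l\<in>{k<..n}. lg n y (k, l) + ld n y (k, l)))"
proof -
  have "(\<Prod>l\<in>{k<..n}. exp (- lg n y (k, l)) * exp (- ld n y (k, l))) = exp (- (\<Sum>l\<in>{k<..n}. lg n y (k, l) + ld n y (k, l)))"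
    unfolding sum_negf[symmetric] exp_sum[OF finite_greaterThanAtMost]
    by (intro prod.cong refl) (simp add: exp_add[symmetric])
  then show ?thesis
    by (simp only: fin_torus_def acc_exp gtil_exp dtil_exp exp_add[symmetric] diff_conv_add_uminus)
qed

text \<open>The last three shears of the change of variables; \<open>acoord\<close> and \<open>ccoord\<close> are the coordinates
  in which the exponent becomes a sum of exponentials of single variables.\<close>

definition rcoord :: "nat \<Rightarrow> (slot \<Rightarrow> real) \<Rightarrow> nat \<Rightarrow> real" where
  "rcoord n y i = ld n y (i, n) - lg n y (i, n)"

definition acoord :: "nat \<Rightarrow> (slot \<Rightarrow> real) \<Rightarrow> rarray" where
  "acoord n y = (\<lambda>(i, l). lg n y (i, l) + (if l = n then softplus (rcoord n y i) else 0))"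

definition ccoord :: "nat \<Rightarrow> (slot \<Rightarrow> real) \<Rightarrow> rarray" where
  "ccoord n y = (\<lambda>(i, l). if l = n then rcoord n y i else ld n y (i, l) - lg n y (i, l) + acoord n y (i, Suc l))"

definition new_coord :: "nat \<Rightarrow> (slot \<Rightarrow> real) \<Rightarrow> slot \<Rightarrow> real" where
  "new_coord n y = (\<lambda>k\<in>slots n. if snd k then ccoord n y (fst k) else acoord n y (fst k))"

text \<open>The swap by parity disappears in the sum, which is rho (l - 1) (1/G + 1/D) / rho l. For
  l < n the value of rho reduces the quotient to 1/G; in the last column two exponentials remain and
  are merged by \<open>softplus\<close>. The factor rho (l - 1) contributes the second
  exponential.\<close>

lemma p_sum_exp:
  assumes "(i, l) \<in> idx n"
  shows "p_g n (g_of y) (d_of y) (i, l) + p_d n (g_of y) (d_of y) (i, l)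
    = exp (acoord n y (i, l)) + (if l = Suc i then 0 else exp (ccoord n y (i, l - 1)))"
proof -
  have il: "1 \<le> i" "i < l" "l \<le> n" using assms by (auto simp: idx_def)
  define G D where "G j = exp (- lg n y (i, j))" and "D j = exp (- ld n y (i, j))" for j
  define rho where "rho = row_rho n i G D"
  have GD: "G j > 0" "D j > 0" for j by (simp_all add: G_def D_def)
  have rho0: "rho j > 0" for j using GD by (auto simp: rho_def row_rho_def intro!: add_pos_pos)
  have "p_g n (g_of y) (d_of y) (i, l) + p_d n (g_of y) (d_of y) (i, l) = row_g n i G D l + row_d n i G D l"
    by (simp add: p_g_def p_d_def gtil_exp dtil_exp G_def[abs_def] D_def[abs_def])
  also have "\<dots> = rho (l - 1) * ((1 / G l + 1 / D l) / rho l)"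
    unfolding row_g_def row_d_def rho_def[symmetric]
  proof (cases "l = n \<and> odd (n - i)")
    case True
    show "rho (l - 1) / (rho l * (if l = n \<and> odd (n - i) then G l else D l)) + rho (l - 1) / (rho l * (if l = n \<and> odd (n - i) then D l else G l))
      = rho (l - 1) * ((1 / G l + 1 / D l) / rho l)"
      unfolding if_P[OF True] by (simp add: add_divide_distrib distrib_left mult.commute)
  next
    case False
    show "rho (l - 1) / (rho l * (if l = n \<and> odd (n - i) then G l else D l)) + rho (l - 1) / (rho l * (if l = n \<and> odd (n - i) then D l else G l))
      = rho (l - 1) * ((1 / G l + 1 / D l) / rho l)"
      unfolding if_not_P[OF False] by (simp add: add_divide_distrib distrib_left mult.commute add.commute)
  qed
  also have "(1 / G l + 1 / D l) / rho l = exp (acoord n y (i, l))"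
  proof (cases "l = n")
    case True
    have "exp (acoord n y (i, n)) = exp (lg n y (i, n)) * (1 + exp (rcoord n y i))"
      by (simp add: acoord_def exp_add exp_softplus)
    also have "\<dots> = exp (lg n y (i, n)) + exp (ld n y (i, n))"
      by (simp add: rcoord_def exp_diff distrib_left)
    finally show ?thesis using True by (simp add: rho_def row_rho_def G_def D_def exp_minus inverse_eq_divide)
  next
    case False
    then have "rho l = G l * (1 / G l + 1 / D l)"
      using il GD[of l] by (simp add: rho_def row_rho_def distrib_left)
    then have "(1 / G l + 1 / D l) / rho l = 1 / G l"
      using GD[of l] rho0[of l] by auto
    then show ?thesis using False by (simp add: acoord_def G_def exp_minus inverse_eq_divide)
  qed
  also have "rho (l - 1) * exp (acoord n y (i, l)) = exp (acoord n y (i, l)) + (if l = Suc i then 0 else exp (ccoord n y (i, l - 1)))"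
  proof (cases "l = Suc i")
    case True then show ?thesis by (simp add: rho_def row_rho_def)
  next
    case False
    then have l: "l - 1 \<noteq> i" "l - 1 \<noteq> n" "Suc (l - 1) = l" using il by auto
    have "rho (l - 1) = 1 + exp (ld n y (i, l - 1) - lg n y (i, l - 1))"
      using l by (simp add: rho_def row_rho_def G_def D_def exp_diff exp_minus field_simps)
    then show ?thesis using l False by (simp add: ccoord_def exp_add distrib_left distrib_right mult.commute)
  qed
  finally show ?thesis .
qed

section \<open>The change of variables preserves Lebesgue measure\<close>

lemma lacc_last_measurable: "i \<le> n \<Longrightarrow> (\<lambda>y. lacc_last n y i) \<in> borel_measurable (PiR (slots n))"
proof (induction i)
  case (Suc i)
  show ?case
  proof (cases "i = 0")
    case False
    then have "((i, n), False) \<in> slots n" "((i, n), True) \<in> slots n" using Suc.prems by (auto simp: idx_def)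
    moreover have "(\<lambda>y. lacc_last n y i) \<in> borel_measurable (PiR (slots n))" using Suc by simp
    ultimately show ?thesis using False by simp
  qed simp
qed simp

lemma lacc_measurable: "i \<le> l \<Longrightarrow> l \<le> n \<Longrightarrow> (\<lambda>y. lacc n y i l) \<in> borel_measurable (PiR (slots n))"
  unfolding lacc_def using lacc_last_measurable[of i n]
  by (cases "l = n") (auto intro!: borel_measurable_sum borel_measurable_diff measurable_component_singleton[where M = "\<lambda>_. lborel", simplified] simp: idx_def)

lemma lacc_cong:
  assumes "i \<le> l" "l \<le> n" "\<And>r b. 1 \<le> r \<Longrightarrow> r < i \<Longrightarrow> x ((r, l), b) = y ((r, l), b)"
  shows "lacc n x i l = lacc n y i l"
proof -
  have "lacc_last n x i = lacc_last n y i" if "\<And>r b. 1 \<le> r \<Longrightarrow> r < i \<Longrightarrow> x ((r, n), b) = y ((r, n), b)"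
    using that by (induction i) auto
  then show ?thesis using assms(3) by (auto simp: lacc_def intro!: sum.cong)
qed

lemma distr_comp:
  assumes "f \<in> measurable M M" "g \<in> measurable M M" "distr M M f = M" "distr M M g = M"
  shows "g \<circ> f \<in> measurable M M \<and> distr M M (g \<circ> f) = M"
  using assms distr_distr[OF assms(2,1)] measurable_comp[OF assms(1,2)] by simp

text \<open>A composition of three shears. \<open>C\<close> is triangular with respect to rows,
  since \<open>lacc\<close> at row i uses earlier rows; \<open>B\<close> takes the difference in the
  last column; \<open>A\<close> is triangular in the order: last-column \<open>d\<close> slots,
  \<open>g\<close> slots, remaining \<open>d\<close> slots.\<close>

lemma new_coord_preserving:
  "new_coord n \<in> measurable (PiR (slots n)) (PiR (slots n)) \<and> distr (PiR (slots n)) (PiR (slots n)) (new_coord n) = PiR (slots n)"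
proof -
  let ?M = "PiR (slots n)"
  define hC where "hC k y = (case k of ((i, l), b) \<Rightarrow> if b \<and> l = n then lacc n y i (n - 1) + lacc n y i n else lacc n y i (l - 1) - lacc n y i l)"
    for k :: slot and y
  define hB where "hB k y = (case k of ((i, l), b) \<Rightarrow> if b \<and> l = n then - y ((i, n), False) else 0)"
    for k :: slot and y :: "slot \<Rightarrow> real"
  define hA where "hA k y = (case k of ((i, l), b) \<Rightarrow>
     if b then (if l = n then 0 else y ((i, Suc l), False) - y ((i, l), False) + (if Suc l = n then softplus (y ((i, n), True)) else 0))
     else (if l = n then softplus (y ((i, n), True)) else 0))"
    for k :: slot and y :: "slot \<Rightarrow> real"
  define C where "C y = (\<lambda>k\<in>slots n. y k + hC k y)" for y
  define B where "B y = (\<lambda>k\<in>slots n. y k + hB k y)" for y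
  define A where "A y = (\<lambda>k\<in>slots n. y k + hA k y)" for y
  have comp: "(\<lambda>y. y k) \<in> borel_measurable ?M" if "k \<in> slots n" for k
    using measurable_component_singleton[OF that, of "\<lambda>_. lborel"] by simp
  have mC: "hC k \<in> borel_measurable ?M" if "k \<in> slots n" for k
  proof -
    obtain i l b where k: "k = ((i, l), b)" by (metis surj_pair)
    have il: "1 \<le> i" "i < l" "l \<le> n" using that by (auto simp: k idx_def)
    then show ?thesis unfolding hC_def k using lacc_measurable[of i "l - 1" n] lacc_measurable[of i l n] lacc_measurable[of i "n - 1" n] lacc_measurable[of i n n]
      by (cases "b \<and> l = n") auto
  qed
  have mB: "hB k \<in> borel_measurable ?M" if "k \<in> slots n" for k
  proof -
    obtain i l b where kk: "k = ((i, l), b)" by (metis surj_pair)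
    have "((i, n), False) \<in> slots n" using that by (auto simp: kk idx_def)
    from comp[OF this] show ?thesis unfolding hB_def kk by (cases "b \<and> l = n") auto
  qed
  have mA: "hA k \<in> borel_measurable ?M" if k: "k \<in> slots n" for k
  proof -
    obtain i l b where kk: "k = ((i, l), b)" by (metis surj_pair)
    have il: "1 \<le> i" "i < l" "l \<le> n" using k by (auto simp: kk idx_def)
    have s: "(\<lambda>y. softplus (y ((i, n), True))) \<in> borel_measurable ?M"
      using il by (intro measurable_compose[OF comp softplus_measurable]) (auto simp: idx_def)
    have c: "(\<lambda>y. y ((i, l), False)) \<in> borel_measurable ?M" using il by (intro comp) (auto simp: idx_def)
    have "(\<lambda>y. y ((i, Suc l), False)) \<in> borel_measurable ?M" if "l \<noteq> n" using il that by (intro comp) (auto simp: idx_def)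
    with s c show ?thesis unfolding hA_def kk by (cases b; cases "l = n"; cases "Suc l = n") auto
  qed
  have C: "C \<in> measurable ?M ?M" "distr ?M ?M C = ?M"
  proof -
    show "C \<in> measurable ?M ?M" unfolding C_def using mC comp by (intro measurable_restrict) auto
    show "distr ?M ?M C = ?M"
      unfolding C_def
    proof (rule distr_PiR_triangular[where r = "\<lambda>k. fst (fst k)"])
      fix k and x y :: "slot \<Rightarrow> real" assume k: "k \<in> slots n" and eq: "\<forall>j\<in>slots n. fst (fst j) < fst (fst k) \<longrightarrow> x j = y j"
      obtain i l b where kk: "k = ((i, l), b)" by (metis surj_pair)
      have il: "1 \<le> i" "i < l" "l \<le> n" using k by (auto simp: kk idx_def)
      have "lacc n x i l' = lacc n y i l'" if "i \<le> l'" "l' \<le> n" for l'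
        using that eq il by (intro lacc_cong) (auto simp: kk idx_def)
      then show "hC k x = hC k y" using il by (auto simp: hC_def kk)
    qed (use mC in auto)
  qed
  have B: "B \<in> measurable ?M ?M" "distr ?M ?M B = ?M"
  proof -
    show "B \<in> measurable ?M ?M" unfolding B_def using mB comp by (intro measurable_restrict) auto
    show "distr ?M ?M B = ?M"
      unfolding B_def
    proof (rule distr_PiR_triangular[where r = "\<lambda>k. if snd k \<and> snd (fst k) = n then 1 else 0"])
      fix k and x y :: "slot \<Rightarrow> real" assume k: "k \<in> slots n"
        and eq: "\<forall>j\<in>slots n. (if snd j \<and> snd (fst j) = n then 1 else 0) < (if snd k \<and> snd (fst k) = n then 1 else (0::nat)) \<longrightarrow> x j = y j"
      obtain i l b where kk: "k = ((i, l), b)" by (metis surj_pair)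
      have "((i, n), False) \<in> slots n" using k by (auto simp: kk idx_def)
      then have "x ((i, n), False) = y ((i, n), False)" if "b" "l = n" using eq that by (simp add: kk)
      then show "hB k x = hB k y" by (auto simp: hB_def kk)
    qed (use mB in auto)
  qed
  have A: "A \<in> measurable ?M ?M" "distr ?M ?M A = ?M"
  proof -
    show "A \<in> measurable ?M ?M" unfolding A_def using mA comp by (intro measurable_restrict) auto
    show "distr ?M ?M A = ?M"
      unfolding A_def
    proof (rule distr_PiR_triangular[where r = "\<lambda>k. if snd k then if snd (fst k) = n then 0 else 2 else 1"])
      fix k and x y :: "slot \<Rightarrow> real" assume k: "k \<in> slots n"
        and eq: "\<forall>j\<in>slots n. (if snd j then if snd (fst j) = n then 0 else 2 else 1) < (if snd k then if snd (fst k) = n then 0 else (2::nat) else 1) \<longrightarrow> x j = y j"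
      obtain i l b where kk: "k = ((i, l), b)" by (metis surj_pair)
      have il: "1 \<le> i" "i < l" "l \<le> n" using k by (auto simp: kk idx_def)
      have 1: "x ((i, n), True) = y ((i, n), True)" if "b \<longrightarrow> l \<noteq> n" using eq il that by (auto simp: kk idx_def)
      have 2: "x ((i, l'), False) = y ((i, l'), False)" if "b" "l \<noteq> n" "i < l'" "l' \<le> n" for l' using eq il that by (auto simp: kk idx_def)
      show "hA k x = hA k y" using 1 2[of l] 2[of "Suc l"] il by (auto simp: hA_def kk)
    qed (use mA in auto)
  qed
  have "new_coord n y = (A \<circ> (B \<circ> C)) y" for y
  proof
    fix k
    show "new_coord n y k = (A \<circ> (B \<circ> C)) y k"
    proof (cases "k \<in> slots n")
      case True
      obtain i l b where kk: "k = ((i, l), b)" by (metis surj_pair)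
      have il: "1 \<le> i" "i < l" "l \<le> n" using True by (auto simp: kk idx_def)
      have Cg: "C y ((i, l'), False) = lg n y (i, l')" and Cd: "C y ((i, l'), True) = ld n y (i, l')" if "i < l'" "l' \<le> n" for l'
        using that il by (auto simp: C_def hC_def lg_def ld_def idx_def)
      have Bg: "B (C y) ((i, l'), False) = lg n y (i, l')"
        and Bd: "B (C y) ((i, l'), True) = (if l' = n then rcoord n y i else ld n y (i, l'))" if "i < l'" "l' \<le> n" for l'
        using that il Cg[of l'] Cd[of l'] Cg[of n] Cd[of n] by (auto simp: B_def hB_def rcoord_def idx_def)
      show ?thesis
        using il Bg[of l] Bg[of "Suc l"] Bd[of l] Bd[of n] True
        by (auto simp: new_coord_def kk A_def hA_def acoord_def ccoord_def)
    next
      case False then show ?thesis by (simp add: new_coord_def A_def)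
    qed
  qed
  then have "new_coord n = A \<circ> (B \<circ> C)" by auto
  then show ?thesis using distr_comp[OF C(1) B(1) C(2) B(2)] distr_comp[of "B \<circ> C" ?M A] A by simp
qed

text \<open>The coefficient of \<open>acoord\<close> at (i, l): for i < l - 1, \<open>ld\<close> at
  (i, l - 1) equals \<open>ccoord\<close> plus \<open>lg\<close> at the same place minus
  \<open>acoord\<close> at (i, l), which removes the weight \<open>wd (i, l - 1)\<close>.\<close>

definition a_weight :: "(nat \<times> nat \<Rightarrow> complex) \<Rightarrow> (nat \<times> nat \<Rightarrow> complex) \<Rightarrow> nat \<times> nat \<Rightarrow> complex" where
  "a_weight wg wd = (\<lambda>(i, l). wg (i, l) + wd (i, l) - (if l = Suc i then 0 else wd (i, l - 1)))"

definition slot_exponent :: "nat \<Rightarrow> (nat \<times> nat \<Rightarrow> complex) \<Rightarrow> (nat \<times> nat \<Rightarrow> complex) \<Rightarrow> slot \<Rightarrow> real \<Rightarrow> complex" where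
  "slot_exponent n wg wd k u = (case k of (p, b) \<Rightarrow>
     if \<not> b then a_weight wg wd p * of_real u - of_real (exp u)
     else if snd p = n then wd p * of_real u - (wg p + wd p) * of_real (softplus u)
     else wd p * of_real u - of_real (exp u))"

text \<open>In each row the neighbour terms of \<open>ccoord\<close> and the second exponentials of
  \<open>p_sum_exp\<close> are shifted by one column; after this regrouping every term belongs to a
  single slot.\<close>

lemma slot_exponent_sum:
  "(\<Sum>k\<in>slots n. slot_exponent n wg wd k (new_coord n y k))
    = (\<Sum>p\<in>idx n. wg p * of_real (lg n y p) + wd p * of_real (ld n y p))
      - of_real (\<Sum>p\<in>idx n. p_g n (g_of y) (d_of y) p + p_d n (g_of y) (d_of y) p)"
proof -
  have row: "(\<Sum>l=i+1..n. slot_exponent n wg wd ((i, l), False) (acoord n y (i, l)) + slot_exponent n wg wd ((i, l), True) (ccoord n y (i, l)))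
     = (\<Sum>l=i+1..n. wg (i, l) * of_real (lg n y (i, l)) + wd (i, l) * of_real (ld n y (i, l)))
      - of_real (\<Sum>l=i+1..n. p_g n (g_of y) (d_of y) (i, l) + p_d n (g_of y) (d_of y) (i, l))"
    if i: "i \<in> {1..<n}" for i
  proof -
    define a c where "a l = acoord n y (i, l)" and "c l = ccoord n y (i, l)" for l
    define P where "P l = p_g n (g_of y) (d_of y) (i, l) + p_d n (g_of y) (d_of y) (i, l)" for l
    define G D where "G l = wg (i, l)" and "D l = wd (i, l)" for l
    define s where "s = softplus (rcoord n y i)"
    have S: "{i+1..n} = insert n {i+1..<n}" using i by auto
    have P: "P l = exp (a l) + (if l = Suc i then 0 else exp (c (l - 1)))" if "l \<in> {i+1..n}" for l
      unfolding P_def a_def c_def using that i by (intro p_sum_exp) (auto simp: idx_def)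
    have shift: "(\<Sum>l=i+1..n. if l = Suc i then 0 else f (l - 1)) = (\<Sum>l=i+1..<n. f l)" for f :: "nat \<Rightarrow> complex"
    proof -
      have "(\<Sum>l=i+1..n. if l = Suc i then 0 else f (l - 1)) = (\<Sum>l=Suc (i+1)..n. f (l - 1))"
        using i by (intro sum.mono_neutral_cong_right) auto
      also have "\<dots> = (\<Sum>l=i+1..<n. f l)"
        using i by (intro sum.reindex_bij_witness[of _ Suc "\<lambda>l. l - 1"]) auto
      finally show ?thesis .
    qed
    have "(\<Sum>l=i+1..n. slot_exponent n wg wd ((i, l), False) (a l))
       = (\<Sum>l=i+1..n. (G l + D l) * of_real (a l) - of_real (P l)
           - (if l = Suc i then 0 else D (l - 1) * of_real (a (Suc (l - 1))) - of_real (exp (c (l - 1)))))"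
      by (intro sum.cong refl) (auto simp: slot_exponent_def a_weight_def P G_def D_def algebra_simps)
    also have "\<dots> = (\<Sum>l=i+1..n. (G l + D l) * of_real (a l)) - of_real (\<Sum>l=i+1..n. P l)
        - (\<Sum>l=i+1..<n. D l * of_real (a (Suc l)) - of_real (exp (c l)))"
      unfolding sum_subtractf shift[of "\<lambda>l. D l * of_real (a (Suc l)) - of_real (exp (c l))"] by simp
    finally have 1: "(\<Sum>l=i+1..n. slot_exponent n wg wd ((i, l), False) (a l))
      = (\<Sum>l=i+1..n. (G l + D l) * of_real (a l)) - of_real (\<Sum>l=i+1..n. P l)
        - (\<Sum>l=i+1..<n. D l * of_real (a (Suc l)) - of_real (exp (c l)))" .
    have 2: "(\<Sum>l=i+1..n. slot_exponent n wg wd ((i, l), True) (c l))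
      = (D n * of_real (c n) - (G n + D n) * of_real s) + (\<Sum>l=i+1..<n. D l * of_real (c l) - of_real (exp (c l)))"
      unfolding S by (simp add: slot_exponent_def G_def D_def s_def c_def ccoord_def)
    have 3: "(\<Sum>l=i+1..n. (G l + D l) * of_real (a l)) = (G n + D n) * of_real (lg n y (i, n) + s) + (\<Sum>l=i+1..<n. (G l + D l) * of_real (lg n y (i, l)))"
      unfolding S by (simp add: a_def acoord_def s_def)
    have 4: "(\<Sum>l=i+1..<n. D l * of_real (c l) - of_real (exp (c l))) - (\<Sum>l=i+1..<n. D l * of_real (a (Suc l)) - of_real (exp (c l)))
       = (\<Sum>l=i+1..<n. D l * of_real (ld n y (i, l) - lg n y (i, l)))"
      unfolding sum_subtractf[symmetric] by (intro sum.cong refl) (auto simp: c_def ccoord_def a_def algebra_simps)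
    have 5: "(\<Sum>l=i+1..<n. (G l + D l) * of_real (lg n y (i, l))) + (\<Sum>l=i+1..<n. D l * of_real (ld n y (i, l) - lg n y (i, l)))
       = (\<Sum>l=i+1..<n. G l * of_real (lg n y (i, l)) + D l * of_real (ld n y (i, l)))"
      unfolding sum.distrib[symmetric] by (intro sum.cong refl) (simp add: algebra_simps)
    have 6: "(\<Sum>l=i+1..n. G l * of_real (lg n y (i, l)) + D l * of_real (ld n y (i, l)))
       = G n * of_real (lg n y (i, n)) + D n * of_real (ld n y (i, n)) + (\<Sum>l=i+1..<n. G l * of_real (lg n y (i, l)) + D l * of_real (ld n y (i, l)))"
      unfolding S by simp
    have cn: "c n = ld n y (i, n) - lg n y (i, n)" by (simp add: c_def ccoord_def rcoord_def)
    have "(\<Sum>l=i+1..n. slot_exponent n wg wd ((i, l), False) (a l) + slot_exponent n wg wd ((i, l), True) (c l))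
      = (G n + D n) * of_real (lg n y (i, n) + s) + (D n * of_real (c n) - (G n + D n) * of_real s)
        + (\<Sum>l=i+1..<n. G l * of_real (lg n y (i, l)) + D l * of_real (ld n y (i, l))) - of_real (\<Sum>l=i+1..n. P l)"
    proof -
      have alg: "A1 + A2 = Z + Y + T - Q" if "A1 = X - Q - Sa" "A2 = Y + Sc" "X = Z + Sl" "Sc - Sa = Sd" "Sl + Sd = T"
        for A1 A2 X Y Z T Q Sa Sc Sl Sd :: complex
      proof -
        have "Sc = Sd + Sa" using that(4) by (simp add: algebra_simps)
        then show ?thesis using that by simp
      qed
      show ?thesis unfolding sum.distrib[of _ _ "{i+1..n}"] by (rule alg[OF 1 2 3 4 5])
    qed
    also have "\<dots> = (\<Sum>l=i+1..n. G l * of_real (lg n y (i, l)) + D l * of_real (ld n y (i, l))) - of_real (\<Sum>l=i+1..n. P l)"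
      unfolding 6 cn by (simp add: algebra_simps)
    finally show ?thesis by (simp only: a_def c_def G_def D_def P_def)
  qed
  have "(\<Sum>k\<in>slots n. slot_exponent n wg wd k (new_coord n y k))
     = (\<Sum>p\<in>idx n. slot_exponent n wg wd (p, False) (acoord n y p) + slot_exponent n wg wd (p, True) (ccoord n y p))"
    unfolding sum_slots by (intro sum.cong refl) (simp add: new_coord_def)
  also have "\<dots> = (\<Sum>i=1..<n. (\<Sum>l=i+1..n. wg (i, l) * of_real (lg n y (i, l)) + wd (i, l) * of_real (ld n y (i, l)))
      - of_real (\<Sum>l=i+1..n. p_g n (g_of y) (d_of y) (i, l) + p_d n (g_of y) (d_of y) (i, l)))"
    unfolding sum_idx by (intro sum.cong refl row)
  finally show ?thesis unfolding sum_idx by (simp add: sum_subtractf)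
qed

text \<open>In the new coordinates the integrand is a product over slots. The \<open>d\<close> slots
  of the last column give Beta integrals, all others Gamma integrals.\<close>

lemma decoupled_integral:
  fixes wg wd :: "nat \<times> nat \<Rightarrow> complex"
  assumes a: "\<And>p. p \<in> idx n \<Longrightarrow> Re (a_weight wg wd p) > 0" and d: "\<And>p. p \<in> idx n \<Longrightarrow> Re (wd p) > 0"
    and g: "\<And>i. 1 \<le> i \<Longrightarrow> i < n \<Longrightarrow> Re (wg (i, n)) > 0"
  defines "E \<equiv> \<lambda>y. exp ((\<Sum>p\<in>idx n. wg p * of_real (lg n y p) + wd p * of_real (ld n y p))
      - of_real (\<Sum>p\<in>idx n. p_g n (g_of y) (d_of y) p + p_d n (g_of y) (d_of y) p))"
  shows "integrable (PiR (slots n)) E"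
    and "(LINT y|PiR (slots n). E y) = (\<Prod>p\<in>idx n. Gamma (a_weight wg wd p) *
       (if snd p = n then Gamma (wg p) * Gamma (wd p) / Gamma (wg p + wd p) else Gamma (wd p)))"
proof -
  let ?M = "PiR (slots n)"
  define f where "f k u = exp (slot_exponent n wg wd k u)" for k u
  define F where "F u = (\<Prod>k\<in>slots n. f k (u k))" for u
  have EF: "E = (\<lambda>y. F (new_coord n y))"
    unfolding E_def F_def f_def by (simp only: exp_sum[OF finite_slots, symmetric] slot_exponent_sum)
  have f: "integrable lborel (f k) \<and> (LINT u|lborel. f k u) = (case k of (p, b) \<Rightarrow> if \<not> b then Gamma (a_weight wg wd p)
      else if snd p = n then Gamma (wg p) * Gamma (wd p) / Gamma (wg p + wd p) else Gamma (wd p))"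
    if "k \<in> slots n" for k
  proof -
    obtain p b where k: "k = (p, b)" by (metis surj_pair)
    have p: "p \<in> idx n" using that by (simp add: k)
    have gp: "Re (wg p) > 0" if "snd p = n" using g[of "fst p"] p that by (cases p) (auto simp: idx_def)
    show ?thesis
      using Gamma_log_integral[OF a[OF p]] Gamma_log_integral[OF d[OF p]]
        integrable_Beta_log[OF gp d[OF p]] integral_Beta_log[OF gp d[OF p]]
      by (auto simp: f_def[abs_def] slot_exponent_def k)
  qed
  have mF: "F \<in> borel_measurable ?M"
    unfolding F_def[abs_def]
  proof (rule borel_measurable_prod)
    fix k assume k: "k \<in> slots n"
    have "f k \<in> borel_measurable lborel" by (rule borel_measurable_integrable[OF conjunct1[OF f[OF k]]])
    then show "(\<lambda>u. f k (u k)) \<in> borel_measurable ?M"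
      by (rule measurable_compose[OF measurable_component_singleton[OF k]])
  qed
  note N = new_coord_preserving[of n]
  have iF: "integrable ?M F"
    unfolding F_def[abs_def] by (rule PiR.product_integrable_prod[OF finite_slots conjunct1[OF f]])
  show "integrable ?M E"
    using integrable_distr_eq[OF conjunct1[OF N] mF] N iF by (simp add: EF)
  have "(LINT y|?M. E y) = (LINT u|?M. F u)"
    using integral_distr[OF conjunct1[OF N] mF] N by (simp add: EF)
  also have "\<dots> = (\<Prod>k\<in>slots n. LINT u|lborel. f k u)"
    unfolding F_def[abs_def] by (rule PiR.product_integral_prod[OF finite_slots conjunct1[OF f]])
  also have "\<dots> = (\<Prod>k\<in>slots n. case k of (p, b) \<Rightarrow> if \<not> b then Gamma (a_weight wg wd p)
      else if snd p = n then Gamma (wg p) * Gamma (wd p) / Gamma (wg p + wd p) else Gamma (wd p))"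
    by (intro prod.cong refl) (rule conjunct2[OF f])
  finally show "(LINT y|?M. E y) = (\<Prod>p\<in>idx n. Gamma (a_weight wg wd p) *
       (if snd p = n then Gamma (wg p) * Gamma (wd p) / Gamma (wg p + wd p) else Gamma (wd p)))"
    unfolding prod_slots by simp
qed

section \<open>The exponents\<close>

text \<open>The weights of \<open>ld\<close> for which \<open>exponent_identity\<close> holds. They
  reappear as arguments of Gamma functions in the final formula: the \<open>xi\<close> ones for l <
  n and the \<open>eta\<close> ones for l = n.\<close>

definition w_d :: "nat \<Rightarrow> (nat \<Rightarrow> real) \<Rightarrow> carray \<Rightarrow> carray \<Rightarrow> nat \<times> nat \<Rightarrow> complex" where
  "w_d n lam G D = (\<lambda>(i, l). if l = n then eta n G D i n + \<i> * of_real (lam i + lam n)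
     else xi n G D i l + \<i> * of_real (lam i - lam l))"

text \<open>The Mellin variables are differences down the columns of gamma or delta; since these
  telescope, \<open>H_fun\<close> contains first-row entries only.\<close>

definition z_g :: "nat \<Rightarrow> carray \<Rightarrow> nat \<times> nat \<Rightarrow> complex" where
  "z_g n G = (\<lambda>(i, l). entry n G i l - entry n G (i + 1) l)"

definition w_g :: "nat \<Rightarrow> (nat \<Rightarrow> real) \<Rightarrow> carray \<Rightarrow> carray \<Rightarrow> nat \<times> nat \<Rightarrow> complex" where
  "w_g n lam G D = (\<lambda>(i, l). z_g n G (i, l) + z_g n D (i, l) + 2 * \<i> * of_real (lam i) - w_d n lam G D (i, l))"

lemma w_g_last: "w_g n lam G D (i, n) = xi n G D i n + \<i> * of_real (lam i - lam n)"
  by (simp add: w_g_def w_d_def z_g_def xi_def eta_def algebra_simps)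

lemma entry_diag [simp]: "k \<ge> l \<Longrightarrow> entry n G k l = 0"
  by (simp add: entry_def)

text \<open>Here the \<open>eta\<close> arguments with l < n arise, and for l = i + 1 the arguments
  of the numerators in the quotient of Gamma functions.\<close>

lemma a_weight_eq:
  assumes "(i, l) \<in> idx n"
  shows "a_weight (w_g n lam G D) (w_d n lam G D) (i, l) = (if l = Suc i
     then entry n G i l + entry n D i l + 2 * \<i> * of_real (lam i) else eta n G D i (l - 1) + \<i> * of_real (lam i + lam (l - 1)))"
proof (cases "l = Suc i")
  case True
  then show ?thesis by (simp add: a_weight_def w_g_def z_g_def)
next
  case False
  have il: "1 \<le> i" "i < l" "l \<le> n" using assms by (auto simp: idx_def)
  then obtain m where m: "l = Suc m" "i < m" "m < n" using False by (cases l) auto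
  then show ?thesis
    by (simp add: a_weight_def w_g_def w_d_def z_g_def xi_def eta_def algebra_simps)
qed

section \<open>Summation by parts along the columns\<close>

lemma sum_idx_col: "(\<Sum>p\<in>idx n. f p) = (\<Sum>l=1..n. \<Sum>i=1..<l. f (i, l))"
  by (subst sum.Sigma, simp, simp, rule sum.reindex_bij_witness[where i = "\<lambda>(l, i). (i, l)" and j = "\<lambda>(i, l). (l, i)"])
     (auto simp: idx_def)

lemma sum_idx_shift: "(\<Sum>(i, l)\<in>idx n. f i (l - 1)) = (\<Sum>l=1..<n. \<Sum>i=1..l. f i l)"
  by (subst sum.Sigma, simp, simp, rule sum.reindex_bij_witness[where i = "\<lambda>(l, i). (i, Suc l)" and j = "\<lambda>(i, l). (l - 1, i)"])
     (auto simp: idx_def)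

text \<open>Each summand is the increment of - K L along the recursion, so the sum telescopes, with
  zero contribution at the lower end.\<close>

lemma abel_minus:
  fixes K L t s :: "nat \<Rightarrow> complex"
  assumes "1 \<le> m" and L1: "L 1 = 0" and "\<And>i. 1 \<le> i \<Longrightarrow> i < m \<Longrightarrow> L (Suc i) = L i + (s i - t i)"
  shows "(\<Sum>i=1..<m. K i * (t i - s i) + (K (i - 1) - K i) * L i) = - (K (m - 1) * L m)"
  using assms(1,3)
proof (induction m rule: dec_induct)
  case base
  show ?case using L1 by simp
next
  case (step n)
  have LS: "L (Suc n) = L n + (s n - t n)" using step by simp
  have "(\<Sum>i=1..<Suc n. K i * (t i - s i) + (K (i - 1) - K i) * L i)
      = - (K (n - 1) * L n) + (K n * (t n - s n) + (K (n - 1) - K n) * L n)" using step by simp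
  also have "\<dots> = - (K n * L (Suc n))" unfolding LS by (simp add: algebra_simps)
  finally show ?case by simp
qed

lemma sum_diff_telescope:
  fixes L t s :: "nat \<Rightarrow> complex"
  assumes "1 \<le> m" and L1: "L 1 = 0" and "\<And>i. 1 \<le> i \<Longrightarrow> i < m \<Longrightarrow> L (Suc i) = L i + (s i - t i)"
  shows "(\<Sum>i=1..<m. t i - s i) = - L m"
  using assms(1,3)
proof (induction m rule: dec_induct)
  case base
  show ?case using L1 by simp
next
  case (step n)
  have "L (Suc n) = L n + (s n - t n)" using step by simp
  then show ?case using step by simp
qed

text \<open>In the last column the recursion reverses the sign of \<open>L\<close> at every step, as
  \<open>acc_last\<close> takes reciprocals; hence sums of neighbouring \<open>K\<close> in place of
  differences.\<close>

lemma abel_plus: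
  fixes K L t s :: "nat \<Rightarrow> complex"
  assumes "1 \<le> m" and L1: "L 1 = 0" and "\<And>i. 1 \<le> i \<Longrightarrow> i < m \<Longrightarrow> L (Suc i) = t i - s i - L i"
  shows "(\<Sum>i=1..<m. K i * (t i - s i) - (K (i - 1) + K i) * L i) = K (m - 1) * L m"
  using assms(1,3)
proof (induction m rule: dec_induct)
  case base
  show ?case using L1 by simp
next
  case (step n)
  have LS: "L (Suc n) = t n - s n - L n" using step by simp
  have "(\<Sum>i=1..<Suc n. K i * (t i - s i) - (K (i - 1) + K i) * L i)
      = K (n - 1) * L n + (K n * (t n - s n) - (K (n - 1) + K n) * L n)" using step by simp
  also have "\<dots> = K n * L (Suc n)" unfolding LS by (simp add: algebra_simps)
  finally show ?case by simp
qed

text \<open>Up to multiples of lambda, the weights are \<open>z_g\<close> plus or minus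
  \<open>K\<close>, and the coefficients of \<open>L\<close> are increments of \<open>K\<close>. By
  \<open>abel_minus\<close> all terms with \<open>K\<close> cancel, including the boundary term from
  i = l.\<close>

lemma exponent_column:
  fixes y :: "slot \<Rightarrow> real" and lam :: "nat \<Rightarrow> real" and G D :: carray
  assumes l: "1 \<le> l" "l < n"
  defines "L \<equiv> \<lambda>i. complex_of_real (lacc n y i l)"
    and "s \<equiv> \<lambda>i l. w_g n lam G D (i, l) + w_d n lam G D (i, l)"
    and "t \<equiv> \<lambda>i. complex_of_real (y ((i, l), False))" and "u \<equiv> \<lambda>i. complex_of_real (y ((i, l), True))"
  shows "(\<Sum>i=1..<l. w_g n lam G D (i, l) * t i + w_d n lam G D (i, l) * u i)
      + (\<Sum>i=1..l. s i (Suc l) * L i) - (\<Sum>i=1..<l. s i l * L i)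
    = (\<i> * of_real (lam l) + of_nat (n - l)) * L l
      + (\<Sum>i=1..<l. (\<i> * of_real (lam i) + of_nat (n - l) + z_g n G (i, l)) * t i
           + (\<i> * of_real (lam i) - of_nat (n - l) + z_g n D (i, l)) * u i)"
proof -
  define K where "K i = 2 * \<i> * of_real (lam l) + entry n G (i + 1) (l + 1) + entry n D (i + 1) (l + 1)
     - entry n G (i + 1) l - entry n D (i + 1) l" for i
  have L1: "L 1 = 0" using l by (simp add: L_def lacc_def)
  have LS: "L (Suc i) = L i + (u i - t i)" if "1 \<le> i" "i < l" for i
    using l that by (simp add: L_def lacc_def u_def t_def)
  have wd: "w_d n lam G D (i, l) = z_g n D (i, l) + \<i> * of_real (lam i + lam l) - K i" for i
    using l by (simp add: w_d_def xi_def z_g_def K_def algebra_simps)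
  have wg: "w_g n lam G D (i, l) = z_g n G (i, l) + \<i> * of_real (lam i - lam l) + K i" for i
    unfolding w_g_def prod.case wd by (simp add: algebra_simps)
  have sd: "s i (Suc l) - s i l = K (i - 1) - K i" if "1 \<le> i" "i < l" for i
    using that by (simp add: s_def w_g_def z_g_def K_def algebra_simps)
  have sl: "s l (Suc l) = K (l - 1)" using l by (simp add: s_def w_g_def z_g_def K_def)
  \<comment> \<open>Splitting off c (t i - u i) trades the multiples of lambda_l and n - l for a
    multiple of \<open>L l\<close>, by \<open>sum_diff_telescope\<close>.\<close>
  define c where "c = \<i> * complex_of_real (lam l) + of_nat (n - l)"
  have S: "{1..l} = insert l {1..<l}" using l by auto
  have "(\<Sum>i=1..<l. w_g n lam G D (i, l) * t i + w_d n lam G D (i, l) * u i)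
      + (\<Sum>i=1..l. s i (Suc l) * L i) - (\<Sum>i=1..<l. s i l * L i)
    = (\<Sum>i=1..<l. w_g n lam G D (i, l) * t i + w_d n lam G D (i, l) * u i + (s i (Suc l) - s i l) * L i) + K (l - 1) * L l"
    unfolding S by (simp add: sum.distrib sum_subtractf sl left_diff_distrib)
  also have "(\<Sum>i=1..<l. w_g n lam G D (i, l) * t i + w_d n lam G D (i, l) * u i + (s i (Suc l) - s i l) * L i)
    = (\<Sum>i=1..<l. ((\<i> * of_real (lam i) + of_nat (n - l) + z_g n G (i, l)) * t i
           + (\<i> * of_real (lam i) - of_nat (n - l) + z_g n D (i, l)) * u i)
         + (K i * (t i - u i) + (K (i - 1) - K i) * L i) - c * (t i - u i))"
  proof (intro sum.cong refl)
    fix i assume "i \<in> {1..<l}"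
    then have i: "1 \<le> i" "i < l" by auto
    show "w_g n lam G D (i, l) * t i + w_d n lam G D (i, l) * u i + (s i (Suc l) - s i l) * L i
      = ((\<i> * of_real (lam i) + of_nat (n - l) + z_g n G (i, l)) * t i
           + (\<i> * of_real (lam i) - of_nat (n - l) + z_g n D (i, l)) * u i)
         + (K i * (t i - u i) + (K (i - 1) - K i) * L i) - c * (t i - u i)"
      unfolding wg wd sd[OF i] c_def by (simp add: algebra_simps)
  qed
  also have "\<dots> = (\<Sum>i=1..<l. (\<i> * of_real (lam i) + of_nat (n - l) + z_g n G (i, l)) * t i
           + (\<i> * of_real (lam i) - of_nat (n - l) + z_g n D (i, l)) * u i) - K (l - 1) * L l + c * L l"
  proof -
    have a1: "(\<Sum>i=1..<l. K i * (t i - u i) + (K (i - 1) - K i) * L i) = - (K (l - 1) * L l)"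
      by (rule abel_minus) (use l L1 LS in auto)
    have a2: "(\<Sum>i=1..<l. t i - u i) = - L l"
      by (rule sum_diff_telescope) (use l L1 LS in auto)
    have "(\<Sum>i=1..<l. P i + Q i - c * R i) = (\<Sum>i=1..<l. P i) + (\<Sum>i=1..<l. Q i) - c * (\<Sum>i=1..<l. R i)" for P Q R :: "nat \<Rightarrow> complex"
      by (simp only: sum.distrib sum_subtractf sum_distrib_left)
    then show ?thesis by (simp only: a1 a2) simp
  qed
  finally show ?thesis by (simp add: c_def)
qed

text \<open>The analogue of \<open>exponent_column\<close> for the alternating recursion of
  \<open>lacc_last\<close>, with \<open>abel_plus\<close> removing \<open>K\<close>.\<close>

lemma exponent_last_column:
  fixes y :: "slot \<Rightarrow> real"
  assumes n: "n \<ge> 2"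
  defines "L \<equiv> \<lambda>i. complex_of_real (lacc n y i n)"
    and "t \<equiv> \<lambda>i. complex_of_real (y ((i, n), False))" and "u \<equiv> \<lambda>i. complex_of_real (y ((i, n), True))"
  shows "(\<Sum>i=1..<n. w_g n lam G D (i, n) * t i + w_d n lam G D (i, n) * u i + (w_d n lam G D (i, n) - w_g n lam G D (i, n)) * L i)
    = - (\<i> * of_real (lam n)) * L n
      + (\<Sum>i=1..<n. (\<i> * of_real (lam i) + z_g n G (i, n)) * t i + (\<i> * of_real (lam i) + z_g n D (i, n)) * u i)"
proof -
  define K where "K i = entry n G (i + 1) n - entry n D (i + 1) n - \<i> * of_real (lam n)" for i
  have L1: "L 1 = 0" by (simp add: L_def lacc_def)
  have LS: "L (Suc i) = t i - u i - L i" if "1 \<le> i" "i < n" for i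
    using that by (simp add: L_def lacc_def u_def t_def)
  have wd: "w_d n lam G D (i, n) = z_g n D (i, n) + \<i> * of_real (lam i) - K i" for i
    by (simp add: w_d_def eta_def z_g_def K_def algebra_simps)
  have wg: "w_g n lam G D (i, n) = z_g n G (i, n) + \<i> * of_real (lam i) + K i" for i
    unfolding w_g_def prod.case wd by (simp add: algebra_simps)
  have dif: "w_d n lam G D (i, n) - w_g n lam G D (i, n) = - (K (i - 1) + K i)" if "1 \<le> i" for i
    using that unfolding wd wg by (simp add: K_def z_g_def algebra_simps)
  have "(\<Sum>i=1..<n. w_g n lam G D (i, n) * t i + w_d n lam G D (i, n) * u i + (w_d n lam G D (i, n) - w_g n lam G D (i, n)) * L i)
    = (\<Sum>i=1..<n. ((\<i> * of_real (lam i) + z_g n G (i, n)) * t i + (\<i> * of_real (lam i) + z_g n D (i, n)) * u i)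
        + (K i * (t i - u i) - (K (i - 1) + K i) * L i))"
  proof (intro sum.cong refl)
    fix i assume "i \<in> {1..<n}"
    then have i: "1 \<le> i" by auto
    show "w_g n lam G D (i, n) * t i + w_d n lam G D (i, n) * u i + (w_d n lam G D (i, n) - w_g n lam G D (i, n)) * L i
      = ((\<i> * of_real (lam i) + z_g n G (i, n)) * t i + (\<i> * of_real (lam i) + z_g n D (i, n)) * u i)
        + (K i * (t i - u i) - (K (i - 1) + K i) * L i)"
      unfolding dif[OF i] unfolding wg wd by (simp add: algebra_simps)
  qed
  also have "\<dots> = (\<Sum>i=1..<n. (\<i> * of_real (lam i) + z_g n G (i, n)) * t i + (\<i> * of_real (lam i) + z_g n D (i, n)) * u i) + K (n - 1) * L n"
  proof -
    have a1: "(\<Sum>i=1..<n. K i * (t i - u i) - (K (i - 1) + K i) * L i) = K (n - 1) * L n"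
      by (rule abel_plus) (use n L1 LS in auto)
    show ?thesis unfolding a1[symmetric] by (rule sum.distrib)
  qed
  also have "K (n - 1) = - (\<i> * of_real (lam n))" using n by (simp add: K_def)
  finally show ?thesis by (simp add: add.commute)
qed

definition log_torus :: "nat \<Rightarrow> (slot \<Rightarrow> real) \<Rightarrow> nat \<Rightarrow> real" where
  "log_torus n y k = lacc n y k k - (\<Sum>l\<in>{k<..n}. lg n y (k, l) + ld n y (k, l))"

text \<open>In the columns k < l < n the accumulated terms telescope with factor 2; in the last
  column those at n cancel between \<open>lg\<close> and \<open>ld\<close>. Altogether
  \<open>lacc n y k k\<close> changes its sign.\<close>

lemma log_torus_eq:
  assumes "k < n"
  shows "log_torus n y k = - lacc n y k k - (\<Sum>l=k+1..n. y ((k, l), False) + y ((k, l), True))"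
proof -
  have S: "{k<..n} = insert n {k+1..<n}" "{k+1..n} = insert n {k+1..<n}" using assms by auto
  have tel: "(\<Sum>l=k+1..<n. lacc n y k (l - 1) - lacc n y k l) = lacc n y k k - lacc n y k (n - 1)"
  proof -
    obtain m where m: "n = Suc m" "k \<le> m" using assms by (cases n) auto
    have "(\<Sum>l=k+1..<Suc m. lacc n y k (l - 1) - lacc n y k l) = lacc n y k k - lacc n y k m"
      using m(2) by (induction m rule: dec_induct) auto
    then show ?thesis by (simp add: m)
  qed
  have "(\<Sum>l=k+1..<n. lg n y (k, l) + ld n y (k, l))
     = (\<Sum>l=k+1..<n. (y ((k, l), False) + y ((k, l), True)) + 2 * (lacc n y k (l - 1) - lacc n y k l))"
    by (intro sum.cong refl) (auto simp: lg_def ld_def)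
  also have "\<dots> = (\<Sum>l=k+1..<n. y ((k, l), False) + y ((k, l), True)) + 2 * (lacc n y k k - lacc n y k (n - 1))"
    unfolding sum.distrib[of "\<lambda>l. _ l + _ l" "\<lambda>l. 2 * _ l"] sum_distrib_left[symmetric] tel ..
  finally show ?thesis unfolding log_torus_def S by (simp add: lg_def ld_def)
qed

text \<open>The left side decouples; the right side collects the conjugated torus character, the
  Mellin variables and the powers in the measure. These powers come out as (n - i) - (n - l) = l - i
  and (n - i) + (n - l) = 2 n - i - l, with n - i from the rho part of the character and n - l from
  the columns.\<close>

lemma exponent_identity:
  assumes n: "n \<ge> 2"
  shows "(\<Sum>p\<in>idx n. w_g n lam G D p * of_real (lg n y p) + w_d n lam G D p * of_real (ld n y p))
    = (\<Sum>k=1..n. cnj (whittaker_param n lam k) * of_real (log_torus n y k))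
      + (\<Sum>(i, l)\<in>idx n. (z_g n G (i, l) - of_nat (l - i)) * of_real (y ((i, l), False))
          + (z_g n D (i, l) - of_nat (2*n - i - l)) * of_real (y ((i, l), True)))"
proof -
  define wg where "wg = w_g n lam G D"
  define wd where "wd = w_d n lam G D"
  define L where "L i l = complex_of_real (lacc n y i l)" for i l
  define s where "s i l = wg (i, l) + wd (i, l)" for i l
  define t where "t i l = complex_of_real (y ((i, l), False))" for i l
  define u where "u i l = complex_of_real (y ((i, l), True))" for i l
  define R where "R i l = (\<i> * of_real (lam i) + of_nat (n - l) + z_g n G (i, l)) * t i l
           + (\<i> * of_real (lam i) - of_nat (n - l) + z_g n D (i, l)) * u i l" for i l
  have N: "{1..n} = insert n {1..<n}" using n by auto
  have "(\<Sum>p\<in>idx n. wg p * of_real (lg n y p) + wd p * of_real (ld n y p))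
    = (\<Sum>(i, l)\<in>idx n. (wg (i, l) * t i l + wd (i, l) * u i l) + s i (Suc (l - 1)) * L i (l - 1)
        + (if l = n then (wd (i, l) - wg (i, l)) * L i l else - (s i l * L i l)))"
    by (intro sum.cong refl) (auto simp: lg_def ld_def t_def u_def s_def L_def idx_def algebra_simps)
  also have "\<dots> = (\<Sum>(i, l)\<in>idx n. wg (i, l) * t i l + wd (i, l) * u i l) + (\<Sum>(i, l)\<in>idx n. s i (Suc (l - 1)) * L i (l - 1))
        + (\<Sum>(i, l)\<in>idx n. if l = n then (wd (i, l) - wg (i, l)) * L i l else - (s i l * L i l))"
    by (simp only: sum.distrib case_prod_unfold)
  also have "(\<Sum>(i, l)\<in>idx n. s i (Suc (l - 1)) * L i (l - 1)) = (\<Sum>l=1..<n. \<Sum>i=1..l. s i (Suc l) * L i l)"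
    by (rule sum_idx_shift[of "\<lambda>i l. s i (Suc l) * L i l"])
  also have "(\<Sum>(i, l)\<in>idx n. wg (i, l) * t i l + wd (i, l) * u i l)
      = (\<Sum>i=1..<n. wg (i, n) * t i n + wd (i, n) * u i n) + (\<Sum>l=1..<n. \<Sum>i=1..<l. wg (i, l) * t i l + wd (i, l) * u i l)"
    unfolding sum_idx_col N by simp
  also have "(\<Sum>(i, l)\<in>idx n. if l = n then (wd (i, l) - wg (i, l)) * L i l else - (s i l * L i l))
      = (\<Sum>i=1..<n. (wd (i, n) - wg (i, n)) * L i n) + (\<Sum>l=1..<n. - (\<Sum>i=1..<l. s i l * L i l))"
    unfolding sum_idx_col N sum_negf[symmetric] by (simp cong: sum.cong_simp)
  also have "(\<Sum>i=1..<n. wg (i, n) * t i n + wd (i, n) * u i n) + (\<Sum>l=1..<n. \<Sum>i=1..<l. wg (i, l) * t i l + wd (i, l) * u i l)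
       + (\<Sum>l=1..<n. \<Sum>i=1..l. s i (Suc l) * L i l)
       + ((\<Sum>i=1..<n. (wd (i, n) - wg (i, n)) * L i n) + (\<Sum>l=1..<n. - (\<Sum>i=1..<l. s i l * L i l)))
     = (\<Sum>i=1..<n. wg (i, n) * t i n + wd (i, n) * u i n + (wd (i, n) - wg (i, n)) * L i n)
       + (\<Sum>l=1..<n. (\<Sum>i=1..<l. wg (i, l) * t i l + wd (i, l) * u i l) + (\<Sum>i=1..l. s i (Suc l) * L i l) - (\<Sum>i=1..<l. s i l * L i l))"
    by (simp add: sum.distrib sum_subtractf sum_negf)
  also have "(\<Sum>l=1..<n. (\<Sum>i=1..<l. wg (i, l) * t i l + wd (i, l) * u i l) + (\<Sum>i=1..l. s i (Suc l) * L i l) - (\<Sum>i=1..<l. s i l * L i l))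
     = (\<Sum>l=1..<n. (\<i> * of_real (lam l) + of_nat (n - l)) * L l l + (\<Sum>i=1..<l. R i l))"
    unfolding wg_def wd_def s_def L_def t_def u_def R_def
    by (intro sum.cong refl exponent_column) auto
  also have "(\<Sum>i=1..<n. wg (i, n) * t i n + wd (i, n) * u i n + (wd (i, n) - wg (i, n)) * L i n)
     = - (\<i> * of_real (lam n)) * L n n + (\<Sum>i=1..<n. R i n)"
    using exponent_last_column[OF n, of lam G D y] unfolding wg_def wd_def s_def L_def t_def u_def R_def by simp
  also have "- (\<i> * of_real (lam n)) * L n n + (\<Sum>i=1..<n. R i n) + (\<Sum>l=1..<n. (\<i> * of_real (lam l) + of_nat (n - l)) * L l l + (\<Sum>i=1..<l. R i l))
     = - (\<i> * of_real (lam n)) * L n n + (\<Sum>l=1..<n. (\<i> * of_real (lam l) + of_nat (n - l)) * L l l) + (\<Sum>(i, l)\<in>idx n. R i l)"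
    unfolding sum_idx_col N by (simp add: sum.distrib)
  finally have A: "(\<Sum>p\<in>idx n. wg p * of_real (lg n y p) + wd p * of_real (ld n y p))
     = - (\<i> * of_real (lam n)) * L n n + (\<Sum>l=1..<n. (\<i> * of_real (lam l) + of_nat (n - l)) * L l l) + (\<Sum>(i, l)\<in>idx n. R i l)" .
  have c: "cnj (whittaker_param n lam k) = - (\<i> * of_real (lam k) + of_nat (n - k))" if "k \<le> n" for k
    using that by (simp add: whittaker_param_def rho_def of_nat_diff)
  have "(\<Sum>k=1..n. cnj (whittaker_param n lam k) * of_real (log_torus n y k))
     = - (\<i> * of_real (lam n)) * L n n + (\<Sum>k=1..<n. (\<i> * of_real (lam k) + of_nat (n - k)) * (L k k + (\<Sum>l=k+1..n. t k l + u k l)))"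
  proof -
    have "cnj (whittaker_param n lam n) * of_real (log_torus n y n) = - (\<i> * of_real (lam n)) * L n n"
      using c[of n] by (simp add: log_torus_def L_def)
    moreover have "cnj (whittaker_param n lam k) * of_real (log_torus n y k)
       = (\<i> * of_real (lam k) + of_nat (n - k)) * (L k k + (\<Sum>l=k+1..n. t k l + u k l))" if "k \<in> {1..<n}" for k
    proof -
      have "complex_of_real (log_torus n y k) = - (L k k + (\<Sum>l=k+1..n. t k l + u k l))"
        using that log_torus_eq[of k n y] by (simp add: L_def t_def u_def)
      moreover have "k \<le> n" using that by simp
      ultimately show ?thesis unfolding c[OF \<open>k \<le> n\<close>] by (simp only: minus_mult_minus)
    qed
    ultimately show ?thesis unfolding N by simp
  qed
  also have "\<dots> = - (\<i> * of_real (lam n)) * L n n + (\<Sum>k=1..<n. (\<i> * of_real (lam k) + of_nat (n - k)) * L k k)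
      + (\<Sum>(i, l)\<in>idx n. (\<i> * of_real (lam i) + of_nat (n - i)) * (t i l + u i l))"
    unfolding sum_idx by (simp add: distrib_left sum.distrib sum_distrib_left)
  finally have B: "(\<Sum>k=1..n. cnj (whittaker_param n lam k) * of_real (log_torus n y k))
     = - (\<i> * of_real (lam n)) * L n n + (\<Sum>k=1..<n. (\<i> * of_real (lam k) + of_nat (n - k)) * L k k)
      + (\<Sum>(i, l)\<in>idx n. (\<i> * of_real (lam i) + of_nat (n - i)) * (t i l + u i l))" .
  have C: "(\<Sum>(i, l)\<in>idx n. R i l) = (\<Sum>(i, l)\<in>idx n. (\<i> * of_real (lam i) + of_nat (n - i)) * (t i l + u i l))
     + (\<Sum>(i, l)\<in>idx n. (z_g n G (i, l) - of_nat (l - i)) * t i l + (z_g n D (i, l) - of_nat (2*n - i - l)) * u i l)"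
    unfolding sum.distrib[symmetric]
  proof (intro sum.cong refl)
    fix p assume "p \<in> idx n"
    then obtain i l where p: "p = (i, l)" "i < l" "l \<le> n" by (auto simp: idx_def)
    then have e: "(of_nat (n - i) :: complex) = of_nat n - of_nat i" "(of_nat (n - l) :: complex) = of_nat n - of_nat l"
      "(of_nat (l - i) :: complex) = of_nat l - of_nat i" "(of_nat (2*n - i - l) :: complex) = 2 * of_nat n - of_nat i - of_nat l"
      by (simp_all add: of_nat_diff)
    show "(case p of (i, l) \<Rightarrow> R i l) = (case p of (i, l) \<Rightarrow> (\<i> * of_real (lam i) + of_nat (n - i)) * (t i l + u i l))
       + (case p of (i, l) \<Rightarrow> (z_g n G (i, l) - of_nat (l - i)) * t i l + (z_g n D (i, l) - of_nat (2*n - i - l)) * u i l)"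
      unfolding p prod.case R_def e by (simp add: algebra_simps)
  qed
  show ?thesis using A B C unfolding wg_def wd_def t_def u_def by simp
qed

section \<open>The domain of analyticity\<close>

lemma domain_Re:
  assumes "(G, D) \<in> analyticity_domain n" "(k, l) \<in> idx n"
  shows "Re (entry n G k l) > 0" "Re (entry n D k l) > 0" "Re (xi n G D k l) > 0" "Re (eta n G D k l) > 0"
    "Re (entry n G k l - entry n G (k+1) l) > 0" "Re (entry n D k l - entry n D (k+1) l) > 0"
  using assms unfolding analyticity_domain_def by blast+

lemma domain_weights:
  assumes "(G, D) \<in> analyticity_domain n"
  shows "\<And>p. p \<in> idx n \<Longrightarrow> Re (a_weight (w_g n lam G D) (w_d n lam G D) p) > 0"
    and "\<And>p. p \<in> idx n \<Longrightarrow> Re (w_d n lam G D p) > 0"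
    and "\<And>i. 1 \<le> i \<Longrightarrow> i < n \<Longrightarrow> Re (w_g n lam G D (i, n)) > 0"
proof -
  fix p assume p: "p \<in> idx n"
  obtain i l where il: "p = (i, l)" by force
  note dr = domain_Re[OF assms]
  show "Re (w_d n lam G D p) > 0" using dr[OF p[unfolded il]] by (auto simp: il w_d_def)
  show "Re (a_weight (w_g n lam G D) (w_d n lam G D) p) > 0"
  proof (cases "l = Suc i")
    case True
    then show ?thesis using dr[OF p[unfolded il]] a_weight_eq[OF p[unfolded il]] by (simp add: il)
  next
    case False
    then have "(i, l - 1) \<in> idx n" using p by (auto simp: il idx_def)
    then show ?thesis using dr(4) a_weight_eq[OF p[unfolded il]] False by (simp add: il)
  qed
next
  fix i assume "1 \<le> i" "i < n"
  then have "(i, n) \<in> idx n" by (simp add: idx_def)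
  then show "Re (w_g n lam G D (i, n)) > 0" using domain_Re(3)[OF assms] by (simp add: w_g_last)
qed

text \<open>\<open>a_weight\<close> supplies the numerators and the \<open>eta\<close> factors with
  l < n, \<open>w_d\<close> the \<open>xi\<close> factors with l < n and \<open>eta\<close> at n,
  \<open>w_g\<close> the \<open>xi\<close> factors at n, and the Beta integrals the denominators.
  For k = n - 1 numerator and denominator coincide, so the product of quotients stops at n -
  2.\<close>

lemma gamma_product:
  fixes lam :: "nat \<Rightarrow> real" and G D :: carray
  assumes n: "n \<ge> 2" and dom: "(G, D) \<in> analyticity_domain n"
  defines "wg \<equiv> w_g n lam G D" and "wd \<equiv> w_d n lam G D"
  shows "(\<Prod>p\<in>idx n. Gamma (a_weight wg wd p) *
       (if snd p = n then Gamma (wg p) * Gamma (wd p) / Gamma (wg p + wd p) else Gamma (wd p)))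
    = (\<Prod>k=1..n-2. Gamma (entry n G k (k+1) + entry n D k (k+1) + 2 * \<i> * complex_of_real (lam k))
          / Gamma (entry n G k n + entry n D k n - entry n G (k+1) n - entry n D (k+1) n + 2 * \<i> * complex_of_real (lam k)))
      * (\<Prod>(k, l)\<in>idx n. Gamma (xi n G D k l + \<i> * complex_of_real (lam k - lam l)) * Gamma (eta n G D k l + \<i> * complex_of_real (lam k + lam l)))"
proof -
  define A where "A k = Gamma (entry n G k (k+1) + entry n D k (k+1) + 2 * \<i> * complex_of_real (lam k))" for k
  define Bt where "Bt k = Gamma (entry n G k n + entry n D k n - entry n G (k+1) n - entry n D (k+1) n + 2 * \<i> * complex_of_real (lam k))" for k
  define X where "X k l = Gamma (xi n G D k l + \<i> * complex_of_real (lam k - lam l))" for k l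
  define Y where "Y k l = Gamma (eta n G D k l + \<i> * complex_of_real (lam k + lam l))" for k l
  have pi: "(\<Prod>p\<in>idx n. f p) = (\<Prod>i=1..<n. \<Prod>l=i+1..n. f (i, l))" for f :: "nat \<times> nat \<Rightarrow> complex"
    by (simp add: idx_Sigma prod.Sigma)
  have row: "(\<Prod>l=i+1..n. Gamma (a_weight wg wd (i, l)) *
       (if l = n then Gamma (wg (i, l)) * Gamma (wd (i, l)) / Gamma (wg (i, l) + wd (i, l)) else Gamma (wd (i, l))))
     = A i / Bt i * (\<Prod>l=i+1..n. X i l * Y i l)" if i: "i \<in> {1..<n}" for i
  proof -
    have S: "{i+1..n} = insert n {i+1..<n}" using i by auto
    have "(\<Prod>l=i+1..n. Gamma (a_weight wg wd (i, l))) = (\<Prod>l=i+1..n. if l = Suc i then A i else Y i (l - 1))"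
    proof (intro prod.cong refl)
      fix l assume "l \<in> {i+1..n}"
      then have "(i, l) \<in> idx n" using i by (auto simp: idx_def)
      from a_weight_eq[OF this] show "Gamma (a_weight wg wd (i, l)) = (if l = Suc i then A i else Y i (l - 1))"
        by (simp add: wg_def wd_def A_def Y_def)
    qed
    also have "\<dots> = A i * (\<Prod>l\<in>{i+1..<n}. Y i l)"
    proof -
      have S2: "{i+1..n} = insert (Suc i) {Suc (Suc i)..n}" using i by auto
      have "(\<Prod>l\<in>{Suc (Suc i)..n}. if l = Suc i then A i else Y i (l - 1)) = (\<Prod>l\<in>{i+1..<n}. Y i l)"
        using i by (intro prod.reindex_bij_witness[of _ Suc "\<lambda>l. l - 1"]) auto
      then show ?thesis unfolding S2 by simp
    qed
    finally have 1: "(\<Prod>l=i+1..n. Gamma (a_weight wg wd (i, l))) = A i * (\<Prod>l\<in>{i+1..<n}. Y i l)" .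
    have wd: "Gamma (wd (i, l)) = (if l = n then Y i l else X i l)" for l
      by (simp add: wd_def w_d_def X_def Y_def)
    have wg: "Gamma (wg (i, n)) = X i n" by (simp add: wg_def w_g_last X_def)
    have s: "wg (i, n) + wd (i, n) = entry n G i n + entry n D i n - entry n G (i+1) n - entry n D (i+1) n + 2 * \<i> * complex_of_real (lam i)"
      by (simp add: wg_def wd_def w_g_def z_g_def)
    have 2: "(\<Prod>l=i+1..n. if l = n then Gamma (wg (i, l)) * Gamma (wd (i, l)) / Gamma (wg (i, l) + wd (i, l)) else Gamma (wd (i, l)))
      = X i n * Y i n / Bt i * (\<Prod>l=i+1..<n. X i l)"
      unfolding S by (simp add: wd wg s Bt_def cong: prod.cong_simp)
    have 3: "(\<Prod>l=i+1..n. X i l * Y i l) = X i n * Y i n * ((\<Prod>l=i+1..<n. X i l) * (\<Prod>l=i+1..<n. Y i l))"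
      unfolding S by (simp add: prod.distrib)
    show ?thesis unfolding prod.distrib[of _ _ "{i+1..n}", of "\<lambda>l. Gamma (a_weight wg wd (i, l))"] 1 2 3 by simp
  qed
  have last: "A (n - 1) / Bt (n - 1) = 1"
  proof -
    have i: "(n - 1, n) \<in> idx n" "n - 1 + 1 = n" using n by (auto simp: idx_def)
    define w where "w = entry n G (n - 1) n + entry n D (n - 1) n + 2 * \<i> * complex_of_real (lam (n - 1))"
    have "Re w > 0" using domain_Re[OF dom i(1)] by (simp add: w_def)
    then have "Gamma w \<noteq> 0" by (simp add: Gamma_eq_zero_iff not_nonpos_Ints_if_Re_pos)
    moreover have "A (n - 1) = Gamma w" "Bt (n - 1) = Gamma w"
      unfolding A_def Bt_def i(2) w_def by simp_all
    ultimately show ?thesis by simp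
  qed
  have "{1..<n} = insert (n - 1) {1..n-2}" using n by auto
  moreover have "n - 1 \<notin> {1..n-2}" using n by auto
  ultimately have AB: "(\<Prod>i=1..<n. A i / Bt i) = (\<Prod>i=1..n-2. A i / Bt i)" using last by simp
  have "(\<Prod>p\<in>idx n. Gamma (a_weight wg wd p) *
       (if snd p = n then Gamma (wg p) * Gamma (wd p) / Gamma (wg p + wd p) else Gamma (wd p)))
    = (\<Prod>i=1..<n. A i / Bt i * (\<Prod>l=i+1..n. X i l * Y i l))"
    unfolding pi by (intro prod.cong refl) (simp only: snd_conv row)
  also have "\<dots> = (\<Prod>i=1..n-2. A i / Bt i) * (\<Prod>(k, l)\<in>idx n. X k l * Y k l)"
    unfolding prod.distrib[of _ _ "{1..<n}"] AB pi by simp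
  finally show ?thesis by (simp only: A_def Bt_def X_def Y_def)
qed

lemma analyticity_domain_nonempty: "analyticity_domain n \<noteq> {}"
proof -
  \<comment> \<open>With gamma = delta = h and l = k + 1 < n, positivity of \<open>xi\<close> says h
    k l > 2 h (k + 1) (l + 1), so the entries must shrink with k by a ratio below 1/2; 1/3 is such a
    ratio.\<close>
  define h :: "nat \<Rightarrow> nat \<Rightarrow> real" where "h k l = real (l - k) / 3 ^ k" for k l
  define g where "g = (\<lambda>p\<in>idx n. complex_of_real (h (fst p) (snd p)))"
  have e: "entry n g k l = of_real (h k l)" if "1 \<le> k" "l \<le> n" for k l
    using that by (cases "k < l") (auto simp: entry_def g_def idx_def h_def)
  have "(g, g) \<in> analyticity_domain n"
    unfolding analyticity_domain_def
  proof -
    have "g \<in> idx n \<rightarrow>\<^sub>E UNIV" by (simp add: g_def)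
    moreover have "\<forall>(k, l)\<in>idx n. 0 < Re (entry n g k l) \<and> 0 < Re (xi n g g k l) \<and> 0 < Re (eta n g g k l) \<and>
       Re (entry n g (Suc k) l) < Re (entry n g k l)"
    proof clarify
      fix k l assume "(k, l) \<in> idx n"
      then have kl: "1 \<le> k" "k < l" "l \<le> n" by (auto simp: idx_def)
      obtain m where m: "l = Suc (k + m)" using kl(2) less_iff_Suc_add by auto
      have p: "(3::real) ^ k > 0" by simp
      have h: "h k l = real (Suc m) / 3 ^ k" "h (Suc k) l = real m / 3 ^ k / 3"
        "h k (Suc l) = real (Suc (Suc m)) / 3 ^ k" "h (Suc k) (Suc l) = real (Suc m) / 3 ^ k / 3"
        by (simp_all add: h_def m field_simps)
      show "0 < Re (entry n g k l) \<and> 0 < Re (xi n g g k l) \<and> 0 < Re (eta n g g k l) \<and>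
         Re (entry n g (Suc k) l) < Re (entry n g k l)"
      proof (cases "l < n")
        case True
        then show ?thesis using kl p
          by (simp add: xi_def eta_def e h) (simp add: field_simps, intro conjI add_pos_nonneg, simp_all)
      next
        case False
        then have "l = n" using kl by simp
        then show ?thesis using kl p
          by (simp add: xi_def eta_def e[of _ n] h[unfolded \<open>l = n\<close>]) (simp add: field_simps)
      qed
    qed
    ultimately show "(g, g) \<in> {(g, d) \<in> (idx n \<rightarrow>\<^sub>E UNIV) \<times> (idx n \<rightarrow>\<^sub>E UNIV). \<forall>(k, l)\<in>idx n.
        Re (entry n g k l) > 0 \<and> Re (entry n d k l) > 0 \<and>
        Re (xi n g d k l) > 0 \<and> Re (eta n g d k l) > 0 \<and>
        Re (entry n g k l - entry n g (k+1) l) > 0 \<and>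
        Re (entry n d k l - entry n d (k+1) l) > 0}" by auto
  qed
  then show ?thesis by blast
qed

lemma entry_upd_analytic:
  "(\<lambda>z. entry n (g(p := z)) k l) analytic_on S"
  unfolding entry_def by (cases "(k, l) = p"; cases "1 \<le> k \<and> k < l \<and> l \<le> n") (auto intro!: analytic_intros)

lemma Gamma_analytic_at:
  assumes "f analytic_on {a}" "Re (f a) > 0"
  shows "(\<lambda>z. Gamma (f z)) analytic_on {a}"
  using assms by (intro analytic_on_Gamma') (auto simp: not_nonpos_Ints_if_Re_pos)

text \<open>\<open>G\<close> and \<open>D\<close> depend on a parameter so that varying one gamma
  and varying one delta are both instances. Denominators are rewritten with the entire function
  \<open>rGamma\<close>; all numerators have arguments with positive real part at
  \<open>a\<close>.\<close>

lemma mb_integrand_analytic: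
  fixes G D :: "complex \<Rightarrow> carray"
  assumes dom: "(G a, D a) \<in> analyticity_domain n"
    and G: "\<And>k l. (\<lambda>z. entry n (G z) k l) analytic_on {a}" and D: "\<And>k l. (\<lambda>z. entry n (D z) k l) analytic_on {a}"
  shows "(\<lambda>z. mb_integrand n lam x (G z) (D z)) analytic_on {a}"
proof -
  have xi: "(\<lambda>z. xi n (G z) (D z) k l) analytic_on {a}" for k l
    unfolding xi_def by (cases "l < n") (auto intro!: analytic_intros G D)
  have eta: "(\<lambda>z. eta n (G z) (D z) k l) analytic_on {a}" for k l
    unfolding eta_def by (cases "l < n") (auto intro!: analytic_intros G D)
  have H: "(\<lambda>z. H_fun n x (G z) (D z)) analytic_on {a}"
    unfolding H_fun_def by (intro analytic_intros G D)
  have r: "u / Gamma v = u * rGamma v" for u v :: complex by (simp add: Gamma_def divide_inverse)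
  have f0: "(\<lambda>z. Gamma (entry n (G z) k (k + 1) + entry n (D z) k (k + 1) + 2 * \<i> * complex_of_real (lam k))
      * rGamma (entry n (G z) k n + entry n (D z) k n - entry n (G z) (k + 1) n - entry n (D z) (k + 1) n + 2 * \<i> * complex_of_real (lam k))) analytic_on {a}"
    if "k \<in> {1..n-2}" for k
  proof -
    have "(k, k + 1) \<in> idx n" using that by (auto simp: idx_def)
    from domain_Re(1,2)[OF dom this]
    have "Re (entry n (G a) k (k + 1) + entry n (D a) k (k + 1) + 2 * \<i> * complex_of_real (lam k)) > 0" by simp
    then show ?thesis by (intro analytic_intros Gamma_analytic_at G D)
  qed
  have f1: "(\<lambda>z. Gamma (xi n (G z) (D z) k l + \<i> * complex_of_real (lam k - lam l))
          * Gamma (eta n (G z) (D z) k l + \<i> * complex_of_real (lam k + lam l))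
          * Gamma (entry n (G z) k l - entry n (G z) (k+1) l)
          * Gamma (entry n (D z) k l - entry n (D z) (k+1) l)) analytic_on {a}"
    if p: "(k, l) \<in> idx n" for k l
  proof -
    note dr = domain_Re[OF dom p]
    have "Re (xi n (G a) (D a) k l + \<i> * complex_of_real (lam k - lam l)) > 0"
      "Re (eta n (G a) (D a) k l + \<i> * complex_of_real (lam k + lam l)) > 0"
      using dr by auto
    with dr(5,6) show ?thesis by (intro analytic_on_mult Gamma_analytic_at analytic_on_add analytic_on_diff analytic_on_const G D xi eta)
  qed
  show ?thesis
    unfolding mb_integrand_def r case_prod_unfold
    by (intro f0 f1 H analytic_on_mult analytic_on_prod analytic_intros) auto
qed

section \<open>The wave integrand in logarithmic coordinates\<close>

lemma X_mat_cong:
  assumes "\<And>p. p \<in> idx n \<Longrightarrow> t p = t' p \<and> s p = s' p"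
  shows "X_mat n t s = X_mat n t' s'"
proof -
  have "row_word n t s i = row_word n t' s' i" if "i \<in> set (rev [1..<n])" for i
    using that assms by (auto simp: row_word_def idx_def)
  then have "full_word n t s = full_word n t' s'"
    unfolding full_word_def by (intro arg_cong[where f = concat] map_cong refl)
  then show ?thesis by (simp add: X_mat_def)
qed

lemma wave_integrand_cong:
  assumes "\<And>p. p \<in> idx n \<Longrightarrow> t p = t' p \<and> s p = s' p"
  shows "wave_integrand n lam x (t, s) = wave_integrand n lam x (t', s')"
proof -
  have "(\<Prod>(i, j)\<in>idx n. t (i, j) ^ (j - i) * s (i, j) ^ (2*n - i - j) * (1 / t (i, j)) * (1 / s (i, j)))
     = (\<Prod>(i, j)\<in>idx n. t' (i, j) ^ (j - i) * s' (i, j) ^ (2*n - i - j) * (1 / t' (i, j)) * (1 / s' (i, j)))"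
    using assms by (intro prod.cong refl) auto
  then show ?thesis
    unfolding wave_integrand_def using X_mat_cong[OF assms] by (simp only: prod.case)
qed

lemma torus_char_exp:
  "torus_char n mu (\<lambda>k. exp (r k)) = exp (\<Sum>k=1..n. mu k * of_real (r k))"
  "cnj (torus_char n mu (\<lambda>k. exp (r k))) = exp (\<Sum>k=1..n. cnj (mu k) * of_real (r k))"
proof -
  have p: "complex_of_real (exp u) powr w = exp (w * of_real u)" for u w
    by (simp add: powr_def Ln_of_real flip: exp_of_real)
  then show "torus_char n mu (\<lambda>k. exp (r k)) = exp (\<Sum>k=1..n. mu k * of_real (r k))"
    by (simp add: torus_char_def exp_sum)
  then show "cnj (torus_char n mu (\<lambda>k. exp (r k))) = exp (\<Sum>k=1..n. cnj (mu k) * of_real (r k))"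
    by (simp add: exp_cnj)
qed

text \<open>Minus the logarithm of the factor which each parameter acquires when exp (- h(x)) is
  moved to the left through X(t,s).\<close>

definition shift_of :: "nat \<Rightarrow> (nat \<Rightarrow> real) \<Rightarrow> slot \<Rightarrow> real" where
  "shift_of n x k = (case k of ((i, l), b) \<Rightarrow> if b \<and> l = n then - (x (n - 1) + x n) else x l - x (l - 1))"

text \<open>The conjugated left vector times the powers from the measure, which is the part of the
  integrand independent of x. Its modulus is not 1 in general.\<close>

definition phase :: "nat \<Rightarrow> (nat \<Rightarrow> real) \<Rightarrow> (slot \<Rightarrow> real) \<Rightarrow> complex" where
  "phase n lam y = exp ((\<Sum>k=1..n. cnj (whittaker_param n lam k) * of_real (log_torus n y k))
     - (\<Sum>(i, l)\<in>idx n. of_nat (l - i) * of_real (y ((i, l), False)) + of_nat (2*n - i - l) * of_real (y ((i, l), True)))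
     - of_real (\<Sum>p\<in>idx n. p_g n (g_of y) (d_of y) p + p_d n (g_of y) (d_of y) p))"

lemma node_ratio_shift:
  fixes x :: "nat \<Rightarrow> real"
  assumes "(i, l) \<in> idx n"
  defines "T \<equiv> \<lambda>k. exp (- x k) :: real"
  shows "l < n \<Longrightarrow> node_ratio n T (Lin (l - 1)) = exp (- shift_of n x ((i, l), b))"
    and "l = n \<Longrightarrow> node_ratio n T (Spin s) = exp (- shift_of n x ((i, l), s \<noteq> 1))"
proof -
  have il: "1 \<le> i" "i < l" "l \<le> n" using assms by (auto simp: idx_def)
  show "node_ratio n T (Lin (l - 1)) = exp (- shift_of n x ((i, l), b))" if "l < n"
    using il that by (simp add: node_ratio_def torus_val_def T_def shift_of_def of_nat_diff exp_diff[symmetric] nat_diff_distrib)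
  show "node_ratio n T (Spin s) = exp (- shift_of n x ((i, l), s \<noteq> 1))" if "l = n"
    using il that by (simp add: node_ratio_def torus_val_def T_def shift_of_def of_nat_diff exp_diff[symmetric] nat_diff_distrib
        exp_minus[symmetric] exp_add[symmetric])
qed

text \<open>Moving exp (- h(x)) to the left of X(t,s) gives a factorization with Y = 1 and hence the
  right vector; the left vector is \<open>left_whittaker_formula\<close>. The Jacobian exp (- y)
  cancels the denominators of dt/t and ds/s.\<close>

lemma wave_integrand_log:
  assumes n: "n \<ge> 2"
  shows "(\<Prod>k\<in>slots n. exp (- y k)) *\<^sub>R wave_integrand n lam x (gpart n (g_of y) (d_of y), dpart n (g_of y) (d_of y))
    = torus_char n (whittaker_param n lam) (\<lambda>k. exp (- x k)) * (phase n lam y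
        * (\<Prod>k\<in>slots n. of_real (exp (- exp (- (y k + shift_of n x k))))))"
proof -
  define g d where "g = g_of y" and "d = d_of y"
  define t s where "t = gpart n g d" and "s = dpart n g d"
  define mu where "mu = whittaker_param n lam"
  define T where "T = (\<lambda>k. exp (- x k) :: real)"
  have gd: "g p > 0" "d p > 0" for p by (simp_all add: g_def d_def g_of_def d_of_def)
  then have ts: "t p > 0" "s p > 0" for p by (simp_all add: t_def s_def gpart_def dpart_def)
  have pa: "positive_array n g" "positive_array n d" using gd by (simp_all add: positive_array_def)
  have left: "cnj (left_whittaker n mu (X_mat n t s))
     = exp (\<Sum>k=1..n. cnj (mu k) * of_real (log_torus n y k)) * of_real (exp (- (\<Sum>p\<in>idx n. p_g n g d p + p_d n g d p)))"
  proof -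
    have "fin_torus n g d = (\<lambda>k. exp (log_torus n y k))"
      by (simp add: g_def d_def fin_torus_exp log_torus_def fun_eq_iff)
    then show ?thesis
      unfolding t_def s_def left_whittaker_formula[OF n pa] complex_cnj_mult by (simp add: torus_char_exp(2) exp_char_def)
  qed
  define t' s' where "t' p = t p * node_ratio n T (t_node n p)" and "s' p = s p * node_ratio n T (s_node n p)" for p
  \<comment> \<open>The equality is one of sums: where \<open>sw\<close> holds, the two summands are
    exchanged.\<close>
  have sum': "t' p + s' p = exp (- (y (p, False) + shift_of n x (p, False))) + exp (- (y (p, True) + shift_of n x (p, True)))"
    if p: "p \<in> idx n" for p
  proof -
    obtain i l where il: "p = (i, l)" by force
    have l: "l \<le> n" using p by (auto simp: il idx_def)
    note nr = node_ratio_shift[OF p[unfolded il], where x = x, folded T_def]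
    have G: "g p = exp (- y (p, False))" and D: "d p = exp (- y (p, True))" by (simp_all add: g_def d_def g_of_def d_of_def)
    have E: "exp (- (u + v)) = exp (- u) * exp (- v)" for u v :: real by (simp add: exp_add[symmetric])
    show ?thesis
    proof (cases "l = n")
      case True
      then show ?thesis unfolding E G[symmetric] D[symmetric]
        by (cases "even (n - i)")
           (simp_all add: t'_def s'_def t_def s_def gpart_def dpart_def sw_def il t_node_def s_node_def nr(2) sgn_pow_eq)
    next
      case False
      then show ?thesis unfolding E G[symmetric] D[symmetric] using l nr(1)[where b = False] nr(1)[where b = True]
        by (simp add: t'_def s'_def t_def s_def gpart_def dpart_def sw_def il t_node_def s_node_def)
    qed
  qed
  have T0: "positive_torus n T" by (simp add: positive_torus_def T_def)
  have nr_pos: "node_ratio n T a > 0" for a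
    by (cases a) (auto simp: node_ratio_def torus_val_def T_def)
  have right: "right_whittaker n mu (X_mat n t s * mat_exp (- cartan_mat n x)) = torus_char n mu T * exp_char n t' s'"
  proof (rule right_whittaker_eq[OF n one_lower_unipotent T0])
    show "positive_array n t'" "positive_array n s'" using ts nr_pos by (simp_all add: positive_array_def t'_def s'_def)
    have X: "X_mat n t s * torus_mat n T = torus_mat n T * X_mat n t' s'"
      unfolding t'_def[abs_def] s'_def[abs_def] by (rule X_mat_torus[OF n]) (simp add: T_def)
    have c: "torus_mat n T \<in> carrier_mat (2*n) (2*n)" by (simp add: torus_mat_def)
    show "X_mat n t s * mat_exp (- cartan_mat n x) = 1\<^sub>m (2*n) * torus_mat n T * X_mat n t' s'"
      unfolding mat_exp_cartan T_def[symmetric] X left_mult_one_mat[OF c] ..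
  qed
  have ex: "exp_char n t' s' = (\<Prod>k\<in>slots n. of_real (exp (- exp (- (y k + shift_of n x k)))))"
  proof -
    have "(\<Sum>p\<in>idx n. t' p + s' p) = (\<Sum>k\<in>slots n. exp (- (y k + shift_of n x k)))"
      unfolding sum_slots by (intro sum.cong refl sum')
    then show ?thesis by (simp add: exp_char_def sum_negf[symmetric] exp_sum del: sum_negf)
  qed
  have mono: "(\<Prod>k\<in>slots n. exp (- y k)) * (\<Prod>(i, j)\<in>idx n. t (i, j) ^ (j - i) * s (i, j) ^ (2*n - i - j) * (1 / t (i, j)) * (1 / s (i, j)))
     = exp (- (\<Sum>(i, l)\<in>idx n. of_nat (l - i) * y ((i, l), False) + of_nat (2*n - i - l) * y ((i, l), True)))"
    unfolding prod_slots prod.distrib[symmetric] sum_negf[symmetric] exp_sum[OF finite_idx]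
  proof (intro prod.cong refl)
    fix p assume p: "p \<in> idx n"
    obtain i l where il: "p = (i, l)" by force
    have l: "i < l" "l \<le> n" using p by (auto simp: il idx_def)
    have "exp (- y (p, False)) * exp (- y (p, True)) = t p * s p"
      by (simp add: t_def s_def gpart_def dpart_def g_def d_def g_of_def d_of_def)
    then have "exp (- y (p, False)) * exp (- y (p, True)) * (t p ^ (l - i) * s p ^ (2*n - i - l) * (1 / t p) * (1 / s p))
       = t p ^ (l - i) * s p ^ (2*n - i - l)"
      using ts[of p] by simp
    also have "\<dots> = g p ^ (l - i) * d p ^ (2*n - i - l)"
      using l by (auto simp: t_def s_def gpart_def dpart_def sw_def il)
    also have "\<dots> = exp (- (of_nat (l - i) * y (p, False) + of_nat (2*n - i - l) * y (p, True)))"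
      by (simp add: g_def d_def g_of_def d_of_def exp_of_nat_mult[symmetric] exp_add[symmetric])
    finally show "exp (- y (p, False)) * exp (- y (p, True)) *
       (case p of (i, j) \<Rightarrow> t (i, j) ^ (j - i) * s (i, j) ^ (2*n - i - j) * (1 / t (i, j)) * (1 / s (i, j)))
      = exp (- (case p of (i, l) \<Rightarrow> of_nat (l - i) * y ((i, l), False) + of_nat (2*n - i - l) * y ((i, l), True)))"
      by (simp add: il)
  qed
  have ph: "phase n lam y = exp (\<Sum>k=1..n. cnj (mu k) * of_real (log_torus n y k))
      * of_real (exp (- (\<Sum>(i, l)\<in>idx n. of_nat (l - i) * y ((i, l), False) + of_nat (2*n - i - l) * y ((i, l), True))))
      * of_real (exp (- (\<Sum>p\<in>idx n. p_g n g d p + p_d n g d p)))"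
    unfolding phase_def mu_def g_def d_def exp_of_real[symmetric] exp_add[symmetric]
    by (simp add: case_prod_unfold)
  have "(\<Prod>k\<in>slots n. exp (- y k)) *\<^sub>R wave_integrand n lam x (t, s)
     = cnj (left_whittaker n mu (X_mat n t s)) * right_whittaker n mu (X_mat n t s * mat_exp (- cartan_mat n x))
       * of_real ((\<Prod>k\<in>slots n. exp (- y k)) * (\<Prod>(i, j)\<in>idx n. t (i, j) ^ (j - i) * s (i, j) ^ (2*n - i - j) * (1 / t (i, j)) * (1 / s (i, j))))"
    by (simp add: wave_integrand_def mu_def scaleR_conv_of_real)
  also have "\<dots> = torus_char n mu T * (phase n lam y * (\<Prod>k\<in>slots n. of_real (exp (- exp (- (y k + shift_of n x k))))))"
    unfolding left right ex mono ph by (simp only: ac_simps)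
  finally show ?thesis by (simp only: t_def s_def g_def d_def mu_def T_def)
qed

lemma phase_weights:
  assumes "n \<ge> 2"
  shows "phase n lam y * exp (\<Sum>p\<in>idx n. z_g n G p * of_real (y (p, False)) + z_g n D p * of_real (y (p, True)))
    = exp ((\<Sum>p\<in>idx n. w_g n lam G D p * of_real (lg n y p) + w_d n lam G D p * of_real (ld n y p))
      - of_real (\<Sum>p\<in>idx n. p_g n (g_of y) (d_of y) p + p_d n (g_of y) (d_of y) p))"
proof -
  have f: "(\<Sum>(i, l)\<in>idx n. (z_g n G (i, l) - of_nat (l - i)) * of_real (y ((i, l), False))
          + (z_g n D (i, l) - of_nat (2*n - i - l)) * of_real (y ((i, l), True)))
    = (\<Sum>p\<in>idx n. z_g n G p * of_real (y (p, False)) + z_g n D p * of_real (y (p, True)))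
      - (\<Sum>(i, l)\<in>idx n. of_nat (l - i) * of_real (y ((i, l), False)) + of_nat (2*n - i - l) * of_real (y ((i, l), True)))"
    unfolding sum_subtractf[symmetric] by (intro sum.cong refl) (auto simp: algebra_simps)
  show ?thesis
    unfolding exponent_identity[OF assms] phase_def exp_add[symmetric] f by (rule arg_cong[where f = exp]) simp
qed

section \<open>Arrays and slots\<close>

text \<open>\<open>w\<close> selects the slot of the first array: \<open>sw n\<close> sorts (t, s)
  into \<open>g\<close> and \<open>d\<close>, while the constant \<open>False\<close> sends gamma
  and delta to their own slots.\<close>

definition join :: "nat \<Rightarrow> (nat \<times> nat \<Rightarrow> bool) \<Rightarrow> rarray \<times> rarray \<Rightarrow> slot \<Rightarrow> real" where
  "join n w ts = (\<lambda>k\<in>slots n. if snd k = w (fst k) then fst ts (fst k) else snd ts (fst k))"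

text \<open>\<open>join\<close> undoes the map of \<open>distr_PiR_bool\<close>, which is already
  known to carry one measure to the other.\<close>

lemma distr_join:
  "join n w \<in> measurable (array_measure n) (PiR (slots n)) \<and> distr (array_measure n) (PiR (slots n)) (join n w) = PiR (slots n)"
proof -
  let ?S = "\<lambda>x. (\<lambda>p\<in>idx n. x (p, w p), \<lambda>p\<in>idx n. x (p, \<not> w p))"
  have mj: "join n w \<in> measurable (array_measure n) (PiR (slots n))"
    unfolding join_def array_measure_def
  proof (rule measurable_restrict)
    fix k assume "k \<in> slots n"
    then have k: "fst k \<in> idx n" by (cases k) simp
    have "(\<lambda>ts. fst ts (fst k)) \<in> measurable (PiR (idx n) \<Otimes>\<^sub>M PiR (idx n)) lborel"
      "(\<lambda>ts. snd ts (fst k)) \<in> measurable (PiR (idx n) \<Otimes>\<^sub>M PiR (idx n)) lborel"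
      using measurable_compose[OF measurable_fst measurable_component_singleton[OF k, of "\<lambda>_. lborel"]]
        measurable_compose[OF measurable_snd measurable_component_singleton[OF k, of "\<lambda>_. lborel"]] by auto
    then show "(\<lambda>ts. if snd k = w (fst k) then fst ts (fst k) else snd ts (fst k)) \<in> measurable (PiR (idx n) \<Otimes>\<^sub>M PiR (idx n)) lborel"
      by (cases "snd k = w (fst k)") auto
  qed
  have mS: "?S \<in> measurable (PiR (slots n)) (array_measure n)"
    unfolding array_measure_def
    by (intro measurable_Pair measurable_restrict measurable_component_singleton) auto
  have A: "array_measure n = distr (PiR (slots n)) (array_measure n) ?S"
    using distr_PiR_bool[of "idx n" w] by (simp add: array_measure_def slots_def)
  have "distr (array_measure n) (PiR (slots n)) (join n w)
     = distr (distr (PiR (slots n)) (array_measure n) ?S) (PiR (slots n)) (join n w)"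
    by (simp only: A[symmetric])
  also have "\<dots> = distr (PiR (slots n)) (PiR (slots n)) (join n w \<circ> ?S)"
    by (rule distr_distr[OF mj mS])
  also have "\<dots> = distr (PiR (slots n)) (PiR (slots n)) (\<lambda>x. x)"
  proof (rule distr_cong; simp)
    fix x :: "slot \<Rightarrow> real" assume x: "x \<in> space (PiR (slots n))"
    show "join n w (?S x) = x"
    proof
      fix k :: slot
      obtain p b where k: "k = (p, b)" by (metis surj_pair)
      show "join n w (?S x) k = x k"
      proof (cases "p \<in> idx n")
        case True
        then show ?thesis by (cases "b = w p") (auto simp: join_def k)
      next
        case False
        then have "k \<notin> slots n" by (simp add: k)
        moreover have "x \<in> extensional (slots n)" using x by (simp add: space_PiM PiE_def)
        ultimately show ?thesis using extensional_arb[of x "slots n" k] by (simp add: join_def)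
      qed
    qed
  qed
  also have "\<dots> = PiR (slots n)" by (rule distr_id2) simp
  finally show ?thesis using mj by blast
qed

lemma integral_array_slots:
  fixes F :: "rarray \<times> rarray \<Rightarrow> complex"
  assumes m: "F' \<in> borel_measurable (PiR (slots n))"
    and eq: "\<And>ts. ts \<in> space (array_measure n) \<Longrightarrow> F ts = F' (join n w ts)"
  shows "integrable (array_measure n) F \<longleftrightarrow> integrable (PiR (slots n)) F'"
    and "(LINT ts|array_measure n. F ts) = (LINT x|PiR (slots n). F' x)"
proof -
  note J = distr_join[of n w]
  have "integrable (array_measure n) F \<longleftrightarrow> integrable (array_measure n) (\<lambda>ts. F' (join n w ts))"
    by (intro Bochner_Integration.integrable_cong refl eq)
  then show "integrable (array_measure n) F \<longleftrightarrow> integrable (PiR (slots n)) F'"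
    using integrable_distr_eq[OF conjunct1[OF J] m] J by simp
  have "(LINT ts|array_measure n. F ts) = (LINT ts|array_measure n. F' (join n w ts))"
    by (intro Bochner_Integration.integral_cong refl eq)
  then show "(LINT ts|array_measure n. F ts) = (LINT x|PiR (slots n). F' x)"
    using integral_distr[OF conjunct1[OF J] m] J by simp
qed

lemma card_slots: "card (slots n) = n * (n - 1)"
proof -
  have "card (slots n) = 2 * card (idx n)" by (simp add: slots_def card_cartesian_product)
  also have "card (idx n) = (\<Sum>i=1..<n. n - i)" by (simp add: idx_Sigma)
  also have "2 * (\<Sum>i=1..<n. n - i) = n * (n - 1)"
  proof (induction n)
    case (Suc n)
    have "(\<Sum>i=1..<Suc n. Suc n - i) = (\<Sum>i=1..<Suc n. (n - i) + 1)" by (intro sum.cong) auto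
    also have "\<dots> = (\<Sum>i=1..<n. n - i) + n" by (simp only: sum.distrib) (cases n; simp)
    finally show ?case using Suc by (cases n) auto
  qed simp
  finally show ?thesis .
qed

section \<open>The Mellin--Barnes integral\<close>

definition rentry :: "nat \<Rightarrow> rarray \<Rightarrow> nat \<Rightarrow> nat \<Rightarrow> real" where
  "rentry n a k l = (if 1 \<le> k \<and> k < l \<and> l \<le> n then a (k, l) else 0)"

lemma entry_plane_point: "entry n (plane_point n a y) k l = Complex (rentry n a k l) (rentry n y k l)"
  by (auto simp: entry_def rentry_def plane_point_def idx_def Complex_eq)

definition rdiff :: "nat \<Rightarrow> rarray \<Rightarrow> rarray" where
  "rdiff n a = (\<lambda>(i, l). rentry n a i l - rentry n a (i + 1) l)"

lemma z_g_plane_point: "z_g n (plane_point n a y) p = Complex (rdiff n a p) (rdiff n y p)"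
  by (cases p) (simp add: z_g_def rdiff_def entry_plane_point complex_eq_iff)

lemma plane_point_vertical: "(plane_point n a y, plane_point n b z) \<in> vertical_plane n a b"
  by (auto simp: vertical_plane_def plane_point_def)

text \<open>The differences in each column telescope to the entry in the first row.\<close>

lemma H_fun_columns:
  assumes n: "n \<ge> 2"
  shows "(\<Sum>p\<in>idx n. z_g n G p * of_real (shift_of n x (p, False)) + z_g n D p * of_real (shift_of n x (p, True))) = H_fun n x G D"
proof -
  define c d where "c l = complex_of_real (x l - x (l - 1))"
    and "d l = complex_of_real (if l = n then - (x (n - 1) + x n) else x l - x (l - 1))" for l
  have tel: "(\<Sum>i=1..<l. entry n A i l - entry n A (i + 1) l) = entry n A 1 l" if "1 \<le> l" for A :: carray and l
  proof -
    have "(\<Sum>i=1..<m. entry n A i l - entry n A (i + 1) l) = entry n A 1 l - entry n A m l" if "1 \<le> m" for m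
      using that by (induction m rule: dec_induct) auto
    from this[OF \<open>1 \<le> l\<close>] show ?thesis by simp
  qed
  have "(\<Sum>p\<in>idx n. z_g n G p * of_real (shift_of n x (p, False)) + z_g n D p * of_real (shift_of n x (p, True)))
     = (\<Sum>l=1..n. \<Sum>i=1..<l. (entry n G i l - entry n G (i + 1) l) * c l + (entry n D i l - entry n D (i + 1) l) * d l)"
    unfolding sum_idx_col by (simp only: z_g_def shift_of_def c_def d_def prod.case simp_thms if_False)
  also have "\<dots> = (\<Sum>l=1..n. entry n G 1 l * c l + entry n D 1 l * d l)"
    by (intro sum.cong refl) (simp only: sum.distrib sum_distrib_right[symmetric] tel atLeastAtMost_iff)
  \<comment> \<open>The term at l = 1 contains \<open>x 0\<close>, but the entries at (1, 1) are 0
    by convention.\<close>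
  also have "{1..n} = insert 1 (insert n {2..<n})" using n by auto
  also have "(\<Sum>l\<in>insert 1 (insert n {2..<n}). entry n G 1 l * c l + entry n D 1 l * d l)
     = entry n G 1 n * c n + entry n D 1 n * d n + (\<Sum>l=2..<n. entry n G 1 l * c l + entry n D 1 l * d l)"
    using n by simp
  also have "(\<Sum>l=2..<n. entry n G 1 l * c l + entry n D 1 l * d l) = (\<Sum>l=2..<n. (entry n G 1 l + entry n D 1 l) * complex_of_real (x l - x (l - 1)))"
    by (intro sum.cong refl) (simp add: c_def d_def distrib_right)
  finally show ?thesis by (simp add: H_fun_def c_def d_def algebra_simps)
qed

text \<open>Read from the bottom of each column upwards, the map is a shear: entry k is shifted by
  entry k + 1.\<close>

lemma distr_rdiff:
  fixes n :: nat
  defines "B \<equiv> \<lambda>v. \<lambda>k\<in>slots n. rdiff n (\<lambda>p. v (p, snd k)) (fst k)"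
  shows "B \<in> measurable (PiR (slots n)) (PiR (slots n)) \<and> distr (PiR (slots n)) (PiR (slots n)) B = PiR (slots n)"
proof -
  let ?M = "PiR (slots n)"
  define h where "h k v = - rentry n (\<lambda>p. v (p, snd k)) (fst (fst k) + 1) (snd (fst k))" for k :: slot and v
  have comp: "(\<lambda>y. y k) \<in> borel_measurable ?M" if "k \<in> slots n" for k
    using measurable_component_singleton[OF that, of "\<lambda>_. lborel"] by simp
  have mh: "h k \<in> borel_measurable ?M" for k
  proof (cases "fst (fst k) + 1 < snd (fst k) \<and> snd (fst k) \<le> n")
    case True
    then have "((fst (fst k) + 1, snd (fst k)), snd k) \<in> slots n" by (simp add: idx_def)
    from comp[OF this] show ?thesis using True by (simp add: h_def[abs_def] rentry_def)
  next
    case False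
    then have "h k = (\<lambda>_. 0)" by (auto simp: h_def rentry_def)
    then show ?thesis by simp
  qed
  have B: "B = (\<lambda>v. \<lambda>k\<in>slots n. v k + h k v)"
    by (auto simp: B_def h_def rdiff_def rentry_def slots_def idx_def fun_eq_iff restrict_def)
  have "distr ?M ?M (\<lambda>v. \<lambda>k\<in>slots n. v k + h k v) = ?M"
  proof (rule distr_PiR_triangular[where r = "\<lambda>k. n - fst (fst k)"])
    fix k and u v :: "slot \<Rightarrow> real" assume k: "k \<in> slots n"
      and eq: "\<forall>j\<in>slots n. n - fst (fst j) < n - fst (fst k) \<longrightarrow> u j = v j"
    have "u ((fst (fst k) + 1, snd (fst k)), snd k) = v ((fst (fst k) + 1, snd (fst k)), snd k)"
      if "fst (fst k) + 1 < snd (fst k)" "snd (fst k) \<le> n"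
      using that by (intro eq[rule_format]) (auto simp: idx_def)
    then show "h k u = h k v" by (simp add: h_def rentry_def)
  qed (use mh in auto)
  moreover have "(\<lambda>v. \<lambda>k\<in>slots n. v k + h k v) \<in> measurable ?M ?M"
    using mh comp by (intro measurable_restrict) auto
  ultimately show ?thesis by (simp add: B)
qed

text \<open>Every factor \<open>exp (- exp (- (y k + shift_of n x k)))\<close> is written as a Mellin integral. After
  interchanging the integrations, the inner integral over \<open>y\<close> is the decoupled one; absolute
  convergence holds because the modulus of the double integrand is a product of a function of \<open>y\<close> and
  a function of \<open>v\<close>.\<close>

lemma mellin_barnes:
  fixes lam x :: "nat \<Rightarrow> real" and a b :: rarray
  assumes n: "n \<ge> 2" and sub: "vertical_plane n a b \<subseteq> analyticity_domain n"
  defines "mb \<equiv> \<lambda>v. mb_integrand n lam x (plane_point n a (\<lambda>p. v (p, False))) (plane_point n b (\<lambda>p. v (p, True)))"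
    and "Q \<equiv> \<lambda>y. phase n lam y * (\<Prod>k\<in>slots n. of_real (exp (- exp (- (y k + shift_of n x k)))))"
  shows "integrable (PiR (slots n)) mb" and "integrable (PiR (slots n)) Q"
    and "(LINT v|PiR (slots n). mb v) = of_real ((2 * pi) ^ (n * (n - 1))) * (LINT y|PiR (slots n). Q y)"
proof -
  let ?M = "PiR (slots n)"
  have sf: "sigma_finite_measure ?M" by (rule PiR.sigma_finite) simp
  interpret P: pair_sigma_finite ?M ?M using sf by (simp add: pair_sigma_finite_def)
  define G where "G v = plane_point n a (\<lambda>p. v (p, False))" for v :: "slot \<Rightarrow> real"
  define D where "D v = plane_point n b (\<lambda>p. v (p, True))" for v :: "slot \<Rightarrow> real"
  have dom: "(G v, D v) \<in> analyticity_domain n" for v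
    using sub plane_point_vertical by (auto simp: G_def D_def)
  define al where "al k = rdiff n (if snd k then b else a) (fst k)" for k :: slot
  define B where "B v = (\<lambda>k\<in>slots n. rdiff n (\<lambda>p. v (p, snd k)) (fst k))" for v :: "slot \<Rightarrow> real"
  note Bp = distr_rdiff[of n, folded B_def[abs_def]]
  have zG: "z_g n (G v) p = Complex (al (p, False)) (B v (p, False))"
    and zD: "z_g n (D v) p = Complex (al (p, True)) (B v (p, True))" if "p \<in> idx n" for v p
    using that by (simp_all add: G_def D_def z_g_plane_point al_def B_def)
  have al: "al k > 0" if "k \<in> slots n" for k
  proof -
    obtain i l c where k: "k = ((i, l), c)" by (metis surj_pair)
    have p: "(i, l) \<in> idx n" using that by (simp add: k)
    have z: "Re (z_g n (G v) (i, l)) > 0" "Re (z_g n (D v) (i, l)) > 0" for v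
      using domain_Re(5,6)[OF dom p] by (simp_all add: z_g_def)
    show ?thesis using z[of "\<lambda>_. 0"] by (cases c) (simp_all add: zG[OF p] zD[OF p] k)
  qed
  define w where "w y k = y k + shift_of n x k" for y :: "slot \<Rightarrow> real" and k
  define f where "f y = phase n lam y * exp (of_real (\<Sum>k\<in>slots n. al k * w y k))" for y
  define gm where "gm v = (\<Prod>k\<in>slots n. Gamma (Complex (al k) (B v k)))" for v
  \<comment> \<open>The double integrand. Its modulus is carried by \<open>f\<close> and
    \<open>gm\<close>, since \<open>B v\<close> enters the remaining exponential through the
    imaginary part only.\<close>
  define R where "R = (\<lambda>(y, v). f y * gm v * iexp (\<Sum>k\<in>slots n. B v k * w y k))"
  define E where "E v y = exp ((\<Sum>p\<in>idx n. w_g n lam (G v) (D v) p * of_real (lg n y p) + w_d n lam (G v) (D v) p * of_real (ld n y p))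
      - of_real (\<Sum>p\<in>idx n. p_g n (g_of y) (d_of y) p + p_d n (g_of y) (d_of y) p))" for v y
  have E_phase: "phase n lam y * exp (\<Sum>k\<in>slots n. Complex (al k) (B v k) * of_real (y k)) = E v y" for v y
  proof -
    have "(\<Sum>k\<in>slots n. Complex (al k) (B v k) * of_real (y k))
       = (\<Sum>p\<in>idx n. z_g n (G v) p * of_real (y (p, False)) + z_g n (D v) p * of_real (y (p, True)))"
      unfolding sum_slots by (intro sum.cong refl) (simp only: zG zD)
    then show ?thesis using phase_weights[OF n, of lam y "G v" "D v"] by (simp only: E_def)
  qed
  have E_int: "integrable ?M (E v)" for v
    unfolding E_def[abs_def] by (rule decoupled_integral(1)[OF domain_weights[OF dom]])
  have R_prod: "R (y, v) = phase n lam y * (\<Prod>k\<in>slots n. Gamma (Complex (al k) (B v k)) * exp (Complex (al k) (B v k) * of_real (w y k)))" for y v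
  proof -
    have "exp (of_real (\<Sum>k\<in>slots n. al k * w y k)) * iexp (\<Sum>k\<in>slots n. B v k * w y k)
       = exp (\<Sum>k\<in>slots n. Complex (al k) (B v k) * of_real (w y k))"
      unfolding exp_add[symmetric] of_real_sum sum_distrib_left sum.distrib[symmetric]
      by (intro arg_cong[where f = exp] sum.cong refl) (simp add: Complex_eq algebra_simps)
    then show ?thesis
      by (simp add: R_def f_def gm_def prod.distrib exp_sum)
  qed
  have R_E: "R (y, v) = gm v * exp (\<Sum>k\<in>slots n. Complex (al k) (B v k) * of_real (shift_of n x k)) * E v y" for y v
  proof -
    have "(\<Prod>k\<in>slots n. exp (Complex (al k) (B v k) * of_real (w y k)))
       = exp (\<Sum>k\<in>slots n. Complex (al k) (B v k) * of_real (y k)) * exp (\<Sum>k\<in>slots n. Complex (al k) (B v k) * of_real (shift_of n x k))"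
      unfolding exp_sum[OF finite_slots] prod.distrib[symmetric]
      by (intro prod.cong refl) (simp add: w_def algebra_simps exp_add)
    then show ?thesis unfolding R_prod E_phase[symmetric] prod.distrib gm_def by simp
  qed
  \<comment> \<open>At v = 0 the Mellin variables are real and \<open>E\<close> is \<open>f\<close>
    up to a constant, so decoupling at this single point provides the majorant in y.\<close>
  have f_int: "integrable ?M f"
  proof -
    define v0 where "v0 = (\<lambda>_::slot. 0::real)"
    have B0: "B v0 k = 0" if "k \<in> slots n" for k
      using that by (cases k) (auto simp: B_def v0_def rdiff_def rentry_def split: prod.splits)
    have "f = (\<lambda>y. exp (of_real (\<Sum>k\<in>slots n. al k * shift_of n x k)) * E v0 y)"
    proof
      fix y
      have "(\<Sum>k\<in>slots n. Complex (al k) (B v0 k) * of_real (y k)) = of_real (\<Sum>k\<in>slots n. al k * y k)"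
        unfolding of_real_sum by (intro sum.cong refl) (simp add: B0 Complex_eq)
      moreover have "(\<Sum>k\<in>slots n. al k * w y k) = (\<Sum>k\<in>slots n. al k * shift_of n x k) + (\<Sum>k\<in>slots n. al k * y k)"
        unfolding w_def sum.distrib[symmetric] by (intro sum.cong refl) (simp add: algebra_simps)
      ultimately show "f y = exp (of_real (\<Sum>k\<in>slots n. al k * shift_of n x k)) * E v0 y"
        using E_phase[of y v0] by (simp only: f_def of_real_add exp_add) (simp add: mult.commute mult.left_commute)
    qed
    then show ?thesis using E_int[of v0] by simp
  qed
  define T where "T c u = (\<Prod>k\<in>slots n. Gamma (Complex (al k) (u k)) * exp (Complex (al k) (u k) * of_real (c k)))" for c u :: "slot \<Rightarrow> real"
  have T1: "integrable lborel (\<lambda>u. Gamma (Complex (al k) u) * exp (Complex (al k) u * of_real s))" if k: "k \<in> slots n" for k s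
  proof (rule Bochner_Integration.integrable_bound)
    show "integrable lborel (\<lambda>u. of_real (exp (al k * s)) * Gamma (Complex (al k) u))"
      using integrable_Gamma_vertical[OF al[OF k]] by simp
    have "(\<lambda>u. Gamma (Complex (al k) u)) \<in> borel_measurable lborel"
      using borel_measurable_integrable[OF integrable_Gamma_vertical[OF al[OF k]]] .
    moreover have "(\<lambda>u. exp (Complex (al k) u * of_real s)) \<in> borel_measurable lborel"
      unfolding Complex_eq by measurable
    ultimately show "(\<lambda>u. Gamma (Complex (al k) u) * exp (Complex (al k) u * of_real s)) \<in> borel_measurable lborel"
      by (rule borel_measurable_times)
  qed (simp add: norm_mult norm_exp_eq_Re)
  have T_int: "integrable ?M (T c)" and T_val: "(LINT u|?M. T c u) = (\<Prod>k\<in>slots n. of_real (2 * pi * exp (- exp (- c k))))" for c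
  proof -
    show "integrable ?M (T c)"
      unfolding T_def[abs_def] by (rule PiR.product_integrable_prod[OF finite_slots T1])
    have "(LINT u|?M. T c u) = (\<Prod>k\<in>slots n. LINT u|lborel. Gamma (Complex (al k) u) * exp (Complex (al k) u * of_real (c k)))"
      unfolding T_def[abs_def] by (rule PiR.product_integral_prod[OF finite_slots T1])
    then show "(LINT u|?M. T c u) = (\<Prod>k\<in>slots n. of_real (2 * pi * exp (- exp (- c k))))"
      using al by (simp add: mellin_inversion_exp)
  qed
  have gm_int: "integrable ?M gm"
  proof -
    have "gm = (\<lambda>v. T (\<lambda>_. 0) (B v))" by (simp add: gm_def T_def fun_eq_iff)
    then show ?thesis
      using integrable_distr_eq[OF conjunct1[OF Bp] borel_measurable_integrable[OF T_int[of "\<lambda>_. 0"]]] Bp T_int by simp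
  qed
  have R_int: "integrable (?M \<Otimes>\<^sub>M ?M) R"
  proof (rule Bochner_Integration.integrable_bound)
    show "integrable (?M \<Otimes>\<^sub>M ?M) (\<lambda>(y, v). f y * gm v)"
      by (rule integrable_pair_mult[OF sf sf f_int gm_int])
    have [measurable]: "f \<in> borel_measurable ?M" "gm \<in> borel_measurable ?M" using f_int gm_int by auto
    have [measurable]: "(\<lambda>y. w y k) \<in> borel_measurable ?M" "(\<lambda>v. B v k) \<in> borel_measurable ?M" if "k \<in> slots n" for k
    proof -
      have c: "(\<lambda>y. y k) \<in> borel_measurable ?M"
        using measurable_component_singleton[OF that, of "\<lambda>_. lborel"] by simp
      show "(\<lambda>y. w y k) \<in> borel_measurable ?M" unfolding w_def using c by simp
      show "(\<lambda>v. B v k) \<in> borel_measurable ?M" using measurable_compose[OF conjunct1[OF Bp] c] by simp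
    qed
    show "R \<in> borel_measurable (?M \<Otimes>\<^sub>M ?M)"
      unfolding R_def by measurable
    show "AE z in ?M \<Otimes>\<^sub>M ?M. norm (R z) \<le> norm (case z of (y, v) \<Rightarrow> f y * gm v)"
      by (rule AE_I2) (auto simp: R_def norm_mult)
  qed
  \<comment> \<open>Over v, the measure preserving map \<open>B\<close> makes the Mellin integrals
    independent, one for each slot.\<close>
  have inner_v: "(LINT v|?M. R (y, v)) = of_real ((2 * pi) ^ (n * (n - 1))) * Q y" for y
  proof -
    have "(LINT v|?M. R (y, v)) = (LINT v|?M. phase n lam y * T (w y) (B v))"
      by (simp add: R_prod T_def)
    also have "\<dots> = phase n lam y * (LINT v|?M. T (w y) (B v))" by (rule integral_mult_right_zero)
    also have "(LINT v|?M. T (w y) (B v)) = (LINT u|?M. T (w y) u)"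
      using integral_distr[OF conjunct1[OF Bp] borel_measurable_integrable[OF T_int[of "w y"]]] Bp by simp
    also have "\<dots> = of_real ((2 * pi) ^ (n * (n - 1))) * (\<Prod>k\<in>slots n. of_real (exp (- exp (- w y k))))"
      unfolding T_val of_real_mult[of "2 * pi"] prod.distrib by (simp add: card_slots)
    finally show ?thesis by (simp add: Q_def w_def)
  qed
  \<comment> \<open>Over y, the integrand is a multiple of \<open>E v\<close>, whose integral
    supplies all Gamma factors not contained in \<open>gm\<close>.\<close>
  have inner_y: "(LINT y|?M. R (y, v)) = mb v" for v
  proof -
    have g: "gm v = (\<Prod>(k, l)\<in>idx n. Gamma (entry n (G v) k l - entry n (G v) (k+1) l) * Gamma (entry n (D v) k l - entry n (D v) (k+1) l))"
      unfolding gm_def prod_slots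
    proof (intro prod.cong refl)
      fix p assume p: "p \<in> idx n"
      show "Gamma (Complex (al (p, False)) (B v (p, False))) * Gamma (Complex (al (p, True)) (B v (p, True)))
        = (case p of (k, l) \<Rightarrow> Gamma (entry n (G v) k l - entry n (G v) (k+1) l) * Gamma (entry n (D v) k l - entry n (D v) (k+1) l))"
        unfolding zG[OF p, symmetric] zD[OF p, symmetric] by (simp add: z_g_def case_prod_unfold)
    qed
    have h: "(\<Sum>k\<in>slots n. Complex (al k) (B v k) * of_real (shift_of n x k)) = H_fun n x (G v) (D v)"
      unfolding H_fun_columns[OF n, symmetric] sum_slots by (intro sum.cong refl) (simp only: zG zD)
    have "(LINT y|?M. R (y, v)) = (LINT y|?M. gm v * exp (H_fun n x (G v) (D v)) * E v y)"
      by (simp only: R_E h)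
    also have "\<dots> = gm v * exp (H_fun n x (G v) (D v)) * (LINT y|?M. E v y)" by (rule integral_mult_right_zero)
    also have "(LINT y|?M. E v y) = (\<Prod>p\<in>idx n. Gamma (a_weight (w_g n lam (G v) (D v)) (w_d n lam (G v) (D v)) p) *
       (if snd p = n then Gamma (w_g n lam (G v) (D v) p) * Gamma (w_d n lam (G v) (D v) p) / Gamma (w_g n lam (G v) (D v) p + w_d n lam (G v) (D v) p)
        else Gamma (w_d n lam (G v) (D v) p)))"
      unfolding E_def by (rule decoupled_integral(2)[OF domain_weights[OF dom]])
    also note gamma_product[OF n dom]
    finally show ?thesis
      unfolding g mb_def mb_integrand_def G_def[symmetric] D_def[symmetric]
      by (simp add: prod.distrib case_prod_unfold mult_ac)
  qed
  \<comment> \<open>Fubini also yields integrability of both inner integrals, that is of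
    \<open>Q\<close> up to a nonzero constant and of \<open>mb\<close>.\<close>
  have "integrable ?M (\<lambda>y. LINT v|?M. R (y, v))" by (rule P.integrable_fst'[OF R_int])
  then have c_int: "integrable ?M (\<lambda>y. c * Q y)" if "c = of_real ((2 * pi) ^ (n * (n - 1)))" for c
    by (simp only: inner_v that)
  have c0: "c \<noteq> 0" if "c = of_real ((2 * pi) ^ (n * (n - 1)))" for c :: complex
    using that by simp
  have "integrable ?M (\<lambda>y. inverse c * (c * Q y))" if "c = of_real ((2 * pi) ^ (n * (n - 1)))" for c
    using c_int[OF that] by (rule integrable_mult_right)
  then have "integrable ?M (\<lambda>y. (inverse c * c) * Q y)" if "c = of_real ((2 * pi) ^ (n * (n - 1)))" for c
    using that by (simp only: mult.assoc)
  from this[OF refl] show "integrable ?M Q"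
    by (simp only: left_inverse[OF c0[OF refl]] mult_1_left)
  have R_case: "integrable (?M \<Otimes>\<^sub>M ?M) (case_prod (\<lambda>y v. R (y, v)))" using R_int by simp
  have "integrable ?M (\<lambda>v. LINT y|?M. R (y, v))" by (rule P.integrable_snd[OF R_case])
  then show "integrable ?M mb" by (simp only: inner_y)
  have "(LINT v|?M. LINT y|?M. R (y, v)) = (LINT y|?M. LINT v|?M. R (y, v))"
    by (rule P.Fubini_integral[OF R_case])
  then show "(LINT v|?M. mb v) = of_real ((2 * pi) ^ (n * (n - 1))) * (LINT y|?M. Q y)"
    by (simp only: inner_v inner_y integral_mult_right_zero)
qed

text \<open>All conditions defining the domain concern real parts, so it contains the whole plane
  through each of its points.\<close>

lemma domain_vertical_plane:
  assumes "(G, D) \<in> analyticity_domain n"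
  shows "vertical_plane n (\<lambda>p. Re (G p)) (\<lambda>p. Re (D p)) \<subseteq> analyticity_domain n"
proof
  fix z assume "z \<in> vertical_plane n (\<lambda>p. Re (G p)) (\<lambda>p. Re (D p))"
  then obtain g d where z: "z = (g, d)" "g \<in> idx n \<rightarrow>\<^sub>E UNIV" "d \<in> idx n \<rightarrow>\<^sub>E UNIV"
    and eq: "\<And>p. p \<in> idx n \<Longrightarrow> Re (g p) = Re (G p) \<and> Re (d p) = Re (D p)"
    by (auto simp: vertical_plane_def)
  have e: "Re (entry n g k l) = Re (entry n G k l)" "Re (entry n d k l) = Re (entry n D k l)" for k l
    using eq by (auto simp: entry_def idx_def)
  have "Re (xi n g d k l) = Re (xi n G D k l)" "Re (eta n g d k l) = Re (eta n G D k l)" for k l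
    by (simp_all add: xi_def eta_def e)
  then show "z \<in> analyticity_domain n"
    using assms z unfolding analyticity_domain_def by (simp add: e)
qed

text \<open>The wave integrand is built from definite descriptions, so its measurability is taken
  from the explicit function \<open>f\<close>, which is \<open>Q\<close> in multiplicative
  coordinates divided by the Jacobian and agrees with it on the positive region.\<close>

lemma wave_integral_slots:
  fixes lam x :: "nat \<Rightarrow> real"
  assumes n: "n \<ge> 2"
  defines "Q \<equiv> \<lambda>y. phase n lam y * (\<Prod>k\<in>slots n. of_real (exp (- exp (- (y k + shift_of n x k)))))"
    and "C \<equiv> torus_char n (whittaker_param n lam) (\<lambda>k. exp (- x k))"
  assumes Q: "integrable (PiR (slots n)) Q"
  shows "set_integrable (array_measure n) (positive_region n) (wave_integrand n lam x)"
    and "(LINT ts:positive_region n|array_measure n. wave_integrand n lam x ts) = C * (LINT y|PiR (slots n). Q y)"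
proof -
  let ?M = "PiR (slots n)"
  let ?P = "{z :: slot \<Rightarrow> real. \<forall>k\<in>slots n. z k > 0}"
  define f where "f z = (\<Prod>k\<in>slots n. 1 / z k) *\<^sub>R (C * Q (\<lambda>k\<in>slots n. - ln (z k)))" for z :: "slot \<Rightarrow> real"
  have comp: "(\<lambda>y. y k) \<in> borel_measurable ?M" if "k \<in> slots n" for k
    using measurable_component_singleton[OF that, of "\<lambda>_. lborel"] by simp
  have mQ: "Q \<in> borel_measurable ?M" using Q by auto
  have "(\<lambda>z. \<lambda>k\<in>slots n. - ln (z k)) \<in> measurable ?M ?M"
    using comp by (intro measurable_restrict) auto
  from measurable_compose[OF this mQ] have "(\<lambda>z. Q (\<lambda>k\<in>slots n. - ln (z k))) \<in> borel_measurable ?M" .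
  then have mf: "f \<in> borel_measurable ?M"
    unfolding f_def[abs_def] using comp by (intro borel_measurable_scaleR borel_measurable_prod borel_measurable_times) auto
  have P: "?P \<inter> space ?M \<in> sets ?M"
  proof -
    have "?P \<inter> space ?M = {z \<in> space ?M. \<forall>k\<in>slots n. z k > 0}" by auto
    also have "\<dots> \<in> sets ?M" using comp by (intro sets.sets_Collect_finite_All borel_measurable_less finite_slots) auto
    finally show ?thesis .
  qed
  have mF: "(\<lambda>z. indicat_real ?P z *\<^sub>R f z) \<in> borel_measurable ?M"
    using mf P by (intro borel_measurable_scaleR borel_measurable_indicator') auto
  have eq: "indicat_real (positive_region n) ts *\<^sub>R wave_integrand n lam x ts
      = indicat_real ?P (join n (sw n) ts) *\<^sub>R f (join n (sw n) ts)" if ts: "ts \<in> space (array_measure n)" for ts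
  proof -
    obtain t s where tse: "ts = (t, s)" by force
    define z where "z = join n (sw n) ts"
    have z: "z (p, c) = (if c = sw n p then t p else s p)" if "p \<in> idx n" for p c
      using that by (simp add: z_def join_def tse)
    have pos: "ts \<in> positive_region n \<longleftrightarrow> z \<in> ?P"
    proof -
      have "(\<forall>k\<in>slots n. z k > 0) \<longleftrightarrow> (\<forall>p\<in>idx n. t p > 0 \<and> s p > 0)"
      proof
        assume h: "\<forall>k\<in>slots n. z k > 0"
        show "\<forall>p\<in>idx n. t p > 0 \<and> s p > 0"
        proof
          fix p assume p: "p \<in> idx n"
          then have "z (p, sw n p) > 0" "z (p, \<not> sw n p) > 0" using h by auto
          then show "t p > 0 \<and> s p > 0" using z[OF p] by simp
        qed
      next
        assume h: "\<forall>p\<in>idx n. t p > 0 \<and> s p > 0"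
        show "\<forall>k\<in>slots n. z k > 0"
        proof
          fix k assume k: "k \<in> slots n"
          then show "z k > 0" using h z[of "fst k" "snd k"] by (cases k) auto
        qed
      qed
      then show ?thesis using ts by (auto simp: positive_region_def positive_array_def tse)
    qed
    show ?thesis
    proof (cases "z \<in> ?P")
      case True
      define y where "y = (\<lambda>k\<in>slots n. - ln (z k))"
      have zk: "z k > 0" if "k \<in> slots n" for k using True that by simp
      have ey: "exp (- y k) = z k" if "k \<in> slots n" for k using zk[OF that] that by (simp add: y_def)
      have W: "wave_integrand n lam x ts = wave_integrand n lam x (gpart n (g_of y) (d_of y), dpart n (g_of y) (d_of y))"
        unfolding tse by (rule wave_integrand_cong) (auto simp: gpart_def dpart_def g_of_def d_of_def ey z)
      have p0: "(\<Prod>k\<in>slots n. exp (- y k)) \<noteq> 0" by simp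
      have "wave_integrand n lam x ts = (\<Prod>k\<in>slots n. 1 / exp (- y k)) *\<^sub>R ((\<Prod>k\<in>slots n. exp (- y k)) *\<^sub>R wave_integrand n lam x ts)"
        using p0 by (simp add: prod_dividef)
      also have "\<dots> = (\<Prod>k\<in>slots n. 1 / exp (- y k)) *\<^sub>R (C * Q y)"
        unfolding W wave_integrand_log[OF n] by (simp only: C_def Q_def)
      also have "(\<Prod>k\<in>slots n. 1 / exp (- y k)) = (\<Prod>k\<in>slots n. 1 / z k)"
        by (intro prod.cong refl) (simp add: ey)
      finally have "wave_integrand n lam x ts = f z" by (simp only: f_def y_def)
      then show ?thesis using True pos by (simp add: z_def)
    next
      case False
      then show ?thesis using pos by (simp add: z_def)
    qed
  qed
  note A = integral_array_slots[where F = "\<lambda>ts. indicat_real (positive_region n) ts *\<^sub>R wave_integrand n lam x ts" and w = "sw n", OF mF eq]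
  note X = integral_PiR_exp_minus[OF finite_slots mf]
  have subst_back: "(\<Prod>k\<in>slots n. exp (- y k)) *\<^sub>R f (\<lambda>k\<in>slots n. exp (- y k)) = C * Q y" if y: "y \<in> space ?M" for y
  proof -
    have "(\<lambda>k\<in>slots n. - ln ((\<lambda>k\<in>slots n. exp (- y k)) k)) = y"
      using y by (auto simp: space_PiM PiE_def extensional_def fun_eq_iff restrict_def)
    moreover have "(\<Prod>k\<in>slots n. exp (- y k)) * (\<Prod>k\<in>slots n. 1 / (\<lambda>k\<in>slots n. exp (- y k)) k) = 1"
      unfolding prod.distrib[symmetric] by (intro prod.neutral) simp
    ultimately show ?thesis by (simp only: f_def scaleR_scaleR scaleR_one)
  qed
  have "integrable ?M (\<lambda>y. C * Q y)" using Q by simp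
  then have "integrable ?M (\<lambda>y. (\<Prod>k\<in>slots n. exp (- y k)) *\<^sub>R f (\<lambda>k\<in>slots n. exp (- y k)))"
    by (rule Bochner_Integration.integrable_cong[OF refl subst_back, THEN iffD2, rotated])
  then show "set_integrable (array_measure n) (positive_region n) (wave_integrand n lam x)"
    unfolding set_integrable_def using A(1) X(1) by blast
  have "(LINT ts:positive_region n|array_measure n. wave_integrand n lam x ts) = (LINT y|?M. (\<Prod>k\<in>slots n. exp (- y k)) *\<^sub>R f (\<lambda>k\<in>slots n. exp (- y k)))"
    unfolding set_lebesgue_integral_def by (rule trans[OF A(2) X(2)])
  also have "\<dots> = (LINT y|?M. C * Q y)" by (rule Bochner_Integration.integral_cong[OF refl subst_back])
  finally show "(LINT ts:positive_region n|array_measure n. wave_integrand n lam x ts) = C * (LINT y|?M. Q y)"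
    by simp
qed

lemma plane_integral_slots:
  fixes lam x :: "nat \<Rightarrow> real"
  assumes n: "n \<ge> 2" and sub: "vertical_plane n a b \<subseteq> analyticity_domain n"
  defines "Q \<equiv> \<lambda>y. phase n lam y * (\<Prod>k\<in>slots n. of_real (exp (- exp (- (y k + shift_of n x k)))))"
  shows "plane_integrable n a b (mb_integrand n lam x)"
    and "plane_integral n a b (mb_integrand n lam x) = (2 * pi * \<i>) ^ (n * (n - 1)) * (LINT y|PiR (slots n). Q y)"
proof -
  define mb where "mb v = mb_integrand n lam x (plane_point n a (\<lambda>p. v (p, False))) (plane_point n b (\<lambda>p. v (p, True)))"
    for v :: "slot \<Rightarrow> real"
  note MB = mellin_barnes[OF n sub, of lam x, folded mb_def[abs_def] Q_def]
  have eq: "(case ts of (y, z) \<Rightarrow> mb_integrand n lam x (plane_point n a y) (plane_point n b z)) = mb (join n (\<lambda>_. False) ts)"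
    if "ts \<in> space (array_measure n)" for ts
  proof -
    have "plane_point n a (\<lambda>p. join n (\<lambda>_. False) ts (p, False)) = plane_point n a (fst ts)"
      "plane_point n b (\<lambda>p. join n (\<lambda>_. False) ts (p, True)) = plane_point n b (snd ts)"
      by (auto simp: plane_point_def join_def fun_eq_iff)
    then show ?thesis by (simp add: mb_def case_prod_unfold)
  qed
  note A = integral_array_slots[OF borel_measurable_integrable[OF MB(1)] eq]
  show "plane_integrable n a b (mb_integrand n lam x)"
    unfolding plane_integrable_def using A(1) MB(1) by blast
  show "plane_integral n a b (mb_integrand n lam x) = (2 * pi * \<i>) ^ (n * (n - 1)) * (LINT y|PiR (slots n). Q y)"
  proof -
    have "plane_integral n a b (mb_integrand n lam x) = \<i> ^ (n * (n - 1)) * (LINT v|PiR (slots n). mb v)"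
      using A(2) by (simp add: plane_integral_def)
    then show ?thesis unfolding MB(3) by (simp add: power_mult_distrib)
  qed
qed

theorem theorem4p2:
  fixes n :: nat and lam x :: "nat \<Rightarrow> real"
  assumes "n \<ge> 2"
  shows "set_integrable (array_measure n) (positive_region n) (wave_integrand n lam x)
    \<and> analyticity_domain n \<noteq> {}
    \<and> (\<forall>(g, d) \<in> analyticity_domain n. \<forall>p \<in> idx n.
          (\<lambda>z. mb_integrand n lam x (g(p := z)) d) analytic_on {g p} \<and>
          (\<lambda>z. mb_integrand n lam x g (d(p := z))) analytic_on {d p})
    \<and> (\<forall>a b. vertical_plane n a b \<subseteq> analyticity_domain n \<longrightarrow>
          plane_integrable n a b (mb_integrand n lam x) \<and>
          whittaker_wave n lam x =
            exp (- \<i> * complex_of_real (\<Sum>k=1..n. lam k * x k)) / (2 * pi * \<i>) ^ (n * (n - 1))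
            * plane_integral n a b (mb_integrand n lam x))"
proof (intro conjI)
  define Q where "Q y = phase n lam y * (\<Prod>k\<in>slots n. of_real (exp (- exp (- (y k + shift_of n x k)))))" for y
  define C where "C = torus_char n (whittaker_param n lam) (\<lambda>k. exp (- x k))"
  \<comment> \<open>Convergence of the wave integral refers to no plane, but it is obtained from
    \<open>mellin_barnes\<close> for the plane through some point of the domain.\<close>
  obtain G D where GD: "(G, D) \<in> analyticity_domain n"
    using analyticity_domain_nonempty[of n] by auto
  have "integrable (PiR (slots n)) Q"
    using mellin_barnes(2)[OF assms domain_vertical_plane[OF GD]] by (simp add: Q_def[abs_def])
  note W = wave_integral_slots[OF assms this[unfolded Q_def[abs_def]], folded Q_def[abs_def] C_def]
  show "set_integrable (array_measure n) (positive_region n) (wave_integrand n lam x)" by (rule W(1))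
  show "analyticity_domain n \<noteq> {}" by (rule analyticity_domain_nonempty)
  show "\<forall>(g, d) \<in> analyticity_domain n. \<forall>p \<in> idx n.
          (\<lambda>z. mb_integrand n lam x (g(p := z)) d) analytic_on {g p} \<and>
          (\<lambda>z. mb_integrand n lam x g (d(p := z))) analytic_on {d p}"
  proof (clarify, intro conjI)
    fix g d i j assume gd: "(g, d) \<in> analyticity_domain n"
    show "(\<lambda>z. mb_integrand n lam x (g((i, j) := z)) d) analytic_on {g (i, j)}"
      using gd by (intro mb_integrand_analytic entry_upd_analytic analytic_on_const) simp
    show "(\<lambda>z. mb_integrand n lam x g (d((i, j) := z))) analytic_on {d (i, j)}"
      using gd by (intro mb_integrand_analytic entry_upd_analytic analytic_on_const) simp
  qed
  \<comment> \<open>Since mu = i lambda - rho and T = exp (- x), the prefactor with rho cancels the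
    rho part of the character.\<close>
  have C: "complex_of_real (exp (- (\<Sum>k=1..n. rho n k * x k))) * C = exp (- \<i> * complex_of_real (\<Sum>k=1..n. lam k * x k))"
  proof -
    have "(\<Sum>k=1..n. whittaker_param n lam k * of_real (- x k)) = of_real (\<Sum>k=1..n. rho n k * x k) - \<i> * of_real (\<Sum>k=1..n. lam k * x k)"
      unfolding of_real_sum sum_distrib_left sum_subtractf[symmetric]
      by (intro sum.cong refl) (simp add: whittaker_param_def algebra_simps)
    then show ?thesis
      unfolding C_def torus_char_exp(1) exp_of_real[symmetric] exp_add[symmetric] by simp
  qed
  \<comment> \<open>The integral of \<open>Q\<close> is common to all planes. Comparing each plane
    with it takes the place of a deformation of the cycle.\<close>
  have wave: "whittaker_wave n lam x = exp (- \<i> * complex_of_real (\<Sum>k=1..n. lam k * x k)) * (LINT y|PiR (slots n). Q y)"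
    unfolding whittaker_wave_def W(2) C[symmetric] by (simp only: mult.assoc)
  show "\<forall>a b. vertical_plane n a b \<subseteq> analyticity_domain n \<longrightarrow>
          plane_integrable n a b (mb_integrand n lam x) \<and>
          whittaker_wave n lam x =
            exp (- \<i> * complex_of_real (\<Sum>k=1..n. lam k * x k)) / (2 * pi * \<i>) ^ (n * (n - 1))
            * plane_integral n a b (mb_integrand n lam x)"
  proof (intro allI impI conjI)
    fix a b assume sub: "vertical_plane n a b \<subseteq> analyticity_domain n"
    note P = plane_integral_slots[OF assms sub, of lam x, folded Q_def[abs_def]]
    show "plane_integrable n a b (mb_integrand n lam x)" by (rule P(1))
    have "(2 * pi * \<i>) ^ (n * (n - 1)) \<noteq> (0 :: complex)" by simp
    then show "whittaker_wave n lam x =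
            exp (- \<i> * complex_of_real (\<Sum>k=1..n. lam k * x k)) / (2 * pi * \<i>) ^ (n * (n - 1))
            * plane_integral n a b (mb_integrand n lam x)"
      unfolding wave P(2) by simp
  qed
qed

end
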